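(* Let $x>0$, let $\alpha,\beta$ be non-negative integers, and let $s,w$ be complex numbers. For $\sigma,\theta\in(0,1)$ consider the double series $$G^{\alpha,\beta}(x,\sigma,\theta,s,w):=\sum_{m=0}^{\infty}\sum_{n=0}^{\infty}\frac{\partial^{\alpha+\beta}}{\partial\sigma^{\alpha}\partial\theta^{\beta}}\Bigg\{\frac{J_1(4\pi\sqrt{(m+\sigma)(n+\theta)x})}{(m+\sigma)^s(n+\theta)^w}+\frac{J_1(4\pi\sqrt{(m+1-\sigma)(n+\theta)x})}{(m+1-\sigma)^s(n+\theta)^w}$$ $$-\frac{J_1(4\pi\sqrt{(m+\sigma)(n+1-\theta)x})}{(m+\sigma)^s(n+1-\theta)^w}-\frac{J_1(4\pi\sqrt{(m+1-\sigma)(n+1-\theta)x})}{(m+1-\sigma)^s(n+1-\theta)^w}\Bigg\}.$$ Assume that $$4\operatorname{Re}(s)+2\alpha-2\beta>1\qquad\text{and}\qquad 4\operatorname{Re}(w)+2\beta-2\alpha>1.$$ Moreover, if $x$ is an integer, assume that $\operatorname{Re}(s)+\operatorname{Re}(w)>\frac{25}{26}$, while if $x$ is not an integer, assume that $\operatorname{Re}(s)+\operatorname{Re}(w)>\frac56$. Then the double series $G^{\alpha,\beta}(x,\sigma,\theta,s,w)$ converges uniformly with respect to $(\sigma,\theta)$ in any compact subset of $(0,1)^2$.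
   Context: $J_\nu$ is the ordinary Bessel function (of the first kind) of order $\nu$. The double series is an iterated series, with inner sum over $n$ and outer sum over $m$; for each $(m,n)$ the four-term bracket is taken as a single summand. *)

theory Defs
  imports "HOL-Analysis.Analysis"
begin

text \<open>
  The Bessel function of the first kind, by its power series. Here \<open>rGamma\<close> is the entire
  function 1/Gamma, so negative integer orders are covered as well. The value at \<open>z = 0\<close>
  is not the usual one for \<open>\<nu> = 0\<close>, because \<open>0 powr 0 = 0\<close>; for \<open>\<nu> = 1\<close> the function is
  the usual entire function.
\<close>
definition bessel_J :: "complex \<Rightarrow> complex \<Rightarrow> complex" where
  "bessel_J \<nu> z = (z / 2) powr \<nu> *
     (\<Sum>k. (- 1) ^ k * rGamma (\<nu> + of_nat k + 1) / fact k * (z / 2) ^ (2 * k))"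

definition higher_vector_derivative :: "nat \<Rightarrow> (real \<Rightarrow> complex) \<Rightarrow> real \<Rightarrow> complex" where
  "higher_vector_derivative k f = ((\<lambda>g t. vector_derivative g (at t)) ^^ k) f"

definition mixed_partial ::
    "nat \<Rightarrow> nat \<Rightarrow> (real \<Rightarrow> real \<Rightarrow> complex) \<Rightarrow> real \<Rightarrow> real \<Rightarrow> complex" where
  "mixed_partial \<alpha> \<beta> F \<sigma> \<theta> =
     higher_vector_derivative \<alpha> (\<lambda>u. higher_vector_derivative \<beta> (\<lambda>v. F u v) \<theta>) \<sigma>"

definition J1_quotient :: "real \<Rightarrow> complex \<Rightarrow> complex \<Rightarrow> real \<Rightarrow> real \<Rightarrow> complex" where
  "J1_quotient x s w a b =
     bessel_J 1 (of_real (4 * pi * sqrt (a * b * x))) / (of_real a powr s * of_real b powr w)"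

definition G_bracket ::
    "real \<Rightarrow> complex \<Rightarrow> complex \<Rightarrow> nat \<Rightarrow> nat \<Rightarrow> real \<Rightarrow> real \<Rightarrow> complex" where
  "G_bracket x s w m n \<sigma> \<theta> =
       J1_quotient x s w (real m + \<sigma>) (real n + \<theta>)
     + J1_quotient x s w (real m + 1 - \<sigma>) (real n + \<theta>)
     - J1_quotient x s w (real m + \<sigma>) (real n + 1 - \<theta>)
     - J1_quotient x s w (real m + 1 - \<sigma>) (real n + 1 - \<theta>)"

definition G_term ::
    "nat \<Rightarrow> nat \<Rightarrow> real \<Rightarrow> real \<Rightarrow> real \<Rightarrow> complex \<Rightarrow> complex \<Rightarrow> nat \<Rightarrow> nat \<Rightarrow> complex" where
  "G_term \<alpha> \<beta> x \<sigma> \<theta> s w m n = mixed_partial \<alpha> \<beta> (G_bracket x s w m n) \<sigma> \<theta>"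

text \<open>
  Uniform convergence on \<open>K\<close> of an iterated series of functions, inner index \<open>n\<close>, outer
  index \<open>m\<close>: every inner series converges uniformly, and so does the outer series of the
  inner sums.
\<close>
definition iterated_series_uniform_on :: "'a set \<Rightarrow> (nat \<Rightarrow> nat \<Rightarrow> 'a \<Rightarrow> complex) \<Rightarrow> bool" where
  "iterated_series_uniform_on K f \<longleftrightarrow>
     (\<forall>m. uniform_limit K (\<lambda>N p. \<Sum>n<N. f m n p) (\<lambda>p. \<Sum>n. f m n p) sequentially) \<and>
     uniform_limit K (\<lambda>M p. \<Sum>m<M. \<Sum>n. f m n p) (\<lambda>p. \<Sum>m. \<Sum>n. f m n p) sequentially"

end

theory Submission
  imports Defs "HOL-Complex_Analysis.Complex_Analysis"
begin

text \<open>
  Write \<open>a = m + \<sigma>\<close> and \<open>b = n + \<theta>\<close>, or these with \<open>1 - \<sigma>\<close>, \<open>1 - \<theta>\<close>, and let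
  \<open>p = \<alpha> + \<beta>\<close>. The asymptotics of \<open>J\<^sub>1\<close> and \<open>J\<^sub>0\<close> show that the mixed derivative of one of the
  four terms of the bracket is, up to a constant factor and the sign that the reflections produce,
  \<open>\<i> ^ p V H + (- \<i>) ^ p V' H'\<close>, where \<open>H = a\<^sup>z b\<^sup>v exp (4 \<pi> \<i> sqrt (a b x))\<close> with
  \<open>z = - s - (\<alpha> - \<beta>) / 2 - 1 / 4\<close> and \<open>v = - w - (\<beta> - \<alpha>) / 2 - 1 / 4\<close>, \<open>V\<close> is a constant, \<open>V'\<close> is its
  conjugate and \<open>H'\<close> is \<open>H\<close> with the opposite phase. The error is smaller by the factor
  \<open>(a b) powr (- 1 / 2)\<close> (\<open>G_term_eq\<close>, \<open>bessel_term_asymptotic\<close>). The first two conditions on the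
  exponents say that \<open>Re z\<close> and \<open>Re v\<close> are below \<open>- 1 / 2\<close>. Hence the error is summable absolutely
  in both variables, and the exponential sums over \<open>H\<close> remain. The lemmas on these sums write \<open>w\<close>
  for the exponent \<open>v\<close> of \<open>b\<close>.

  As a function of \<open>b\<close>, the phase of \<open>H\<close> has frequency \<open>2 \<pi> sqrt (a x / b)\<close>; as a function of
  \<open>a\<close>, it has frequency \<open>2 \<pi> sqrt (b x / a)\<close>. A sum over points at distance one is close to an
  integral as long as the frequency is at most \<open>3 \<pi> / 2\<close> in absolute value (\<open>osc_sum_integral\<close>).
  Fix \<open>K \<ge> 2 x\<close> and cut the range of \<open>b\<close> where its frequency is \<open>2 \<pi> (k + 1 / 2)\<close>, \<open>0 \<le> k \<le> K\<close>.
  The cut for \<open>k = 0\<close> is the largest; beyond it the frequency is below \<open>\<pi>\<close>, and one integration by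
  parts bounds the sum. Between the cuts for \<open>k\<close> and \<open>k - 1\<close>, subtracting the frequency \<open>2 \<pi> k\<close>
  changes the terms only by the constant factor \<open>exp (2 \<pi> \<i> k \<theta>)\<close>, and the resulting integral has
  one stationary point. In the variable \<open>sqrt b\<close> its phase is exactly quadratic, and a Fresnel
  integral gives the contribution \<open>const exp (2 \<pi> \<i> (k \<theta> + a x / k)) a powr (z + v + 1 / 2)\<close>, with an
  error \<open>O(a powr (Re z + Re v))\<close> that is summable over \<open>m\<close> (\<open>osc_tail_asymptotic\<close>). Below the cut
  for \<open>k = K\<close> the sums are exchanged: there the frequency in \<open>a\<close> is at most \<open>\<pi>\<close>, and
  integration by parts in \<open>a\<close> works (\<open>low_part_bound\<close>).

  It remains to sum the contributions of the finitely many stationary points over \<open>m\<close>. If \<open>x / k\<close>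
  is not an integer, then \<open>exp (2 \<pi> \<i> a x / k)\<close> oscillates, and the sum converges because the
  exponent \<open>z + v + 1 / 2\<close> has negative real part (\<open>resonance_uniform_nonintegral\<close>). If \<open>x / k\<close> is an
  integer, there is no oscillation, but the contributions of the four terms of the bracket cancel
  up to a summable error (\<open>resonance_cancellation\<close>). The cancellation depends on the phase of \<open>V\<close>:
  it holds because \<open>V\<close> times the Fresnel constant is real, which follows from the value
  \<open>- \<i> \<pi> / 4\<close> of the square of the Fresnel constant (\<open>fresnel_const_square\<close>).
\<close>

section \<open>Comparison of a sum with an integral\<close>

text \<open>This is the integral of \<open>exp (z t)\<close> over \<open>0 \<le> t \<le> 1\<close>.\<close>
definition exp_quotient :: "complex \<Rightarrow> complex" where
  "exp_quotient z = (if z = 0 then 1 else (exp z - 1) / z)"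

text \<open>
  The holomorphic extension of \<open>1 / (exp z - 1) - 1 / z\<close>. On the function \<open>exp (z t)\<close>, the first
  summand inverts the difference operator with step one and the second inverts the derivative. The
  kernel therefore measures the difference between a sum and an integral of \<open>exp (z t)\<close> by
  boundary values alone; for general functions it plays the part of the Euler-Maclaurin expansion.
\<close>
definition euler_kernel :: "complex \<Rightarrow> complex" where
  "euler_kernel z = (if z = 0 then deriv (\<lambda>z. inverse (exp_quotient z)) 0
                     else (inverse (exp_quotient z) - 1) / z)"

lemma exp_quotient_holomorphic: "exp_quotient holomorphic_on UNIV"
proof -
  have "(\<lambda>z. if z = 0 then deriv exp 0 else (exp z - exp 0) / (z - 0)) holomorphic_on (UNIV :: complex set)"
    by (rule pole_lemma) (auto intro: holomorphic_intros)
  moreover have "deriv exp (0::complex) = 1"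
    by (simp add: DERIV_imp_deriv[OF DERIV_exp])
  ultimately show ?thesis
    by (simp add: exp_quotient_def[abs_def] cong: if_cong)
qed

lemma exp_quotient_nonzero:
  assumes "norm z < 2 * pi"
  shows "exp_quotient z \<noteq> 0"
proof (cases "z = 0")
  case False
  have "exp z \<noteq> 1"
  proof
    assume "exp z = 1"
    then obtain n :: int where n: "Re z = 0" "Im z = of_int (2 * n) * pi"
      by (auto simp: exp_eq_1)
    then have "norm z = \<bar>of_int n\<bar> * (2 * pi)"
      by (simp add: norm_complex_def abs_mult)
    with assms have "\<bar>real_of_int n\<bar> * (2 * pi) < 1 * (2 * pi)"
      by simp
    then have "\<bar>real_of_int n\<bar> < 1"
      by (simp only: mult_less_cancel_right) simp
    then have "n = 0" by linarith
    with n False show False by (simp add: complex_eq_iff)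
  qed
  with False show ?thesis by (simp add: exp_quotient_def)
qed (simp add: exp_quotient_def)

lemma euler_kernel_holomorphic: "euler_kernel holomorphic_on ball 0 (2 * pi)"
proof -
  have "(\<lambda>z. inverse (exp_quotient z)) holomorphic_on ball 0 (2 * pi)"
    using exp_quotient_nonzero
    by (intro holomorphic_on_inverse holomorphic_on_subset[OF exp_quotient_holomorphic]) auto
  then have "(\<lambda>z. if z = 0 then deriv (\<lambda>z. inverse (exp_quotient z)) 0 else
      (inverse (exp_quotient z) - inverse (exp_quotient 0)) / (z - 0)) holomorphic_on ball 0 (2 * pi)"
    by (rule pole_lemma) auto
  moreover have "exp_quotient 0 = 1" by (simp add: exp_quotient_def)
  ultimately show ?thesis
    by (simp add: euler_kernel_def[abs_def] cong: if_cong)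
qed

lemma euler_kernel_eq:
  assumes "norm z < 2 * pi"
  shows "(exp z - 1) * euler_kernel z = 1 - exp_quotient z"
proof (cases "z = 0")
  case False
  have "exp z - 1 = z * exp_quotient z"
    using False by (simp add: exp_quotient_def)
  then show ?thesis
    using False exp_quotient_nonzero[OF assms]
    by (simp add: euler_kernel_def field_simps)
qed (simp add: exp_quotient_def)

text \<open>
  The radius \<open>7 \<pi> / 4\<close> is below \<open>2 \<pi>\<close>, and it leaves room for a frequency up to \<open>3 \<pi> / 2\<close> and
  a small amplitude term in a logarithmic derivative.
\<close>
lemma euler_kernel_bounded_Lipschitz:
  obtains C where "C > 0" "\<And>z. norm z \<le> 7 * pi / 4 \<Longrightarrow> norm (euler_kernel z) \<le> C"
    "\<And>z w. norm z \<le> 7 * pi / 4 \<Longrightarrow> norm w \<le> 7 * pi / 4 \<Longrightarrow>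
       norm (euler_kernel z - euler_kernel w) \<le> C * norm (z - w)"
proof -
  let ?B = "cball 0 (7 * pi / 4) :: complex set"
  have sub: "?B \<subseteq> ball 0 (2 * pi)"
  proof
    fix z assume "z \<in> ?B"
    then have "norm z \<le> 7 * pi / 4" by simp
    then have "norm z < 2 * pi" using pi_gt_zero by linarith
    then show "z \<in> ball 0 (2 * pi)" by simp
  qed
  have hol: "euler_kernel holomorphic_on ball 0 (2 * pi)" by (rule euler_kernel_holomorphic)
  have c1: "continuous_on ?B euler_kernel"
    using holomorphic_on_imp_continuous_on[OF hol] continuous_on_subset sub by blast
  have c2: "continuous_on ?B (deriv euler_kernel)"
    using holomorphic_on_imp_continuous_on[OF holomorphic_deriv[OF hol open_ball]]
      continuous_on_subset sub by blast
  obtain C1 where C1: "\<And>z. z \<in> ?B \<Longrightarrow> norm (euler_kernel z) \<le> C1"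
    using compact_imp_bounded[OF compact_continuous_image[OF c1 compact_cball]]
    unfolding bounded_iff by blast
  obtain C2 where C2: "\<And>z. z \<in> ?B \<Longrightarrow> norm (deriv euler_kernel z) \<le> C2"
    using compact_imp_bounded[OF compact_continuous_image[OF c2 compact_cball]]
    unfolding bounded_iff by blast
  define C where "C = \<bar>C1\<bar> + \<bar>C2\<bar> + 1"
  show ?thesis
  proof
    show "C > 0" by (simp add: C_def)
    show "norm (euler_kernel z) \<le> C" if "norm z \<le> 7 * pi / 4" for z
      using C1[of z] that by (simp add: C_def)
    show "norm (euler_kernel z - euler_kernel w) \<le> C * norm (z - w)"
      if "norm z \<le> 7 * pi / 4" "norm w \<le> 7 * pi / 4" for z w
    proof (rule field_differentiable_bound[where S = ?B and f' = "deriv euler_kernel"])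
      fix u assume "u \<in> ?B"
      then show "(euler_kernel has_field_derivative deriv euler_kernel u) (at u within ?B)"
        using holomorphic_derivI[OF hol open_ball] sub has_field_derivative_at_within by blast
      show "norm (deriv euler_kernel u) \<le> C"
        using C2[OF \<open>u \<in> ?B\<close>] by (simp add: C_def)
    qed (use that in auto)
  qed
qed

lemma integral_exp_unit:
  "((\<lambda>t. exp (l * of_real (t - t0))) has_integral exp_quotient l) {t0..t0 + 1 :: real}"
proof (cases "l = 0")
  case True
  then show ?thesis
    using has_integral_const_real[of "1::complex" t0 "t0 + 1"] by (simp add: exp_quotient_def)
next
  case False
  have "((\<lambda>t. exp (l * of_real (t - t0))) has_integral
      exp (l * of_real (t0 + 1 - t0)) / l - exp (l * of_real (t0 - t0)) / l) {t0..t0 + 1}"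
  proof (rule fundamental_theorem_of_calculus)
    fix t :: real
    have "((\<lambda>z. exp (l * (z - of_real t0)) / l) has_field_derivative
        exp (l * (of_real t - of_real t0))) (at (of_real t))"
      using False by (auto intro!: derivative_eq_intros)
    from has_vector_derivative_real_field[OF this]
    show "((\<lambda>t. exp (l * of_real (t - t0)) / l) has_vector_derivative exp (l * of_real (t - t0)))
       (at t within {t0..t0 + 1})" by simp
  qed simp
  then show ?thesis using False by (simp add: exp_quotient_def diff_divide_distrib)
qed

lemma onorm_scaleR_le:
  fixes v :: "'a::real_normed_vector"
  assumes "norm v \<le> B"
  shows "onorm (\<lambda>h::real. h *\<^sub>R v) \<le> B"
proof (rule onorm_bound)
  show "B \<ge> 0" using order_trans[OF norm_ge_zero assms] .
  show "norm (h *\<^sub>R v) \<le> B * norm h" for h :: real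
    using mult_right_mono[OF assms, of "\<bar>h\<bar>"] by (simp add: mult.commute)
qed

text \<open>
  On a unit interval, a function with logarithmic derivative \<open>l\<close> differs by \<open>O(B M)\<close> from the
  exponential with the frozen exponent \<open>l t0\<close>, for which the left-hand side vanishes by
  \<open>euler_kernel_eq\<close>. Since \<open>euler_kernel\<close> is evaluated at \<open>l\<close> in both endpoints, the boundary terms
  of adjacent intervals telescope: the error of a long sum is governed by the variation of \<open>l\<close>.
\<close>
lemma sum_integral_step:
  obtains C where "C > 0"
    "\<And>F l l' t0 B M.
      (\<And>t. t \<in> {t0..t0 + 1} \<Longrightarrow> (F has_vector_derivative l t * F t) (at t within {t0..t0 + 1})) \<Longrightarrow>
      (\<And>t. t \<in> {t0..t0 + 1} \<Longrightarrow> (l has_vector_derivative l' t) (at t within {t0..t0 + 1})) \<Longrightarrow>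
      (\<And>t. t \<in> {t0..t0 + 1} \<Longrightarrow> norm (l t) \<le> 7 * pi / 4) \<Longrightarrow>
      (\<And>t. t \<in> {t0..t0 + 1} \<Longrightarrow> norm (l' t) \<le> B) \<Longrightarrow>
      (\<And>t. t \<in> {t0..t0 + 1} \<Longrightarrow> norm (F t) \<le> M) \<Longrightarrow>
      norm (F t0 - integral {t0..t0 + 1} F
        - (euler_kernel (l (t0 + 1)) * F (t0 + 1) - euler_kernel (l t0) * F t0)) \<le> C * B * M"
proof -
  obtain K where K: "K > 0" "\<And>z. norm z \<le> 7 * pi / 4 \<Longrightarrow> norm (euler_kernel z) \<le> K"
    "\<And>z w. norm z \<le> 7 * pi / 4 \<Longrightarrow> norm w \<le> 7 * pi / 4 \<Longrightarrow>
       norm (euler_kernel z - euler_kernel w) \<le> K * norm (z - w)"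
    by (rule euler_kernel_bounded_Lipschitz) (rule that)
  define R where "R = exp (7 * pi / 4)"
  have R: "R > 0" by (simp add: R_def)
  define C where "C = R * R + K + K * (R * R)"
  show ?thesis
  proof
    show "C > 0" using K(1) R by (simp add: C_def add_pos_pos)
    fix F l l' :: "real \<Rightarrow> complex" and t0 B M :: real
    let ?I = "{t0..t0 + 1}"
    assume F: "\<And>t. t \<in> ?I \<Longrightarrow> (F has_vector_derivative l t * F t) (at t within ?I)"
      and l: "\<And>t. t \<in> ?I \<Longrightarrow> (l has_vector_derivative l' t) (at t within ?I)"
      and l_le: "\<And>t. t \<in> ?I \<Longrightarrow> norm (l t) \<le> 7 * pi / 4"
      and B: "\<And>t. t \<in> ?I \<Longrightarrow> norm (l' t) \<le> B"
      and M: "\<And>t. t \<in> ?I \<Longrightarrow> norm (F t) \<le> M"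
    have B0: "B \<ge> 0" using order_trans[OF norm_ge_zero B[of t0]] by simp
    have M0: "M \<ge> 0" using order_trans[OF norm_ge_zero M[of t0]] by simp
    define L where "L = l t0"
    have L: "norm L \<le> 7 * pi / 4" using l_le[of t0] by (simp add: L_def)
    have l_near: "norm (l t - L) \<le> B" if t: "t \<in> ?I" for t
    proof -
      have "norm (l t - l t0) \<le> B * norm (t - t0)"
      proof (rule differentiable_bound[where S = ?I])
        fix s assume s: "s \<in> ?I"
        show "(l has_derivative (\<lambda>h. h *\<^sub>R l' s)) (at s within ?I)"
          using l[OF s] by (simp add: has_vector_derivative_def)
        show "onorm (\<lambda>h. h *\<^sub>R l' s) \<le> B"
          by (rule onorm_scaleR_le[OF B[OF s]])
      qed (use t in auto)
      also have "\<dots> \<le> B * 1" using t B0 by (intro mult_left_mono) auto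
      finally show ?thesis by (simp add: L_def)
    qed
    have exp_le: "norm (exp (z * of_real s)) \<le> R" if "norm z \<le> 7 * pi / 4" "\<bar>s\<bar> \<le> 1" for z :: complex and s
    proof -
      have "norm (exp (z * of_real s)) = exp (Re (z * of_real s))" by (rule norm_exp_eq_Re)
      also have "Re (z * of_real s) \<le> norm (z * of_real s)" by (rule complex_Re_le_cmod)
      also have "norm (z * of_real s) \<le> (7 * pi / 4) * 1"
        unfolding norm_mult using that by (intro mult_mono) auto
      finally show ?thesis by (simp add: R_def)
    qed
    \<comment> \<open>The error made by freezing the exponent.\<close>
    define D where "D t = F t - F t0 * exp (L * of_real (t - t0))" for t
    have D_le: "norm (D t) \<le> R * R * B * M" if t: "t \<in> ?I" for t
    proof -
      define G where "G t = F t * exp (- L * of_real (t - t0))" for t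
      have "norm (G t - G t0) \<le> (B * M * R) * norm (t - t0)"
      proof (rule differentiable_bound[where S = ?I])
        fix s assume s: "s \<in> ?I"
        have e: "((\<lambda>t. exp (- L * of_real (t - t0))) has_vector_derivative
             exp (- L * of_real (s - t0)) * (- L)) (at s within ?I)"
        proof -
          have "((\<lambda>z. exp (- L * (z - of_real t0))) has_field_derivative
             exp (- L * (of_real s - of_real t0)) * (- L)) (at (of_real s))"
            by (auto intro!: derivative_eq_intros)
          from has_vector_derivative_real_field[OF this] show ?thesis by simp
        qed
        have "(G has_vector_derivative (l s - L) * G s) (at s within ?I)"
          unfolding G_def
          by (rule has_vector_derivative_eq_rhs[OF has_vector_derivative_mult[OF F[OF s] e]])
             (simp add: algebra_simps)
        then show "(G has_derivative (\<lambda>h. h *\<^sub>R ((l s - L) * G s))) (at s within ?I)"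
          by (simp add: has_vector_derivative_def)
        have "norm (G s) \<le> M * R"
          unfolding G_def norm_mult using M[OF s] M0 exp_le[of "-L" "s - t0"] L s
          by (intro mult_mono) auto
        then have "norm ((l s - L) * G s) \<le> B * (M * R)"
          unfolding norm_mult using l_near[OF s] B0 by (intro mult_mono) auto
        then show "onorm (\<lambda>h. h *\<^sub>R ((l s - L) * G s)) \<le> B * M * R"
          by (intro onorm_scaleR_le) (simp add: mult_ac)
      qed (use t in auto)
      also have "\<dots> \<le> (B * M * R) * 1" using t B0 M0 R by (intro mult_left_mono) auto
      finally have G: "norm (G t - F t0) \<le> B * M * R" by (simp add: G_def)
      have "D t = (G t - F t0) * exp (L * of_real (t - t0))"
      proof -
        have "exp (- L * of_real (t - t0)) * exp (L * of_real (t - t0)) = 1"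
          by (simp add: exp_add[symmetric])
        then show ?thesis
          by (simp add: G_def D_def left_diff_distrib mult.assoc)
      qed
      then have "norm (D t) \<le> (B * M * R) * R"
        using G exp_le[of L "t - t0"] L t R B0 M0 by (simp add: norm_mult mult_mono)
      then show ?thesis by (simp add: mult_ac)
    qed
    have F_cont: "continuous_on ?I F"
      using F by (intro continuous_on_vector_derivative) auto
    have e1: "norm (integral ?I D) \<le> R * R * B * M"
    proof -
      have "continuous_on ?I D" unfolding D_def by (intro continuous_intros F_cont)
      then have "norm (integral ?I D) \<le> (R * R * B * M) * (t0 + 1 - t0)"
        by (rule integral_bound[rotated]) (auto intro: D_le)
      then show ?thesis by simp
    qed
    have ID: "integral ?I D = integral ?I F - F t0 * exp_quotient L"
    proof -
      have "(D has_integral integral ?I F - F t0 * exp_quotient L) ?I"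
        unfolding D_def
        by (intro has_integral_diff integrable_integral integrable_continuous_real F_cont
            has_integral_mult_right integral_exp_unit)
      then show ?thesis by (rule integral_unique)
    qed
    let ?k0 = "euler_kernel L" and ?k1 = "euler_kernel (l (t0 + 1))"
    have D1: "F (t0 + 1) = F t0 * exp L + D (t0 + 1)" by (simp add: D_def)
    have L2: "norm L < 2 * pi" using L pi_gt_zero by linarith
    have "F t0 - integral ?I F - (?k1 * F (t0 + 1) - ?k0 * F t0)
        = F t0 * (1 - exp_quotient L) - ?k0 * (F t0 * (exp L - 1)) - integral ?I D
          - (?k1 - ?k0) * F (t0 + 1) - ?k0 * D (t0 + 1)"
      unfolding ID D1 by (simp add: algebra_simps)
    also have "F t0 * (1 - exp_quotient L) = ?k0 * (F t0 * (exp L - 1))"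
      unfolding euler_kernel_eq[OF L2, symmetric] by (simp add: mult_ac)
    finally have "norm (F t0 - integral ?I F - (?k1 * F (t0 + 1) - ?k0 * F t0))
       = norm (- integral ?I D - (?k1 - ?k0) * F (t0 + 1) - ?k0 * D (t0 + 1))" by simp
    also have "\<dots> \<le> norm (integral ?I D) + norm ((?k1 - ?k0) * F (t0 + 1)) + norm (?k0 * D (t0 + 1))"
      using norm_triangle_ineq4[of "- integral ?I D - (?k1 - ?k0) * F (t0 + 1)" "?k0 * D (t0 + 1)"]
        norm_triangle_ineq4[of "- integral ?I D" "(?k1 - ?k0) * F (t0 + 1)"] by simp
    also have "\<dots> \<le> R * R * B * M + K * B * M + K * (R * R * B * M)"
    proof (intro add_mono e1)
      have "norm (?k1 - ?k0) \<le> K * norm (l (t0 + 1) - L)"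
        using K(3)[of "l (t0 + 1)" L] l_le[of "t0 + 1"] L by simp
      also have "\<dots> \<le> K * B" using l_near[of "t0 + 1"] K(1) by simp
      finally show "norm ((?k1 - ?k0) * F (t0 + 1)) \<le> K * B * M"
        unfolding norm_mult using M[of "t0 + 1"] K(1) B0 by (intro mult_mono) auto
      show "norm (?k0 * D (t0 + 1)) \<le> K * (R * R * B * M)"
        unfolding norm_mult using K(2)[OF L] D_le[of "t0 + 1"] K(1) by (intro mult_mono) auto
    qed
    finally show "norm (F t0 - integral ?I F
        - (euler_kernel (l (t0 + 1)) * F (t0 + 1) - euler_kernel (l t0) * F t0)) \<le> C * B * M"
      by (simp add: C_def L_def algebra_simps)
  qed
qed

section \<open>Sums and integrals of oscillating powers\<close>

text \<open>
  This is \<open>t powr w\<close> times \<open>exp (\<i> (2 c sqrt t + d t))\<close>. It is written as a single exponential so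
  that its logarithmic derivative \<open>w / t + \<i> (c / sqrt t + d)\<close> can be read off. The parameter \<open>d\<close>
  serves to subtract a multiple of \<open>2 \<pi>\<close> from the frequency.
\<close>
definition osc :: "complex \<Rightarrow> real \<Rightarrow> real \<Rightarrow> real \<Rightarrow> complex" where
  "osc w c d t = exp (w * of_real (ln t) + \<i> * of_real (2 * c * sqrt t + d * t))"

lemma osc_eq: "t > 0 \<Longrightarrow> osc w c d t = of_real t powr w * cis (2 * c * sqrt t + d * t)"
  by (simp add: osc_def powr_def exp_add cis_conv_exp Ln_of_real)

lemma norm_osc: "t > 0 \<Longrightarrow> norm (osc w c d t) = t powr Re w"
  by (simp add: osc_eq norm_mult norm_powr_real_powr)

lemma osc_vector_derivative:
  assumes "t > 0"
  shows "(osc w c d has_vector_derivative (w / of_real t + \<i> * of_real (c / sqrt t + d)) * osc w c d t)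
    (at t within S)"
proof -
  have 1: "((\<lambda>t. of_real (ln t) :: complex) has_vector_derivative of_real (1 / t)) (at t within S)"
    using assms by (intro has_vector_derivative_of_real) (auto intro!: derivative_eq_intros)
  have 2: "((\<lambda>t. of_real (2 * c * sqrt t + d * t) :: complex) has_vector_derivative of_real (c / sqrt t + d)) (at t within S)"
    using assms by (intro has_vector_derivative_of_real)
      (auto intro!: derivative_eq_intros simp: field_simps)
  have "((\<lambda>t. w * of_real (ln t) + \<i> * of_real (2 * c * sqrt t + d * t)) has_vector_derivative
      w * of_real (1 / t) + \<i> * of_real (c / sqrt t + d)) (at t within S)"
    by (intro has_vector_derivative_add has_vector_derivative_mult_right 1 2)
  from field_vector_diff_chain_within[OF this has_field_derivative_at_within[OF DERIV_exp]] show ?thesis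
    by (simp add: o_def osc_def[abs_def] mult_ac)
qed

lemma osc_continuous_on: "S \<subseteq> {0<..} \<Longrightarrow> continuous_on S (osc w c d)"
  by (rule continuous_on_vector_derivative) (use osc_vector_derivative in blast)

lemma osc_integrable: "0 < p \<Longrightarrow> osc w c d integrable_on {p..q}"
  by (intro integrable_continuous_real osc_continuous_on) auto

lemma osc_integral_combine:
  assumes "0 < p" "p \<le> q" "q \<le> r"
  shows "integral {p..q} (osc w c d) + integral {q..r} (osc w c d) = integral {p..r} (osc w c d)"
  by (rule Henstock_Kurzweil_Integration.integral_combine) (use assms osc_integrable in auto)

lemma osc_integral_bound:
  assumes "0 < p" "p \<le> q" "Re w \<le> 0"
  shows "norm (integral {p..q} (osc w c d)) \<le> p powr Re w * (q - p)"
proof (rule integral_bound)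
  fix t assume "t \<in> {p..q}"
  then show "norm (osc w c d t) \<le> p powr Re w"
    using assms by (simp add: norm_osc powr_mono2')
next
  show "continuous_on {p..q} (osc w c d)" using assms by (intro osc_continuous_on) auto
qed (use assms in auto)

lemma log_derivative_osc_vector_derivative:
  assumes "t > 0"
  shows "((\<lambda>t. w / of_real t + \<i> * of_real (c / sqrt t + d)) has_vector_derivative
     - (w / of_real t ^ 2) - \<i> * of_real (c / (2 * t * sqrt t))) (at t within S)"
proof -
  have 1: "((\<lambda>t. of_real (1 / t) :: complex) has_vector_derivative of_real (- (1 / t ^ 2))) (at t within S)"
    using assms by (intro has_vector_derivative_of_real)
      (auto intro!: derivative_eq_intros simp: power2_eq_square)
  have 2: "((\<lambda>t. of_real (c / sqrt t + d) :: complex) has_vector_derivative of_real (- (c / (2 * t * sqrt t)))) (at t within S)"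
    using assms by (intro has_vector_derivative_of_real)
      (auto intro!: derivative_eq_intros simp: field_simps)
  have "((\<lambda>t. w * of_real (1 / t) + \<i> * of_real (c / sqrt t + d)) has_vector_derivative
      w * of_real (- (1 / t ^ 2)) + \<i> * of_real (- (c / (2 * t * sqrt t)))) (at t within S)"
    by (intro has_vector_derivative_add has_vector_derivative_mult_right 1 2)
  then show ?thesis by simp
qed

text \<open>
  Each term is at most four times the difference of \<open>1 / sqrt q\<close> at consecutive points, and these
  differences telescope.
\<close>
lemma sum_three_halves_le:
  assumes "p \<ge> 1"
  shows "(\<Sum>j<N. 1 / ((p + real j) * sqrt (p + real j))) \<le> 4 / sqrt p"
proof -
  have step: "1 / (q * sqrt q) \<le> 4 * (1 / sqrt q - 1 / sqrt (q + 1))" if "q \<ge> 1" for q :: real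
  proof -
    have q: "sqrt q > 0" "sqrt (q + 1) > 0" "sqrt q * sqrt q = q" "sqrt (q + 1) * sqrt (q + 1) = q + 1"
      using that by auto
    have le: "sqrt (q + 1) \<le> 3 / 2 * sqrt q"
      using that by (intro real_le_lsqrt) (auto simp: power_mult_distrib power_divide)
    have "(sqrt (q + 1) - sqrt q) * (sqrt (q + 1) + sqrt q) = 1"
      using q by (simp add: algebra_simps)
    then have d: "sqrt (q + 1) - sqrt q = 1 / (sqrt (q + 1) + sqrt q)"
      using q by (metis nonzero_eq_divide_eq add_pos_pos less_irrefl)
    have "sqrt (q + 1) * (sqrt (q + 1) + sqrt q) \<le> (3 / 2 * sqrt q) * (3 / 2 * sqrt q + sqrt q)"
      using le q by (intro mult_mono) auto
    also have "\<dots> = 15 / 4 * q" using q by simp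
    also have "\<dots> \<le> 4 * q" using that by simp
    finally have m: "sqrt (q + 1) * (sqrt (q + 1) + sqrt q) \<le> 4 * q" .
    have "1 / sqrt q - 1 / sqrt (q + 1) = (sqrt (q + 1) - sqrt q) / (sqrt q * sqrt (q + 1))"
      using q(1,2) by (simp add: diff_frac_eq)
    also have "\<dots> = 1 / (sqrt q * (sqrt (q + 1) * (sqrt (q + 1) + sqrt q)))"
      unfolding d by (simp add: mult_ac)
    finally have "1 / sqrt q - 1 / sqrt (q + 1) = 1 / (sqrt q * (sqrt (q + 1) * (sqrt (q + 1) + sqrt q)))" .
    also have "\<dots> \<ge> 1 / (sqrt q * (4 * q))"
      using q m that by (intro divide_left_mono mult_left_mono) (auto intro!: mult_pos_pos add_pos_pos)
    finally have "1 / (sqrt q * (4 * q)) \<le> 1 / sqrt q - 1 / sqrt (q + 1)" .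
    then have "4 * (1 / (sqrt q * (4 * q))) \<le> 4 * (1 / sqrt q - 1 / sqrt (q + 1))"
      by (rule mult_left_mono) simp
    then show ?thesis by (simp add: mult.commute)
  qed
  have "(\<Sum>j<N. 1 / ((p + real j) * sqrt (p + real j)))
     \<le> (\<Sum>j<N. 4 * (1 / sqrt (p + real j) - 1 / sqrt (p + real j + 1)))"
    using assms by (intro sum_mono step) auto
  also have "\<dots> = 4 * (\<Sum>j<N. 1 / sqrt (p + real j) - 1 / sqrt (p + real (Suc j)))"
    by (simp add: sum_distrib_left add_ac)
  also have "\<dots> = 4 * (1 / sqrt p - 1 / sqrt (p + real N))"
    by (subst sum_lessThan_telescope') simp
  also have "\<dots> \<le> 4 / sqrt p" using assms by simp
  finally show ?thesis .
qed

text \<open>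
  A form of van der Corput's lemma. The frequency \<open>c / sqrt t + d\<close> may vanish inside the interval, but
  it stays away from \<open>2 \<pi>\<close> and \<open>- 2 \<pi>\<close>. By \<open>sum_integral_step\<close> the error is a boundary term of the
  size of the first summand plus a sum over the derivative of the logarithmic derivative. The latter
  is \<open>O(t powr (- 2) + c t powr (- 3/2))\<close>, which has a bounded sum over \<open>t \<ge> p\<close> if \<open>c = O(sqrt p)\<close>.
\<close>
lemma osc_sum_integral:
  fixes w :: complex and G :: real
  assumes w: "Re w \<le> 0" and G: "G \<ge> 0"
  obtains C T where "C > 0" "T \<ge> 1"
    "\<And>c d p N. c \<ge> 0 \<Longrightarrow> p \<ge> T \<Longrightarrow> c \<le> G * sqrt p \<Longrightarrow>
      (\<And>t. t \<in> {p..p + real N} \<Longrightarrow> \<bar>c / sqrt t + d\<bar> \<le> 3 * pi / 2) \<Longrightarrow>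
      norm ((\<Sum>j<N. osc w c d (p + real j)) - integral {p..p + real N} (osc w c d)) \<le> C * p powr Re w"
proof -
  obtain K where K: "K > 0" "\<And>z. norm z \<le> 7 * pi / 4 \<Longrightarrow> norm (euler_kernel z) \<le> K"
    "\<And>z w. norm z \<le> 7 * pi / 4 \<Longrightarrow> norm w \<le> 7 * pi / 4 \<Longrightarrow>
       norm (euler_kernel z - euler_kernel w) \<le> K * norm (z - w)"
    by (rule euler_kernel_bounded_Lipschitz) (rule that)
  obtain S where S: "S > 0"
    "\<And>F l l' t0 B M.
      (\<And>t. t \<in> {t0..t0 + 1} \<Longrightarrow> (F has_vector_derivative l t * F t) (at t within {t0..t0 + 1})) \<Longrightarrow>
      (\<And>t. t \<in> {t0..t0 + 1} \<Longrightarrow> (l has_vector_derivative l' t) (at t within {t0..t0 + 1})) \<Longrightarrow>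
      (\<And>t. t \<in> {t0..t0 + 1} \<Longrightarrow> norm (l t) \<le> 7 * pi / 4) \<Longrightarrow>
      (\<And>t. t \<in> {t0..t0 + 1} \<Longrightarrow> norm (l' t) \<le> B) \<Longrightarrow>
      (\<And>t. t \<in> {t0..t0 + 1} \<Longrightarrow> norm (F t) \<le> M) \<Longrightarrow>
      norm (F t0 - integral {t0..t0 + 1} F
        - (euler_kernel (l (t0 + 1)) * F (t0 + 1) - euler_kernel (l t0) * F t0)) \<le> S * B * M"
    by (rule sum_integral_step) blast
  \<comment> \<open>Beyond \<open>T\<close> the amplitude term \<open>w / t\<close> of the logarithmic derivative is at most \<open>\<pi> / 4\<close>.\<close>
  define T where "T = max 1 (4 * norm w / pi)"
  define C where "C = S * (norm w + G) * 4 + 2 * K"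
  show ?thesis
  proof
    show "C > 0" using S(1) K(1) G by (simp add: C_def add_nonneg_pos)
    show "T \<ge> 1" by (simp add: T_def)
    fix c d p :: real and N :: nat
    assume c: "c \<ge> 0" and p: "p \<ge> T" and cG: "c \<le> G * sqrt p"
      and freq: "\<And>t. t \<in> {p..p + real N} \<Longrightarrow> \<bar>c / sqrt t + d\<bar> \<le> 3 * pi / 2"
    have p1: "p \<ge> 1" using p by (simp add: T_def)
    define F where "F = osc w c d"
    define l where "l t = w / of_real t + \<i> * of_real (c / sqrt t + d)" for t :: real
    define l' where "l' t = - (w / of_real t ^ 2) - \<i> * of_real (c / (2 * t * sqrt t))" for t :: real
    define M where "M = p powr Re w"
    define A where "A = (norm w + G) * sqrt p"
    have F_le: "norm (F t) \<le> M" if "t \<ge> p" for t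
      using that p1 w by (simp add: F_def M_def norm_osc powr_mono2')
    have l_le: "norm (l t) \<le> 7 * pi / 4" if t: "t \<in> {p..p + real N}" for t
    proof -
      have "4 * norm w / pi \<le> t" using p t by (simp add: T_def)
      then have "norm w / t \<le> pi / 4" using t p1 by (simp add: field_simps)
      moreover have "norm (l t) \<le> norm w / t + \<bar>c / sqrt t + d\<bar>"
        using norm_triangle_ineq[of "w / of_real t" "\<i> * of_real (c / sqrt t + d)"] t p1
        by (simp add: l_def norm_divide norm_mult del: of_real_add of_real_divide)
      ultimately show ?thesis using freq[OF t] by linarith
    qed
    have l'_le: "norm (l' t) \<le> A * (1 / (q * sqrt q))" if "p \<le> q" "q \<le> t" for t q
    proof -
      have q: "q \<ge> 1" "t \<ge> 1" "p \<ge> 1" using that p1 by auto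
      have sp: "sqrt p \<ge> 1" using q by simp
      have sq: "sqrt q \<ge> 1" "sqrt q \<le> sqrt t" using q that by simp_all
      have "norm (l' t) \<le> norm w / t ^ 2 + c / (2 * t * sqrt t)"
        using norm_triangle_ineq4[of "- (w / of_real t ^ 2)" "\<i> * of_real (c / (2 * t * sqrt t))"] q c
        by (simp add: l'_def norm_divide norm_mult norm_power del: of_real_divide of_real_mult)
      also have "norm w / t ^ 2 \<le> norm w * sqrt p * (1 / (q * sqrt q))"
      proof -
        have "q * sqrt q \<le> t * t"
        proof (intro mult_mono)
          have "sqrt t \<le> t" using q by (simp add: sqrt_le_D real_le_lsqrt power2_eq_square)
          then show "sqrt q \<le> t" using sq(2) by linarith
        qed (use q that in auto)
        then have "norm w / t ^ 2 \<le> norm w * 1 / (q * sqrt q)"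
          unfolding power2_eq_square using q by (intro frac_le) auto
        also have "\<dots> \<le> norm w * sqrt p / (q * sqrt q)"
          using sp q by (intro divide_right_mono mult_left_mono) auto
        finally show ?thesis by simp
      qed
      also have "c / (2 * t * sqrt t) \<le> G * sqrt p * (1 / (q * sqrt q))"
      proof -
        have "q * sqrt q \<le> (2 * t) * sqrt t" using q that sq by (intro mult_mono) auto
        then have "c / (2 * t * sqrt t) \<le> (G * sqrt p) / (q * sqrt q)"
          using q c cG by (intro frac_le) auto
        then show ?thesis by simp
      qed
      finally show ?thesis by (simp add: A_def algebra_simps)
    qed
    have main: "norm ((\<Sum>j<n. F (p + real j)) - integral {p..p + real n} F
        - (euler_kernel (l (p + real n)) * F (p + real n) - euler_kernel (l p) * F p))
        \<le> S * A * M * (\<Sum>j<n. 1 / ((p + real j) * sqrt (p + real j)))" if "n \<le> N" for n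
      using that
    proof (induction n)
      case 0
      then show ?case by simp
    next
      case (Suc n)
      let ?q = "p + real n"
      let ?E = "\<lambda>t. euler_kernel (l t) * F t"
      have "norm (F ?q - integral {?q..?q + 1} F - (?E (?q + 1) - ?E ?q))
          \<le> S * (A * (1 / (?q * sqrt ?q))) * M"
      proof (rule S(2)[where l = l and l' = l'])
        fix t assume t: "t \<in> {?q..?q + 1}"
        then have t0: "t > 0" using p1 by auto
        show "(F has_vector_derivative l t * F t) (at t within {?q..?q + 1})"
          unfolding F_def l_def by (rule osc_vector_derivative[OF t0])
        show "(l has_vector_derivative l' t) (at t within {?q..?q + 1})"
          unfolding l_def l'_def by (rule log_derivative_osc_vector_derivative[OF t0])
        show "norm (l t) \<le> 7 * pi / 4" using t Suc.prems by (intro l_le) auto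
        show "norm (l' t) \<le> A * (1 / (?q * sqrt ?q))" using t by (intro l'_le) auto
        show "norm (F t) \<le> M" using t by (intro F_le) auto
      qed
      moreover have "integral {p..?q} F + integral {?q..?q + 1} F = integral {p..?q + 1} F"
        unfolding F_def using p1 by (intro osc_integral_combine) auto
      ultimately have "norm (((\<Sum>j<n. F (p + real j)) - integral {p..?q} F - (?E ?q - ?E p))
          + (F ?q - integral {?q..?q + 1} F - (?E (?q + 1) - ?E ?q)))
          \<le> S * A * M * (\<Sum>j<n. 1 / ((p + real j) * sqrt (p + real j))) + S * (A * (1 / (?q * sqrt ?q))) * M"
        using Suc by (intro norm_triangle_mono) auto
      also have "\<dots> = S * A * M * (\<Sum>j<Suc n. 1 / ((p + real j) * sqrt (p + real j)))"
        by (simp add: algebra_simps)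
      also have "((\<Sum>j<n. F (p + real j)) - integral {p..?q} F - (?E ?q - ?E p))
          + (F ?q - integral {?q..?q + 1} F - (?E (?q + 1) - ?E ?q))
          = (\<Sum>j<Suc n. F (p + real j)) - integral {p..p + real (Suc n)} F - (?E (p + real (Suc n)) - ?E p)"
        using \<open>integral {p..?q} F + integral {?q..?q + 1} F = integral {p..?q + 1} F\<close>
        by (simp add: algebra_simps)
      finally show ?case .
    qed
    have SAM: "S * A * M \<ge> 0" using S(1) G p1 by (simp add: A_def M_def)
    have "S * A * M * (\<Sum>j<N. 1 / ((p + real j) * sqrt (p + real j))) \<le> S * A * M * (4 / sqrt p)"
      by (intro mult_left_mono sum_three_halves_le p1 SAM)
    also have "\<dots> = S * (norm w + G) * 4 * M"
      using p1 by (simp add: A_def)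
    finally have b1: "norm ((\<Sum>j<N. F (p + real j)) - integral {p..p + real N} F
        - (euler_kernel (l (p + real N)) * F (p + real N) - euler_kernel (l p) * F p))
        \<le> S * (norm w + G) * 4 * M"
      using main[of N] by simp
    have E_le: "norm (euler_kernel (l t) * F t) \<le> K * M" if "t \<in> {p..p + real N}" for t
      unfolding norm_mult using K(1) K(2)[OF l_le[OF that]] F_le[of t] that by (intro mult_mono) auto
    have b2: "norm (euler_kernel (l (p + real N)) * F (p + real N) - euler_kernel (l p) * F p) \<le> K * M + K * M"
      by (rule norm_triangle_le_diff, rule add_mono) (auto intro: E_le)
    have "norm ((\<Sum>j<N. F (p + real j)) - integral {p..p + real N} F) \<le> S * (norm w + G) * 4 * M + (K * M + K * M)"
      using norm_triangle_mono[OF b1 b2] by simp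
    then show "norm ((\<Sum>j<N. osc w c d (p + real j)) - integral {p..p + real N} (osc w c d)) \<le> C * p powr Re w"
      by (simp add: F_def M_def C_def algebra_simps)
  qed
qed

lemma osc_shift: "t > 0 \<Longrightarrow> osc (w + of_real r) c d t = of_real (t powr r) * osc w c d t"
  by (simp add: osc_def exp_add[symmetric] powr_def exp_of_real[symmetric] algebra_simps)

lemma osc_integral_powr_bound:
  assumes "0 < p" "p \<le> q" "Re w < -1"
  shows "norm (integral {p..q} (osc w c d)) \<le> p powr (Re w + 1) / (- Re w - 1)"
proof -
  have hi: "((\<lambda>t. t powr Re w) has_integral
      q powr (Re w + 1) / (Re w + 1) - p powr (Re w + 1) / (Re w + 1)) {p..q}"
  proof (rule fundamental_theorem_of_calculus)
    fix t assume "t \<in> {p..q}"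
    then have "((\<lambda>t. t powr (Re w + 1) / (Re w + 1)) has_real_derivative
        (Re w + 1) * t powr (Re w + 1 - 1) / (Re w + 1)) (at t)"
      using assms by (intro DERIV_cdivide has_real_derivative_powr) auto
    then show "((\<lambda>t. t powr (Re w + 1) / (Re w + 1)) has_vector_derivative t powr Re w) (at t within {p..q})"
      using assms unfolding has_real_derivative_iff_has_vector_derivative[symmetric]
      by (auto intro: has_field_derivative_at_within)
  qed (use assms in auto)
  have "norm (integral {p..q} (osc w c d)) \<le> integral {p..q} (\<lambda>t. t powr Re w)"
    using hi assms by (intro integral_norm_bound_integral osc_integrable)
      (auto simp: norm_osc has_integral_integrable)
  also have "\<dots> = q powr (Re w + 1) / (Re w + 1) - p powr (Re w + 1) / (Re w + 1)"
    using hi by (rule integral_unique)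
  also have "\<dots> \<le> - (p powr (Re w + 1)) / (Re w + 1)"
    using assms by (simp add: divide_nonneg_neg)
  also have "\<dots> = p powr (Re w + 1) / (- Re w - 1)"
  proof -
    have *: "- Re w - 1 = - (Re w + 1)" by simp
    show ?thesis unfolding * by (simp only: divide_minus_right minus_divide_left)
  qed
  finally show ?thesis .
qed

text \<open>
  Integration by parts: \<open>osc (w + 1/2) c 0 / (\<i> c)\<close> is an antiderivative up to a multiple of
  \<open>osc (w - 1/2) c 0 / c\<close>, whose integral converges absolutely.
\<close>
lemma osc_integral_bound_sqrt:
  fixes w :: complex
  assumes w: "Re w < -1/2"
  obtains C where "C > 0"
    "\<And>c p q. c > 0 \<Longrightarrow> 0 < p \<Longrightarrow> p \<le> q \<Longrightarrow>
      norm (integral {p..q} (osc w c 0)) \<le> C * p powr (Re w + 1/2) / c"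
proof
  define e where "e = - (Re w + 1/2)"
  have e: "e > 0" using w by (simp add: e_def)
  let ?C = "2 + norm (w + 1/2) / e"
  show "?C > 0" using e by (simp add: add_pos_nonneg)
  fix c p q :: real assume c: "c > 0" and p: "0 < p" "p \<le> q"
  define k where "k = (w + 1/2) / (\<i> * of_real c)"
  define G where "G t = osc (w + of_real (1/2)) c 0 t / (\<i> * of_real c)" for t
  have G: "((\<lambda>t. osc w c 0 t + k * osc (w - 1/2) c 0 t) has_integral (G q - G p)) {p..q}"
  proof (rule fundamental_theorem_of_calculus)
    fix t assume "t \<in> {p..q}"
    then have t: "t > 0" using p by auto
    have st: "of_real (sqrt t) * of_real (sqrt t) = (of_real t :: complex)"
      using t by (simp flip: of_real_mult)
    have s: "osc (w + of_real (1/2)) c 0 t = of_real (sqrt t) * osc w c 0 t"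
      unfolding osc_shift[OF t] using t by (simp add: powr_half_sqrt)
    have s2: "osc (w - 1/2) c 0 t = osc w c 0 t / of_real (sqrt t)"
      using osc_shift[OF t, of w "-1/2" c 0] t by (simp add: powr_minus powr_half_sqrt field_simps)
    have "(G has_vector_derivative
      (((w + of_real (1/2)) / of_real t + \<i> * of_real (c / sqrt t + 0)) * osc (w + of_real (1/2)) c 0 t) / (\<i> * of_real c))
      (at t within {p..q})"
      unfolding G_def by (intro has_vector_derivative_divide osc_vector_derivative t)
    also have "(((w + of_real (1/2)) / of_real t + \<i> * of_real (c / sqrt t + 0)) * osc (w + of_real (1/2)) c 0 t) / (\<i> * of_real c)
       = osc w c 0 t + k * osc (w - 1/2) c 0 t"
      unfolding s s2 k_def st[symmetric] using t c by (simp add: field_simps)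
    finally show "(G has_vector_derivative osc w c 0 t + k * osc (w - 1/2) c 0 t) (at t within {p..q})" .
  qed (use p in auto)
  have int: "((\<lambda>t. osc w c 0 t + k * osc (w - 1/2) c 0 t) has_integral
      integral {p..q} (osc w c 0) + k * integral {p..q} (osc (w - 1/2) c 0)) {p..q}"
    by (intro has_integral_add has_integral_mult_right integrable_integral osc_integrable p)
  have eq: "integral {p..q} (osc w c 0) = G q - G p - k * integral {p..q} (osc (w - 1/2) c 0)"
    using has_integral_unique[OF G int] by (simp add: algebra_simps)
  let ?P = "p powr (Re w + 1/2)"
  have Gle: "norm (G t) \<le> ?P / c" if "t \<ge> p" for t
    using that p w c by (simp add: G_def norm_divide norm_mult norm_osc powr_mono2' divide_right_mono)
  have "norm (integral {p..q} (osc (w - 1/2) c 0)) \<le> ?P / e"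
  proof -
    have *: "Re (w - 1/2) + 1 = Re w + 1/2" "- Re (w - 1/2) - 1 = e" by (simp_all add: e_def)
    have "Re (w - 1/2) < -1" using w by simp
    from osc_integral_powr_bound[OF p this, of c 0] show ?thesis unfolding * .
  qed
  then have "norm (k * integral {p..q} (osc (w - 1/2) c 0)) \<le> norm (w + 1/2) / c * (?P / e)"
    unfolding norm_mult k_def using c by (intro mult_mono) (auto simp: norm_divide norm_mult)
  then have "norm (integral {p..q} (osc w c 0)) \<le> ?P / c + ?P / c + norm (w + 1/2) / c * (?P / e)"
    unfolding eq using Gle[of p] Gle[of q] p
    by (intro norm_triangle_le_diff add_mono) auto
  also have "\<dots> = ?C * ?P / c" using c e by (simp add: field_simps)
  finally show "norm (integral {p..q} (osc w c 0)) \<le> ?C * ?P / c" .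
qed

text \<open>The same integration by parts with the phase \<open>d t\<close>, whose frequency does not decay.\<close>
lemma osc_integral_bound_linear:
  fixes w :: complex
  assumes w: "Re w < 0" and d: "d \<noteq> 0" and p: "0 < p" "p \<le> q"
  shows "norm (integral {p..q} (osc w 0 d)) \<le> (2 + norm w / (- Re w)) / \<bar>d\<bar> * p powr Re w"
proof -
  define k where "k = w / (\<i> * of_real d)"
  define G where "G t = osc w 0 d t / (\<i> * of_real d)" for t
  have G: "((\<lambda>t. osc w 0 d t + k * osc (w - 1) 0 d t) has_integral (G q - G p)) {p..q}"
  proof (rule fundamental_theorem_of_calculus)
    fix t assume "t \<in> {p..q}"
    then have t: "t > 0" using p by auto
    have s2: "osc (w - 1) 0 d t = osc w 0 d t / of_real t"
      using osc_shift[OF t, of w "-1" 0 d] t by (simp add: powr_minus field_simps)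
    have "(G has_vector_derivative
      ((w / of_real t + \<i> * of_real (0 / sqrt t + d)) * osc w 0 d t) / (\<i> * of_real d))
      (at t within {p..q})"
      unfolding G_def by (intro has_vector_derivative_divide osc_vector_derivative t)
    also have "((w / of_real t + \<i> * of_real (0 / sqrt t + d)) * osc w 0 d t) / (\<i> * of_real d)
       = osc w 0 d t + k * osc (w - 1) 0 d t"
      unfolding s2 k_def using t d by (simp add: field_simps)
    finally show "(G has_vector_derivative osc w 0 d t + k * osc (w - 1) 0 d t) (at t within {p..q})" .
  qed (use p in auto)
  have int: "((\<lambda>t. osc w 0 d t + k * osc (w - 1) 0 d t) has_integral
      integral {p..q} (osc w 0 d) + k * integral {p..q} (osc (w - 1) 0 d)) {p..q}"
    by (intro has_integral_add has_integral_mult_right integrable_integral osc_integrable p)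
  have eq: "integral {p..q} (osc w 0 d) = G q - G p - k * integral {p..q} (osc (w - 1) 0 d)"
    using has_integral_unique[OF G int] by (simp add: algebra_simps)
  let ?P = "p powr Re w"
  have Gle: "norm (G t) \<le> ?P / \<bar>d\<bar>" if "t \<ge> p" for t
    using that p w d by (simp add: G_def norm_divide norm_mult norm_osc powr_mono2' divide_right_mono)
  have "norm (integral {p..q} (osc (w - 1) 0 d)) \<le> ?P / (- Re w)"
    using osc_integral_powr_bound[OF p, of "w - 1" 0 d] w by simp
  then have "norm (k * integral {p..q} (osc (w - 1) 0 d)) \<le> norm w / \<bar>d\<bar> * (?P / (- Re w))"
    unfolding norm_mult k_def using d by (intro mult_mono) (auto simp: norm_divide norm_mult)
  then have "norm (integral {p..q} (osc w 0 d)) \<le> ?P / \<bar>d\<bar> + ?P / \<bar>d\<bar> + norm w / \<bar>d\<bar> * (?P / (- Re w))"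
    unfolding eq using Gle[of p] Gle[of q] p
    by (intro norm_triangle_le_diff add_mono) auto
  also have "\<dots> = (2 + norm w / (- Re w)) / \<bar>d\<bar> * ?P"
    using d w by (simp add: field_simps)
  finally show ?thesis .
qed

text \<open>
  The error \<open>p powr Re w\<close> of \<open>osc_sum_integral\<close> is dominated by the bound for the integral, because
  \<open>c = O(sqrt p)\<close>.
\<close>
lemma osc_sum_bound_sqrt:
  fixes w :: complex
  assumes w: "Re w < -1/2"
  obtains C T where "C > 0" "T \<ge> 1"
    "\<And>c p N. c > 0 \<Longrightarrow> p \<ge> T \<Longrightarrow> c \<le> 3 * pi / 2 * sqrt p \<Longrightarrow>
      norm (\<Sum>j<N. osc w c 0 (p + real j)) \<le> C * p powr (Re w + 1/2) / c"
proof -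
  have w0: "Re w \<le> 0" and G0: "3 * pi / 2 \<ge> 0" using w by simp_all
  obtain C1 T where C1: "C1 > 0" "T \<ge> 1" and sum:
    "\<And>c d p N. c \<ge> 0 \<Longrightarrow> p \<ge> T \<Longrightarrow> c \<le> 3 * pi / 2 * sqrt p \<Longrightarrow>
      (\<And>t. t \<in> {p..p + real N} \<Longrightarrow> \<bar>c / sqrt t + d\<bar> \<le> 3 * pi / 2) \<Longrightarrow>
      norm ((\<Sum>j<N. osc w c d (p + real j)) - integral {p..p + real N} (osc w c d)) \<le> C1 * p powr Re w"
    by (rule osc_sum_integral[OF w0 G0]) blast
  obtain C2 where C2: "C2 > 0" and int:
    "\<And>c p q. c > 0 \<Longrightarrow> 0 < p \<Longrightarrow> p \<le> q \<Longrightarrow>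
      norm (integral {p..q} (osc w c 0)) \<le> C2 * p powr (Re w + 1/2) / c"
    by (rule osc_integral_bound_sqrt[OF w]) blast
  show ?thesis
  proof
    show "C1 * (3 * pi / 2) + C2 > 0" using C1 C2 by (simp add: add_pos_pos)
    show "T \<ge> 1" by fact
    fix c p :: real and N :: nat
    assume c: "c > 0" and p: "p \<ge> T" and cp: "c \<le> 3 * pi / 2 * sqrt p"
    have p0: "p > 0" using p C1 by simp
    let ?P = "p powr (Re w + 1/2)"
    have "norm ((\<Sum>j<N. osc w c 0 (p + real j)) - integral {p..p + real N} (osc w c 0)) \<le> C1 * p powr Re w"
    proof (rule sum)
      fix t assume t: "t \<in> {p..p + real N}"
      have "c / sqrt t \<le> c / sqrt p" using t p0 c by (intro divide_left_mono) auto
      also have "\<dots> \<le> 3 * pi / 2" using cp p0 by (simp add: field_simps)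
      finally show "\<bar>c / sqrt t + 0\<bar> \<le> 3 * pi / 2" using c t p0 by simp
    qed (use c p cp in auto)
    also have "p powr Re w \<le> (3 * pi / 2) * ?P / c"
    proof -
      have "p powr Re w * c \<le> p powr Re w * (3 * pi / 2 * sqrt p)" using cp by (intro mult_left_mono) auto
      also have "\<dots> = (3 * pi / 2) * ?P" using p0 by (simp add: powr_add powr_half_sqrt)
      finally show ?thesis using c by (simp add: field_simps)
    qed
    finally have 1: "norm ((\<Sum>j<N. osc w c 0 (p + real j)) - integral {p..p + real N} (osc w c 0))
       \<le> C1 * ((3 * pi / 2) * ?P / c)" using C1 by simp
    have 2: "norm (integral {p..p + real N} (osc w c 0)) \<le> C2 * ?P / c"
      using c p0 by (intro int) auto
    show "norm (\<Sum>j<N. osc w c 0 (p + real j)) \<le> (C1 * (3 * pi / 2) + C2) * ?P / c"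
      using norm_triangle_mono[OF 1 2] c by (simp add: field_simps)
  qed
qed

text \<open>
  Subtracting the integer nearest to \<open>y\<close> multiplies the sum by a constant of modulus one and makes
  the frequency at most \<open>\<pi>\<close>, but not zero.
\<close>
lemma osc_sum_bound_linear:
  fixes w :: complex
  assumes w: "Re w < 0" and y: "y \<notin> \<int>"
  obtains C T where "C > 0" "T \<ge> 1"
    "\<And>p N. p \<ge> T \<Longrightarrow> norm (\<Sum>j<N. osc w 0 (2 * pi * y) (p + real j)) \<le> C * p powr Re w"
proof -
  have w0: "Re w \<le> 0" using w by simp
  define k where "k = round y"
  define d where "d = 2 * pi * (y - of_int k)"
  have d: "d \<noteq> 0" using y by (auto simp: d_def)
  have "\<bar>y - of_int k\<bar> \<le> 1/2"
    using of_int_round_abs_le[of y] by (simp add: k_def abs_minus_commute)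
  then have "2 * pi * \<bar>y - of_int k\<bar> \<le> 2 * pi * (1/2)" by (intro mult_left_mono) auto
  then have d_le: "\<bar>d\<bar> \<le> 3 * pi / 2" using pi_gt_zero unfolding d_def abs_mult by simp
  obtain C1 T where C1: "C1 > 0" "T \<ge> 1" and sum:
    "\<And>c d p N. c \<ge> 0 \<Longrightarrow> p \<ge> T \<Longrightarrow> c \<le> 0 * sqrt p \<Longrightarrow>
      (\<And>t. t \<in> {p..p + real N} \<Longrightarrow> \<bar>c / sqrt t + d\<bar> \<le> 3 * pi / 2) \<Longrightarrow>
      norm ((\<Sum>j<N. osc w c d (p + real j)) - integral {p..p + real N} (osc w c d)) \<le> C1 * p powr Re w"
    by (rule osc_sum_integral[OF w0 order_refl]) blast
  define C2 where "C2 = (2 + norm w / (- Re w)) / \<bar>d\<bar>"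
  have "norm w / (- Re w) \<ge> 0" using w by (intro divide_nonneg_pos) auto
  then have C2: "C2 > 0" unfolding C2_def using d by (intro divide_pos_pos) linarith+
  have reduce: "osc w 0 (2 * pi * y) (p + real j) = cis (2 * pi * of_int k * p) * osc w 0 d (p + real j)"
    if "p > 0" for p j
  proof -
    have "cis (2 * pi * y * (p + real j)) = cis (2 * pi * of_int k * p) * cis (d * (p + real j)) * cis (2 * pi * of_int (k * int j))"
      by (simp add: cis_mult d_def algebra_simps)
    also have "cis (2 * pi * of_int (k * int j)) = 1" by (rule cis_multiple_2pi) simp
    finally show ?thesis using that by (simp add: osc_eq)
  qed
  show ?thesis
  proof
    show "C1 + C2 > 0" "T \<ge> 1" using C1 C2 by simp_all
    fix p :: real and N :: nat assume p: "p \<ge> T"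
    have p0: "p > 0" using p C1 by simp
    have 1: "norm ((\<Sum>j<N. osc w 0 d (p + real j)) - integral {p..p + real N} (osc w 0 d)) \<le> C1 * p powr Re w"
      by (rule sum) (use p d_le in auto)
    have 2: "norm (integral {p..p + real N} (osc w 0 d)) \<le> C2 * p powr Re w"
      unfolding C2_def using p0 by (intro osc_integral_bound_linear w d) auto
    have "norm (\<Sum>j<N. osc w 0 (2 * pi * y) (p + real j)) = norm (\<Sum>j<N. osc w 0 d (p + real j))"
      unfolding reduce[OF p0] sum_distrib_left[symmetric] norm_mult by simp
    also have "\<dots> \<le> (C1 + C2) * p powr Re w"
      using norm_triangle_mono[OF 1 2] by (simp add: algebra_simps)
    finally show "norm (\<Sum>j<N. osc w 0 (2 * pi * y) (p + real j)) \<le> (C1 + C2) * p powr Re w" .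
  qed
qed

section \<open>The Fresnel integral and stationary phase\<close>

lemma cis_vector_derivative:
  assumes "(f has_real_derivative f') (at r within S)"
  shows "((\<lambda>r. cis (f r)) has_vector_derivative (\<i> * of_real f' * cis (f r))) (at r within S)"
proof -
  have "((\<lambda>r. \<i> * of_real (f r)) has_vector_derivative \<i> * of_real f') (at r within S)"
    by (intro has_vector_derivative_mult_right has_vector_derivative_of_real assms)
  from field_vector_diff_chain_within[OF this has_field_derivative_at_within[OF DERIV_exp]]
  show ?thesis by (simp add: o_def cis_conv_exp)
qed

definition fresnel :: "real \<Rightarrow> complex" where
  "fresnel T = integral {0..T} (\<lambda>r. cis (- (r ^ 2)))"

text \<open>The integral of \<open>exp (- \<i> r\<^sup>2)\<close> over \<open>r \<ge> 0\<close>, which converges only conditionally.\<close>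
definition fresnel_const :: complex where
  "fresnel_const = lim (\<lambda>n. fresnel (real n))"

lemma cis_continuous_on [continuous_intros]:
  "continuous_on S f \<Longrightarrow> continuous_on S (\<lambda>x. cis (f x))"
  unfolding cis_conv_exp by (intro continuous_intros)

lemma fresnel_integrable: "(\<lambda>r. cis (- (r ^ 2))) integrable_on {a..b}"
  by (intro integrable_continuous_real continuous_intros)

lemma fresnel_vector_derivative:
  "T \<in> {0..R} \<Longrightarrow> (fresnel has_vector_derivative cis (- (T ^ 2))) (at T within {0..R})"
  unfolding fresnel_def[abs_def]
  by (rule integral_has_vector_derivative) (auto intro!: continuous_intros)

lemma fresnel_scaled_integral:
  assumes s: "s \<ge> 0" and R: "R \<ge> 0"
  shows "((\<lambda>r. of_real s * cis (- ((s * r) ^ 2))) has_integral fresnel (s * R)) {0..R}"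
proof -
  have "((\<lambda>r. of_real s * cis (- ((s * r) ^ 2))) has_integral (fresnel (s * R) - fresnel (s * 0))) {0..R}"
  proof (rule fundamental_theorem_of_calculus)
    fix r assume r: "r \<in> {0..R}"
    have "((\<lambda>r. s * r) has_vector_derivative s) (at r within {0..R})"
      by (auto intro!: derivative_eq_intros)
    moreover have "(fresnel has_vector_derivative cis (- ((s * r) ^ 2))) (at (s * r) within (\<lambda>r. s * r) ` {0..R})"
    proof (rule has_vector_derivative_within_subset[OF fresnel_vector_derivative])
      show "s * r \<in> {0..s * R}" using r s by (auto intro: mult_left_mono)
      show "(\<lambda>r. s * r) ` {0..R} \<subseteq> {0..s * R}" using s by (auto intro: mult_left_mono)
    qed
    ultimately have "(fresnel \<circ> (\<lambda>r. s * r) has_vector_derivative s *\<^sub>R cis (- ((s * r) ^ 2))) (at r within {0..R})"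
      by (rule vector_diff_chain_within)
    then show "((\<lambda>r. fresnel (s * r)) has_vector_derivative of_real s * cis (- ((s * r) ^ 2))) (at r within {0..R})"
      by (simp add: o_def scaleR_conv_of_real)
  qed (use R in auto)
  then show ?thesis by (simp add: fresnel_def)
qed

text \<open>Integration by parts: \<open>\<i> exp (- \<i> r\<^sup>2) / (2 r)\<close> is an antiderivative up to \<open>O(r powr (- 2))\<close>.\<close>
lemma fresnel_diff_bound:
  assumes S: "0 < S" "S \<le> T"
  shows "norm (fresnel T - fresnel S) \<le> 2 / S"
proof -
  let ?f = "\<lambda>r::real. cis (- (r ^ 2))"
  let ?g = "\<lambda>r::real. \<i> * of_real (1 / (2 * r ^ 2)) * cis (- (r ^ 2))"
  define G where "G r = \<i> * (of_real (1 / (2 * r)) * cis (- (r ^ 2)))" for r :: real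
  have G: "((\<lambda>r. ?f r - ?g r) has_integral (G T - G S)) {S..T}"
  proof (rule fundamental_theorem_of_calculus)
    fix r assume "r \<in> {S..T}"
    then have r: "r > 0" using S by auto
    have 1: "((\<lambda>r. of_real (1 / (2 * r)) :: complex) has_vector_derivative of_real (- (1 / (2 * r ^ 2)))) (at r within {S..T})"
      using r by (intro has_vector_derivative_of_real)
        (auto intro!: derivative_eq_intros simp: power2_eq_square field_simps)
    have 2: "((\<lambda>r. cis (- (r ^ 2))) has_vector_derivative \<i> * of_real (- (2 * r)) * cis (- (r ^ 2))) (at r within {S..T})"
      by (rule cis_vector_derivative) (auto intro!: derivative_eq_intros)
    have "(G has_vector_derivative \<i> * (of_real (1 / (2 * r)) * (\<i> * of_real (- (2 * r)) * cis (- (r ^ 2)))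
        + of_real (- (1 / (2 * r ^ 2))) * cis (- (r ^ 2)))) (at r within {S..T})"
      unfolding G_def by (intro has_vector_derivative_mult_right has_vector_derivative_mult 1 2)
    also have "\<i> * (of_real (1 / (2 * r)) * (\<i> * of_real (- (2 * r)) * cis (- (r ^ 2)))
        + of_real (- (1 / (2 * r ^ 2))) * cis (- (r ^ 2))) = ?f r - ?g r"
      using r by (simp add: field_simps)
    finally show "(G has_vector_derivative ?f r - ?g r) (at r within {S..T})" .
  qed (use S in auto)
  have hi: "((\<lambda>r. 1 / (2 * r ^ 2)) has_integral (- (1 / (2 * T)) - (- (1 / (2 * S))))) {S..T}"
  proof (rule fundamental_theorem_of_calculus)
    fix r assume "r \<in> {S..T}"
    then have r: "r > 0" using S by auto
    then have "((\<lambda>r. - (1 / (2 * r))) has_real_derivative 1 / (2 * r ^ 2)) (at r within {S..T})"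
      by (auto intro!: derivative_eq_intros simp: power2_eq_square field_simps)
    then show "((\<lambda>r. - (1 / (2 * r))) has_vector_derivative 1 / (2 * r ^ 2)) (at r within {S..T})"
      by (simp add: has_real_derivative_iff_has_vector_derivative)
  qed (use S in auto)
  have fi: "?f integrable_on {S..T}" by (rule fresnel_integrable)
  have gi: "?g integrable_on {S..T}"
    using S by (intro integrable_continuous_real continuous_intros) auto
  have eq: "integral {S..T} ?f - integral {S..T} ?g = G T - G S"
    using has_integral_unique[OF has_integral_diff[OF integrable_integral[OF fi] integrable_integral[OF gi]] G] .
  have "norm (integral {S..T} ?g) \<le> integral {S..T} (\<lambda>r. 1 / (2 * r ^ 2))"
    using hi by (intro integral_norm_bound_integral gi) (auto simp: norm_mult has_integral_integrable norm_divide norm_power)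
  also have "\<dots> = 1 / (2 * S) - 1 / (2 * T)" using integral_unique[OF hi] by simp
  also have "\<dots> \<le> 1 / (2 * S)" using S by simp
  finally have g: "norm (integral {S..T} ?g) \<le> 1 / (2 * S)" .
  have GT: "norm (G T) \<le> 1 / (2 * S)" "norm (G S) \<le> 1 / (2 * S)"
    using S by (simp_all add: G_def norm_mult norm_divide frac_le)
  have "fresnel T = fresnel S + integral {S..T} ?f"
    unfolding fresnel_def
    by (rule Henstock_Kurzweil_Integration.integral_combine[symmetric]) (use S fresnel_integrable in auto)
  then have "fresnel T - fresnel S = G T - G S + integral {S..T} ?g"
    using eq by (simp add: algebra_simps)
  also have "norm \<dots> \<le> (1 / (2 * S) + 1 / (2 * S)) + 1 / (2 * S)"
    by (intro norm_triangle_le norm_triangle_le_diff add_mono g GT)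
  also have "\<dots> \<le> 2 / S" using S by (simp add: field_simps)
  finally show ?thesis .
qed

lemma fresnel_const_bound:
  assumes T: "T > 0"
  shows "norm (fresnel T - fresnel_const) \<le> 2 / T"
proof -
  have "Cauchy (\<lambda>n. fresnel (real n))"
  proof (rule CauchyI')
    fix e :: real assume e: "e > 0"
    obtain M :: nat where M: "real M > 2 / e" "M > 0"
      by (metis reals_Archimedean2 gr0I of_nat_0 order_less_trans e divide_pos_pos zero_less_numeral order.asym)
    show "\<exists>M. \<forall>m\<ge>M. \<forall>n>m. dist (fresnel (real m)) (fresnel (real n)) < e"
    proof (intro exI allI impI)
      fix m n assume m: "M \<le> m" and n: "m < n"
      have "dist (fresnel (real m)) (fresnel (real n)) \<le> 2 / real m"
        using fresnel_diff_bound[of "real m" "real n"] m n M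
        by (simp add: dist_norm norm_minus_commute)
      also have "\<dots> \<le> 2 / real M" using m M by (intro divide_left_mono) auto
      also have "\<dots> < e" using M e by (simp add: field_simps)
      finally show "dist (fresnel (real m)) (fresnel (real n)) < e" .
    qed
  qed
  then have lim: "(\<lambda>n. fresnel (real n)) \<longlonglongrightarrow> fresnel_const"
    unfolding fresnel_const_def by (simp add: Cauchy_convergent_iff convergent_LIMSEQ_iff)
  have "(\<lambda>n. norm (fresnel T - fresnel (real n))) \<longlonglongrightarrow> norm (fresnel T - fresnel_const)"
    by (intro tendsto_intros lim)
  moreover have "\<forall>\<^sub>F n in sequentially. norm (fresnel T - fresnel (real n)) \<le> 2 / T"
  proof -
    obtain M :: nat where M: "real M > T" using reals_Archimedean2 by blast
    show ?thesis
    proof (rule eventually_sequentiallyI[of M])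
      fix n assume "M \<le> n"
      then have "T \<le> real n" using M by linarith
      from fresnel_diff_bound[OF T this] show "norm (fresnel T - fresnel (real n)) \<le> 2 / T"
        by (simp add: norm_minus_commute)
    qed
  qed
  ultimately show ?thesis by (rule tendsto_upperbound) simp
qed

lemma fresnel_scaled_bound:
  assumes L: "L > 0" and R: "R > 0"
  shows "norm (integral {0..R} (\<lambda>r. cis (- (L * r ^ 2))) - fresnel_const / of_real (sqrt L)) \<le> 2 / (L * R)"
proof -
  have s: "sqrt L > 0" "sqrt L * sqrt L = L" using L by auto
  have "((\<lambda>r. of_real (sqrt L) * cis (- ((sqrt L * r) ^ 2)) / of_real (sqrt L))
       has_integral fresnel (sqrt L * R) / of_real (sqrt L)) {0..R}"
    using R s by (intro has_integral_divide fresnel_scaled_integral) auto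
  then have "integral {0..R} (\<lambda>r. cis (- (L * r ^ 2))) = fresnel (sqrt L * R) / of_real (sqrt L)"
    using s L by (intro integral_unique) (simp add: power_mult_distrib)
  then have "norm (integral {0..R} (\<lambda>r. cis (- (L * r ^ 2))) - fresnel_const / of_real (sqrt L))
      = norm (fresnel (sqrt L * R) - fresnel_const) / sqrt L"
    using s by (simp add: diff_divide_distrib[symmetric] norm_divide)
  also have "\<dots> \<le> (2 / (sqrt L * R)) / sqrt L"
    using s R by (intro divide_right_mono fresnel_const_bound) auto
  also have "\<dots> = 2 / (L * R)" using s by (simp add: field_simps)
  finally show ?thesis .
qed

text \<open>
  The value \<open>h 0\<close> contributes the Fresnel integral. What is left is \<open>r (k r) exp (- \<i> L r\<^sup>2)\<close>, where \<open>k\<close>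
  is the difference quotient of \<open>h\<close> at 0; since \<open>r exp (- \<i> L r\<^sup>2)\<close> has an elementary antiderivative,
  an integration by parts gains the factor \<open>1 / L\<close>.
\<close>
lemma fresnel_integral_asymptotic:
  fixes h h' h'' :: "real \<Rightarrow> complex"
  assumes L: "L > 0" and R: "R > 0"
    and h: "\<And>r. r \<in> {0..R} \<Longrightarrow> (h has_vector_derivative h' r) (at r within {0..R})"
    and h': "\<And>r. r \<in> {0..R} \<Longrightarrow> (h' has_vector_derivative h'' r) (at r within {0..R})"
    and A: "\<And>r. r \<in> {0..R} \<Longrightarrow> norm (h'' r) \<le> A"
  shows "norm (integral {0..R} (\<lambda>r. h r * cis (- (L * r ^ 2))) - h 0 * fresnel_const / of_real (sqrt L))
     \<le> (2 * norm (h 0) / R + norm (h' 0) + 2 * A * R) / L"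
proof -
  let ?I = "{0..R}"
  let ?e = "\<lambda>r::real. cis (- (L * r ^ 2))"
  have A0: "A \<ge> 0" using order_trans[OF norm_ge_zero A[of 0]] R by simp
  have h'_diff: "norm (h' r - h' s) \<le> A * \<bar>r - s\<bar>" if "r \<in> ?I" "s \<in> ?I" for r s
  proof -
    have "norm (h' r - h' s) \<le> A * norm (r - s)"
    proof (rule differentiable_bound[where S = ?I])
      fix x assume x: "x \<in> ?I"
      show "(h' has_derivative (\<lambda>y. y *\<^sub>R h'' x)) (at x within ?I)"
        using h'[OF x] by (simp add: has_vector_derivative_def)
      show "onorm (\<lambda>y. y *\<^sub>R h'' x) \<le> A" by (rule onorm_scaleR_le[OF A[OF x]])
    qed (use that in auto)
    then show ?thesis by simp
  qed
  have taylor: "norm (h r - h 0 - of_real r * h' c) \<le> A * r * r" if r: "r \<in> ?I" and c: "c \<in> {0..r}" for r c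
  proof -
    have "norm ((h r - of_real r * h' c) - (h 0 - of_real 0 * h' c)) \<le> A * r * norm (r - 0)"
    proof (rule differentiable_bound[where S = "{0..r}" and f' = "\<lambda>x y. y *\<^sub>R (h' x - h' c)"])
      fix x assume x: "x \<in> {0..r}"
      have "(h has_vector_derivative h' x) (at x within {0..r})"
        by (rule has_vector_derivative_within_subset[OF h]) (use x r in auto)
      then have "((\<lambda>x. h x - of_real x * h' c) has_vector_derivative h' x - of_real 1 * h' c) (at x within {0..r})"
        by (intro has_vector_derivative_diff has_vector_derivative_mult_left has_vector_derivative_of_real)
           (auto intro!: derivative_eq_intros)
      then show "((\<lambda>x. h x - of_real x * h' c) has_derivative (\<lambda>y. y *\<^sub>R (h' x - h' c))) (at x within {0..r})"
        by (simp add: has_vector_derivative_def)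
      have "norm (h' x - h' c) \<le> A * \<bar>x - c\<bar>" using x c r by (intro h'_diff) auto
      also have "\<dots> \<le> A * r" using x c A0 by (intro mult_left_mono) auto
      finally show "onorm (\<lambda>y. y *\<^sub>R (h' x - h' c)) \<le> A * r" by (rule onorm_scaleR_le)
    qed (use r in auto)
    then show ?thesis using r by (simp add: algebra_simps)
  qed
  define k where "k r = (if r = 0 then h' 0 else (h r - h 0) / of_real r)" for r :: real
  define k' where "k' r = (h' r * of_real r - (h r - h 0)) / of_real r ^ 2" for r :: real
  have k_deriv: "(k has_vector_derivative k' r) (at r)" if r: "r \<in> {0<..<R}" for r
  proof -
    have hr: "(h has_vector_derivative h' r) (at r)"
      using h[of r] r by (metis at_within_Icc_at greaterThanLessThan_iff atLeastAtMost_iff less_imp_le)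
    have 1: "((\<lambda>r. of_real (1 / r) :: complex) has_vector_derivative of_real (- (1 / r ^ 2))) (at r)"
      using r by (intro has_vector_derivative_of_real)
        (auto intro!: derivative_eq_intros simp: power2_eq_square)
    have "((\<lambda>r. (h r - h 0) * of_real (1 / r)) has_vector_derivative
       (h r - h 0) * of_real (- (1 / r ^ 2)) + (h' r - 0) * of_real (1 / r)) (at r)"
      by (intro has_vector_derivative_mult has_vector_derivative_diff hr 1 has_vector_derivative_const)
    moreover have "(h r - h 0) * of_real (- (1 / r ^ 2)) + (h' r - 0) * of_real (1 / r) = k' r"
      using r by (simp add: k'_def field_simps power2_eq_square)
    ultimately have "((\<lambda>r. (h r - h 0) * of_real (1 / r)) has_vector_derivative k' r) (at r)" by simp
    then show ?thesis
      by (rule has_vector_derivative_transform_within_open[where S = "{0<..<R}"])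
        (use r in \<open>auto simp: k_def\<close>)
  qed
  have k'_le: "norm (k' r) \<le> A" if r: "r \<in> {0<..<R}" for r
  proof -
    have "norm (h r - h 0 - of_real r * h' r) \<le> A * r * r"
      using r by (intro taylor) auto
    moreover have "k' r = - (h r - h 0 - of_real r * h' r) / of_real (r ^ 2)"
      by (simp add: k'_def algebra_simps)
    ultimately show ?thesis
      using r by (simp add: norm_divide norm_mult norm_minus_commute divide_le_eq power2_eq_square mult.assoc
          del: minus_diff_eq)
  qed
  have k_near: "norm (k r - h' 0) \<le> A * r" if r: "r \<in> ?I" for r
  proof (cases "r = 0")
    case False
    then have r0: "r > 0" using r by auto
    have "norm (h r - h 0 - of_real r * h' 0) \<le> A * r * r" using r by (intro taylor) auto
    moreover have "k r - h' 0 = (h r - h 0 - of_real r * h' 0) / of_real r"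
      using r0 by (simp add: k_def field_simps)
    ultimately show ?thesis using r0 by (simp add: norm_divide divide_le_eq)
  qed (simp add: k_def)
  \<comment> \<open>At 0 the function \<open>k\<close> need not be differentiable; continuity suffices for the fundamental theorem.\<close>
  have k_cont: "continuous_on ?I k"
    unfolding continuous_on_eq_continuous_within
  proof
    fix r assume r: "r \<in> ?I"
    show "continuous (at r within ?I) k"
    proof (cases "r = 0")
      case True
      have "((\<lambda>r. k r - h' 0) \<longlongrightarrow> 0) (at 0 within ?I)"
      proof (rule Lim_null_comparison)
        show "\<forall>\<^sub>F r in at 0 within ?I. norm (k r - h' 0) \<le> A * r"
          using k_near by (auto simp: eventually_at_filter)
        show "((\<lambda>r. A * r) \<longlongrightarrow> 0) (at 0 within ?I)" by (auto intro!: tendsto_eq_intros)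
      qed
      then have "(k \<longlongrightarrow> h' 0) (at 0 within ?I)" by (rule LIM_zero_cancel)
      moreover have "k 0 = h' 0" by (simp add: k_def)
      ultimately show ?thesis using True by (simp add: continuous_within)
    next
      case False
      have "continuous (at r within ?I) (\<lambda>r. (h r - h 0) / of_real r)"
        using False h[OF r] by (intro continuous_intros has_vector_derivative_continuous) auto
      moreover have "\<forall>\<^sub>F x in at r within ?I. (h x - h 0) / of_real x = k x"
      proof -
        have "\<forall>\<^sub>F x in at r within ?I. x \<noteq> 0"
          using False by (intro tendsto_imp_eventually_ne[OF tendsto_ident_at])
        then show ?thesis by eventually_elim (simp add: k_def)
      qed
      ultimately have "(k \<longlongrightarrow> (h r - h 0) / of_real r) (at r within ?I)"
        unfolding continuous_within by (rule Lim_transform_eventually)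
      moreover have "k r = (h r - h 0) / of_real r" using False by (simp add: k_def)
      ultimately show ?thesis by (simp only: continuous_within)
    qed
  qed
  define G where "G r = k r * (\<i> * of_real (1 / (2 * L)) * ?e r)" for r
  define q where "q r = k' r * (\<i> * of_real (1 / (2 * L)) * ?e r)" for r
  have G: "((\<lambda>r. (h r - h 0) * ?e r + q r) has_integral (G R - G 0)) ?I"
  proof (rule fundamental_theorem_of_calculus_interior)
    show "continuous_on ?I G" unfolding G_def by (intro continuous_intros k_cont)
    fix r assume r: "r \<in> {0<..<R}"
    have "(?e has_vector_derivative \<i> * of_real (- (L * (2 * r))) * ?e r) (at r)"
      by (rule cis_vector_derivative) (auto intro!: derivative_eq_intros)
    then have "(G has_vector_derivative k r * (\<i> * of_real (1 / (2 * L)) * (\<i> * of_real (- (L * (2 * r))) * ?e r))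
        + k' r * (\<i> * of_real (1 / (2 * L)) * ?e r)) (at r)"
      unfolding G_def by (intro has_vector_derivative_mult has_vector_derivative_mult_right k_deriv r)
    also have "k r * (\<i> * of_real (1 / (2 * L)) * (\<i> * of_real (- (L * (2 * r))) * ?e r)) = (h r - h 0) * ?e r"
      using r L by (simp add: k_def field_simps)
    finally show "(G has_vector_derivative (h r - h 0) * ?e r + q r) (at r)" by (simp add: q_def)
  qed (use R in auto)
  have h_cont: "continuous_on ?I h" using h by (intro continuous_on_vector_derivative) auto
  have i1: "(\<lambda>r. (h r - h 0) * ?e r) integrable_on ?I"
    by (intro integrable_continuous_real continuous_intros h_cont)
  have qi: "(q has_integral (G R - G 0 - integral ?I (\<lambda>r. (h r - h 0) * ?e r))) ?I"
    using has_integral_diff[OF G integrable_integral[OF i1]] by simp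
  have q_le: "norm (G R - G 0 - integral ?I (\<lambda>r. (h r - h 0) * ?e r)) \<le> A / (2 * L) * R"
  proof -
    have "norm (G R - G 0 - integral ?I (\<lambda>r. (h r - h 0) * ?e r)) \<le> A / (2 * L) * measure lborel (cbox 0 R)"
    proof (rule has_integral_bound_spike_finite[where S = "{0, R}"])
      show "(q has_integral (G R - G 0 - integral ?I (\<lambda>r. (h r - h 0) * ?e r))) (cbox 0 R)"
        using qi by simp
      fix r assume "r \<in> cbox 0 R - {0, R}"
      then have "norm (k' r) \<le> A" by (intro k'_le) auto
      then show "norm (q r) \<le> A / (2 * L)"
        using L by (simp add: q_def norm_mult norm_divide divide_right_mono)
    qed (use A0 L in auto)
    then show ?thesis using R by simp
  qed
  have k_le: "norm (k r) \<le> norm (h' 0) + A * R" if r: "r \<in> ?I" for r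
  proof -
    have "norm (k r) \<le> norm (h' 0) + norm (k r - h' 0)" by (metis norm_triangle_sub)
    also have "norm (k r - h' 0) \<le> A * R" using k_near[OF r] r A0 by (auto intro: order_trans mult_left_mono)
    finally show ?thesis by simp
  qed
  have G_le: "norm (G r) \<le> (norm (h' 0) + A * R) / (2 * L)" if "r \<in> ?I" for r
    using k_le[OF that] L by (simp add: G_def norm_mult norm_divide divide_right_mono)
  have "integral ?I (\<lambda>r. h r * ?e r) = integral ?I (\<lambda>r. (h r - h 0) * ?e r) + h 0 * integral ?I ?e"
  proof -
    have "((\<lambda>r. (h r - h 0) * ?e r + h 0 * ?e r) has_integral
        integral ?I (\<lambda>r. (h r - h 0) * ?e r) + h 0 * integral ?I ?e) ?I"
      by (intro has_integral_add has_integral_mult_right integrable_integral i1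
          integrable_continuous_real continuous_intros)
    then show ?thesis by (intro integral_unique) (simp add: algebra_simps)
  qed
  then have "integral ?I (\<lambda>r. h r * ?e r) - h 0 * fresnel_const / of_real (sqrt L)
     = - (G R - G 0 - integral ?I (\<lambda>r. (h r - h 0) * ?e r)) + (G R - G 0)
       + h 0 * (integral ?I ?e - fresnel_const / of_real (sqrt L))"
    by (simp add: algebra_simps)
  also have "norm \<dots> \<le> A / (2 * L) * R + ((norm (h' 0) + A * R) / (2 * L) + (norm (h' 0) + A * R) / (2 * L))
      + norm (h 0) * (2 / (L * R))"
  proof (intro norm_triangle_mono norm_triangle_le_diff add_mono)
    show "norm (- (G R - G 0 - integral ?I (\<lambda>r. (h r - h 0) * ?e r))) \<le> A / (2 * L) * R"
      using q_le by (simp only: norm_minus_cancel)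
    show "norm (h 0 * (integral ?I ?e - fresnel_const / of_real (sqrt L))) \<le> norm (h 0) * (2 / (L * R))"
      unfolding norm_mult by (intro mult_left_mono fresnel_scaled_bound L R) auto
  qed (use R in \<open>auto intro!: G_le\<close>)
  also have "\<dots> = (2 * norm (h 0) / R + norm (h' 0) + 3 / 2 * A * R) / L"
    using L R by (simp add: field_simps)
  also have "\<dots> \<le> (2 * norm (h 0) / R + norm (h' 0) + 2 * A * R) / L"
    using L R A0 by (intro divide_right_mono add_mono mult_right_mono) auto
  finally show ?thesis .
qed

text \<open>
  Let \<open>Q t\<close> be the integral of \<open>exp (- \<i> t\<^sup>2 (1 + y\<^sup>2)) / (1 + y\<^sup>2)\<close> over \<open>0 \<le> y \<le> 1\<close>. Its derivative
  is \<open>- 2 \<i> exp (- \<i> t\<^sup>2) fresnel t\<close>, so \<open>Q + \<i> fresnel\<^sup>2\<close> is constant. At \<open>t = 0\<close> it equals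
  \<open>\<pi> / 4\<close>, and \<open>Q\<close> tends to 0 by \<open>fresnel_integral_asymptotic\<close>.
\<close>
lemma fresnel_const_square: "fresnel_const ^ 2 = - \<i> * of_real pi / 4"
proof -
  define q where "q t y = cis (- (t ^ 2 * (1 + y ^ 2))) / of_real (1 + y ^ 2)" for t y :: real
  define q' where "q' t y = - 2 * \<i> * of_real t * cis (- (t ^ 2 * (1 + y ^ 2)))" for t y :: real
  define Q where "Q t = integral (cbox 0 1) (q t)" for t
  have pos: "1 + y ^ 2 > 0" "1 + y ^ 2 \<noteq> 0" "of_real (1 + y ^ 2) \<noteq> (0::complex)" for y :: real
  proof -
    show 1: "1 + y ^ 2 > 0" by (intro add_pos_nonneg) auto
    then show 2: "1 + y ^ 2 \<noteq> 0" by (rule less_imp_neq[symmetric])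
    then show "of_real (1 + y ^ 2) \<noteq> (0::complex)" by (simp only: of_real_eq_0_iff not_False_eq_True)
  qed
  have q'_int: "integral (cbox 0 1) (q' t) = - 2 * \<i> * cis (- (t ^ 2)) * fresnel t" if "t \<ge> 0" for t
  proof -
    have "((\<lambda>y. (- 2 * \<i> * cis (- (t ^ 2))) * (of_real t * cis (- ((t * y) ^ 2)))) has_integral
        (- 2 * \<i> * cis (- (t ^ 2))) * fresnel (t * 1)) {0..1}"
      by (intro has_integral_mult_right fresnel_scaled_integral that) simp
    moreover have "(- 2 * \<i> * cis (- (t ^ 2))) * (of_real t * cis (- ((t * y) ^ 2))) = q' t y" for y
    proof -
      have "cis (- (t ^ 2)) * cis (- ((t * y) ^ 2)) = cis (- (t ^ 2 * (1 + y ^ 2)))"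
        by (simp add: cis_mult power_mult_distrib algebra_simps)
      then show ?thesis by (simp add: q'_def mult_ac)
    qed
    ultimately show ?thesis by (simp add: integral_unique)
  qed
  have Q_deriv: "(Q has_vector_derivative integral (cbox 0 1) (q' t)) (at t within {0..T})"
    if "t \<in> {0..T}" for t T
    unfolding Q_def[abs_def]
  proof (rule leibniz_rule_vector_derivative)
    fix s y :: real
    have "((\<lambda>s. cis (- (s ^ 2 * (1 + y ^ 2)))) has_vector_derivative
        \<i> * of_real (- (2 * s * (1 + y ^ 2))) * cis (- (s ^ 2 * (1 + y ^ 2)))) (at s within {0..T})"
      by (rule cis_vector_derivative) (auto intro!: derivative_eq_intros)
    then have "((\<lambda>s. q s y) has_vector_derivative
        \<i> * of_real (- (2 * s * (1 + y ^ 2))) * cis (- (s ^ 2 * (1 + y ^ 2))) / of_real (1 + y ^ 2)) (at s within {0..T})"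
      unfolding q_def by (rule has_vector_derivative_divide)
    also have "\<i> * of_real (- (2 * s * (1 + y ^ 2))) * cis (- (s ^ 2 * (1 + y ^ 2))) / of_real (1 + y ^ 2) = q' s y"
      using pos(3)[of y] by (simp add: q'_def del: of_real_add)
    finally show "((\<lambda>s. q s y) has_vector_derivative q' s y) (at s within {0..T})" .
  next
    fix s :: real
    show "q s integrable_on cbox 0 1"
      unfolding q_def using pos by (intro integrable_continuous continuous_intros) auto
  next
    show "continuous_on ({0..T} \<times> cbox 0 1) (\<lambda>(s, y). q' s y)"
      unfolding q'_def case_prod_unfold by (intro continuous_intros)
  qed (use that in auto)
  have const: "Q T + \<i> * fresnel T ^ 2 = of_real (pi / 4)" if T: "T \<ge> 0" for T
  proof -
    have "((\<lambda>t. Q t + \<i> * fresnel t ^ 2) has_vector_derivative 0) (at t within {0..T})" if t: "t \<in> {0..T}" for t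
    proof -
      have "((\<lambda>t. Q t + \<i> * (fresnel t * fresnel t)) has_vector_derivative
          integral (cbox 0 1) (q' t) + \<i> * (fresnel t * cis (- (t ^ 2)) + cis (- (t ^ 2)) * fresnel t)) (at t within {0..T})"
        by (intro has_vector_derivative_add Q_deriv has_vector_derivative_mult_right
            has_vector_derivative_mult fresnel_vector_derivative t)
      moreover have "integral (cbox 0 1) (q' t) + \<i> * (fresnel t * cis (- (t ^ 2)) + cis (- (t ^ 2)) * fresnel t) = 0"
        using q'_int[of t] t by simp
      ultimately show ?thesis by (simp only: power2_eq_square)
    qed
    then obtain c where c: "\<And>t. t \<in> {0..T} \<Longrightarrow> Q t + \<i> * fresnel t ^ 2 = c"
      using has_vector_derivative_zero_constant[of "{0..T}" "\<lambda>t. Q t + \<i> * fresnel t ^ 2"] by auto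
    have "Q 0 = of_real (pi / 4)"
    proof -
      have "((\<lambda>y. 1 / (1 + y ^ 2)) has_integral arctan 1 - arctan 0) {0..1 :: real}"
        by (rule fundamental_theorem_of_calculus)
          (auto intro!: derivative_eq_intros simp: has_real_derivative_iff_has_vector_derivative[symmetric] field_simps)
      then have "((\<lambda>y. of_real (1 / (1 + y ^ 2)) :: complex) has_integral of_real (arctan 1 - arctan 0)) {0..1 :: real}"
        by (rule has_integral_of_real)
      from integral_unique[OF this] show ?thesis by (simp add: Q_def q_def[abs_def] arctan_one)
    qed
    then have "c = of_real (pi / 4)" using c[of 0] T by (simp add: fresnel_def)
    then show ?thesis using c[of T] T by simp
  qed
  have Q_le: "norm (Q T) \<le> norm fresnel_const / T + 18 / T ^ 2" if T: "T > 0" for T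
  proof -
    define h where "h y = complex_of_real (1 / (1 + y ^ 2))" for y
    define h' where "h' y = complex_of_real (- (2 * y) / (1 + y ^ 2) ^ 2)" for y
    define h'' where "h'' y = complex_of_real ((6 * y ^ 2 - 2) / (1 + y ^ 2) ^ 3)" for y
    have "norm (integral {0..1} (\<lambda>r. h r * cis (- (T ^ 2 * r ^ 2))) - h 0 * fresnel_const / of_real (sqrt (T ^ 2)))
        \<le> (2 * norm (h 0) / 1 + norm (h' 0) + 2 * 8 * 1) / T ^ 2"
    proof (rule fresnel_integral_asymptotic)
      fix y :: real assume y: "y \<in> {0..1}"
      show "(h has_vector_derivative h' y) (at y within {0..1})"
        unfolding h_def h'_def using pos(2)[of y]
        by (intro has_vector_derivative_of_real)
          (auto intro!: derivative_eq_intros simp: power2_eq_square)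
      show "(h' has_vector_derivative h'' y) (at y within {0..1})"
        unfolding h'_def h''_def
      proof (intro has_vector_derivative_of_real)
        let ?d = "1 + y ^ 2"
        have "((\<lambda>y. - (2 * y) / (1 + y ^ 2) ^ 2) has_real_derivative
            (- 2 * ?d ^ 2 - (- (2 * y)) * (2 * ?d * (2 * y))) / (?d ^ 2 * ?d ^ 2)) (at y within {0..1})"
        proof (rule DERIV_divide)
          show "((\<lambda>y. - (2 * y)) has_real_derivative - 2) (at y within {0..1})"
            by (auto intro!: derivative_eq_intros)
          show "((\<lambda>y. (1 + y ^ 2) ^ 2) has_real_derivative 2 * ?d * (2 * y)) (at y within {0..1})"
            by (auto intro!: derivative_eq_intros)
          show "?d ^ 2 \<noteq> 0" using pos(2)[of y] by simp
        qed
        also have "(- 2 * ?d ^ 2 - (- (2 * y)) * (2 * ?d * (2 * y))) / (?d ^ 2 * ?d ^ 2) = (?d * (6 * y ^ 2 - 2)) / (?d * ?d ^ 3)"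
          by (rule arg_cong2[where f = "(/)"]) (simp_all add: power2_eq_square power3_eq_cube algebra_simps)
        also have "\<dots> = (6 * y ^ 2 - 2) / ?d ^ 3" using pos(2)[of y] by simp
        finally show "((\<lambda>y. - (2 * y) / (1 + y ^ 2) ^ 2) has_real_derivative (6 * y ^ 2 - 2) / (1 + y ^ 2) ^ 3) (at y within {0..1})" .
      qed
      have "\<bar>6 * y ^ 2 - 2\<bar> \<le> 8 * (1 + y ^ 2) ^ 3"
      proof -
        have y2: "0 \<le> y ^ 2" "y ^ 2 \<le> 1" using y by (auto simp: power_le_one)
        then have "1 \<le> (1 + y ^ 2) ^ 3" by (intro one_le_power) simp
        then show ?thesis using y2 by (intro abs_leI) linarith+
      qed
      then show "norm (h'' y) \<le> 8" using pos(1)[of y]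
        by (simp only: h''_def norm_of_real abs_divide) (simp add: divide_le_eq)
    qed (use T in auto)
    then have a: "norm (integral {0..1} (\<lambda>r. h r * cis (- (T ^ 2 * r ^ 2))) - fresnel_const / of_real T) \<le> 18 / T ^ 2"
      using T by (simp add: h_def h'_def)
    have "Q T = cis (- (T ^ 2)) * integral {0..1} (\<lambda>r. h r * cis (- (T ^ 2 * r ^ 2)))"
    proof -
      have "q T y = cis (- (T ^ 2)) * (h y * cis (- (T ^ 2 * y ^ 2)))" for y
      proof -
        have "cis (- (T ^ 2)) * cis (- (T ^ 2 * y ^ 2)) = cis (- (T ^ 2 * (1 + y ^ 2)))"
          by (simp add: cis_mult algebra_simps)
        then show ?thesis by (simp add: q_def h_def mult_ac)
      qed
      then have "q T = (\<lambda>y. cis (- (T ^ 2)) * (h y * cis (- (T ^ 2 * y ^ 2))))" by auto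
      then show ?thesis by (simp add: Q_def)
    qed
    then have "norm (Q T) = norm (fresnel_const / of_real T + (integral {0..1} (\<lambda>r. h r * cis (- (T ^ 2 * r ^ 2))) - fresnel_const / of_real T))"
      by (simp add: norm_mult)
    also have "\<dots> \<le> norm (fresnel_const / of_real T) + 18 / T ^ 2"
      by (rule norm_triangle_mono[OF order_refl a])
    finally show ?thesis using T by (simp add: norm_divide)
  qed
  have inf: "filterlim (\<lambda>n. real (Suc n)) at_top sequentially"
    using filterlim_compose[OF filterlim_real_sequentially filterlim_Suc] .
  have "(\<lambda>n. Q (real (Suc n))) \<longlonglongrightarrow> 0"
  proof (rule Lim_null_comparison)
    show "\<forall>\<^sub>F n in sequentially. norm (Q (real (Suc n))) \<le> norm fresnel_const / real (Suc n) + 18 / real (Suc n) ^ 2"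
      by (intro always_eventually allI Q_le) simp
    show "(\<lambda>n. norm fresnel_const / real (Suc n) + 18 / real (Suc n) ^ 2) \<longlonglongrightarrow> 0"
      by (rule tendsto_eq_intros tendsto_divide_0 tendsto_const filterlim_at_top_imp_at_infinity inf
          filterlim_pow_at_top | simp)+
  qed
  moreover have "(\<lambda>n. fresnel (real (Suc n))) \<longlonglongrightarrow> fresnel_const"
  proof (rule LIM_zero_cancel, rule Lim_null_comparison)
    show "\<forall>\<^sub>F n in sequentially. norm (fresnel (real (Suc n)) - fresnel_const) \<le> 2 / real (Suc n)"
      by (intro always_eventually allI fresnel_const_bound) simp
    show "(\<lambda>n. 2 / real (Suc n)) \<longlonglongrightarrow> 0"
      by (rule tendsto_divide_0 tendsto_const filterlim_at_top_imp_at_infinity inf)+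
  qed
  ultimately have "(\<lambda>n. Q (real (Suc n)) + \<i> * fresnel (real (Suc n)) ^ 2) \<longlonglongrightarrow> 0 + \<i> * fresnel_const ^ 2"
    by (intro tendsto_intros)
  then have "(\<lambda>n. of_real (pi / 4)) \<longlonglongrightarrow> \<i> * fresnel_const ^ 2"
    by (simp add: const)
  then have "of_real (pi / 4) = \<i> * fresnel_const ^ 2"
    by (simp add: LIMSEQ_const_iff)
  then have "- \<i> * of_real (pi / 4) = - \<i> * (\<i> * fresnel_const ^ 2)" by simp
  then show ?thesis by simp
qed

lemma osc_affine_vector_derivative:
  assumes "r0 + e * t > 0"
  shows "((\<lambda>t. osc u 0 0 (r0 + e * t)) has_vector_derivative of_real e * (u * osc (u - 1) 0 0 (r0 + e * t))) (at t within S)"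
proof -
  have "((\<lambda>t. r0 + e * t) has_vector_derivative e) (at t within S)"
    by (auto intro!: derivative_eq_intros)
  from vector_diff_chain_within[OF this osc_vector_derivative[OF assms, of u 0 0]]
  have "((\<lambda>t. osc u 0 0 (r0 + e * t)) has_vector_derivative
     e *\<^sub>R ((u / of_real (r0 + e * t) + \<i> * of_real (0 / sqrt (r0 + e * t) + 0)) * osc u 0 0 (r0 + e * t))) (at t within S)"
    by (simp add: o_def)
  moreover have "osc u 0 0 (r0 + e * t) = of_real (r0 + e * t) * osc (u - 1) 0 0 (r0 + e * t)"
    using osc_shift[OF assms, of "u - 1" 1 0 0] assms by simp
  ultimately show ?thesis
    using assms by (simp add: scaleR_conv_of_real del: of_real_add)
qed

text \<open>
  The substitution \<open>y = a (r0 + e t)\<^sup>2\<close> turns the phase into \<open>2 \<pi> a k r0\<^sup>2 - 2 \<pi> a k t\<^sup>2\<close> exactly, so that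
  \<open>fresnel_integral_asymptotic\<close> applies with \<open>L = 2 \<pi> a k\<close>. The sign \<open>e\<close> selects the side of the
  stationary point \<open>a r0\<^sup>2\<close>. One of the two integrals is over an empty interval; their difference is
  the integral with orientation, and this covers both sides by one formula.
\<close>
lemma stationary_phase_half:
  fixes w :: complex
  assumes r0: "r0 > 0" and k: "k > 0" and R: "R > 0" and e: "e = 1 \<or> e = -1" and pos: "r0 + e * R > 0"
  obtains C where "C > 0"
    "\<And>a. a > 0 \<Longrightarrow>
      norm (of_real e * (integral {a * r0 ^ 2..a * (r0 + e * R) ^ 2} (osc w (2 * pi * (sqrt a * (k * r0))) (- (2 * pi * k)))
                       - integral {a * (r0 + e * R) ^ 2..a * r0 ^ 2} (osc w (2 * pi * (sqrt a * (k * r0))) (- (2 * pi * k))))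
        - 2 * osc (2 * w + 1) 0 0 r0 * fresnel_const / of_real (sqrt (2 * pi * k))
          * cis (2 * pi * (a * k * r0 ^ 2)) * of_real a powr (w + 1/2))
      \<le> C * a powr Re w"
proof -
  define u where "u = 2 * w + 1"
  define h where "h t = osc u 0 0 (r0 + e * t)" for t
  define h' where "h' t = of_real e * (u * osc (u - 1) 0 0 (r0 + e * t))" for t
  define h'' where "h'' t = of_real e * (u * (of_real e * ((u - 1) * osc (u - 1 - 1) 0 0 (r0 + e * t))))" for t
  have rpos: "r0 + e * t > 0" if "t \<in> {0..R}" for t
    using e r0 pos that by auto
  have h1: "(h has_vector_derivative h' t) (at t within {0..R})" if "t \<in> {0..R}" for t
    unfolding h_def h'_def by (intro osc_affine_vector_derivative rpos that)
  have h2: "(h' has_vector_derivative h'' t) (at t within {0..R})" if "t \<in> {0..R}" for t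
    unfolding h'_def h''_def
    by (intro has_vector_derivative_mult_right osc_affine_vector_derivative rpos that)
  have "continuous_on {0..R} h''"
    unfolding h''_def
    by (intro continuous_intros continuous_on_compose2[OF osc_continuous_on[OF order_refl]])
      (use rpos in auto)
  then have "bounded (h'' ` {0..R})"
    by (rule compact_imp_bounded[OF compact_continuous_image[OF _ compact_Icc]])
  then obtain A where A: "\<And>t. t \<in> {0..R} \<Longrightarrow> norm (h'' t) \<le> A"
    unfolding bounded_iff by blast
  define D where "D = 2 * norm (h 0) / R + norm (h' 0) + 2 * A * R"
  define C where "C = \<bar>D\<bar> / (pi * k) + 1"
  show ?thesis
  proof
    show "C > 0" using k by (simp add: C_def add_nonneg_pos)
    fix a :: real assume a: "a > 0"
    define L where "L = 2 * pi * a * k"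
    have L: "L > 0" using a k by (simp add: L_def)
    let ?f = "osc w (2 * pi * (sqrt a * (k * r0))) (- (2 * pi * k))"
    let ?g = "\<lambda>t. a * (r0 + e * t) ^ 2"
    let ?m = "2 * cis (2 * pi * (a * k * r0 ^ 2)) * of_real a powr (w + 1)"
    define I where "I = integral {0..R} (\<lambda>t. h t * cis (- (L * t ^ 2)))"
    have "((\<lambda>t. (2 * a * e * (r0 + e * t)) *\<^sub>R ?f (?g t)) has_integral
       (integral {?g 0..?g R} ?f - integral {?g R..?g 0} ?f)) {0..R}"
    proof (rule has_integral_substitution_general[where s = "{}" and c = "min (?g 0) (?g R)" and d = "max (?g 0) (?g R)"])
      show "?g ` {0..R} \<subseteq> {min (?g 0) (?g R)..max (?g 0) (?g R)}"
      proof
        fix y assume "y \<in> ?g ` {0..R}"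
        then obtain t where t: "t \<in> {0..R}" "y = ?g t" by auto
        have "(r0 + e * t) ^ 2 \<in> {min ((r0 + e * 0) ^ 2) ((r0 + e * R) ^ 2)..max ((r0 + e * 0) ^ 2) ((r0 + e * R) ^ 2)}"
          using e
        proof
          assume [simp]: "e = 1"
          have "r0 ^ 2 \<le> (r0 + t) ^ 2" "(r0 + t) ^ 2 \<le> (r0 + R) ^ 2"
            using t r0 by (auto intro!: power_mono)
          then show ?thesis by (auto simp: min_def max_def)
        next
          assume [simp]: "e = -1"
          have "(r0 - t) ^ 2 \<le> r0 ^ 2" "(r0 - R) ^ 2 \<le> (r0 - t) ^ 2"
            using t r0 pos by (auto intro!: power_mono)
          then show ?thesis by (auto simp: min_def max_def)
        qed
        then show "y \<in> {min (?g 0) (?g R)..max (?g 0) (?g R)}"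
          using t a by (auto simp: min_def max_def split: if_splits)
      qed
      show "continuous_on {min (?g 0) (?g R)..max (?g 0) (?g R)} ?f"
      proof (rule osc_continuous_on)
        have "min (?g 0) (?g R) > 0" using a r0 pos by simp
        then show "{min (?g 0) (?g R)..max (?g 0) (?g R)} \<subseteq> {0<..}"
          using less_le_trans by fastforce
      qed
    next
      fix t assume "t \<in> {0..R} - {}"
      show "(?g has_field_derivative 2 * a * e * (r0 + e * t)) (at t within {0..R})"
        by (auto intro!: derivative_eq_intros)
    qed (use R in \<open>auto intro!: continuous_intros\<close>)
    moreover have "(2 * a * e * (r0 + e * t)) *\<^sub>R ?f (?g t) = of_real e * ?m * (h t * cis (- (L * t ^ 2)))"
      if t: "t \<in> {0..R}" for t
    proof -
      define r where "r = r0 + e * t"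
      have r: "r > 0" using rpos[OF t] by (simp add: r_def)
      have ee: "e * e = 1" using e by auto
      have "sqrt (a * r ^ 2) = sqrt a * r" using r a by (simp add: real_sqrt_mult)
      then have "2 * (2 * pi * (sqrt a * (k * r0))) * sqrt (a * r ^ 2) = 4 * pi * k * r0 * r * (sqrt a * sqrt a)"
        by (simp add: mult_ac)
      also have "sqrt a * sqrt a = a" using a by simp
      finally have s: "2 * (2 * pi * (sqrt a * (k * r0))) * sqrt (a * r ^ 2) = 4 * pi * k * r0 * r * a" .
      have "(r - r0) ^ 2 = (e * e) * t ^ 2" by (simp add: r_def power2_eq_square mult_ac)
      then have t2: "t ^ 2 = (r - r0) ^ 2" using ee by simp
      have ph: "2 * (2 * pi * (sqrt a * (k * r0))) * sqrt (a * r ^ 2) + - (2 * pi * k) * (a * r ^ 2)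
          = 2 * pi * (a * k * r0 ^ 2) + - (L * t ^ 2)"
        unfolding s t2 L_def by (simp add: power2_eq_square algebra_simps)
      have ln: "ln (a * r ^ 2) = ln a + 2 * ln r" using a r by (simp add: ln_mult ln_realpow)
      have "of_real (a * r) * exp (w * of_real (ln (a * r ^ 2))) = of_real a powr (w + 1) * osc u 0 0 r"
      proof -
        have "of_real (a * r) = exp (of_real (ln a + ln r) :: complex)"
          using a r by (simp add: exp_add exp_of_real)
        then have "of_real (a * r) * exp (w * of_real (ln (a * r ^ 2))) = exp (of_real (ln a + ln r) + w * of_real (ln a + 2 * ln r))"
          by (simp add: ln exp_add)
        also have "\<dots> = exp ((w + 1) * of_real (ln a) + u * of_real (ln r))"
          by (simp add: u_def algebra_simps)
        also have "\<dots> = of_real a powr (w + 1) * osc u 0 0 r"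
          using a by (simp add: exp_add powr_def osc_def Ln_of_real)
        finally show ?thesis .
      qed
      moreover have "?f (a * r ^ 2) = exp (w * of_real (ln (a * r ^ 2))) * (cis (2 * pi * (a * k * r0 ^ 2)) * cis (- (L * t ^ 2)))"
        unfolding osc_def exp_add ph by (simp add: cis_conv_exp exp_add[symmetric] algebra_simps)
      ultimately show ?thesis
        unfolding r_def[symmetric] h_def by (simp add: scaleR_conv_of_real mult_ac)
    qed
    ultimately have "((\<lambda>t. of_real e * ?m * (h t * cis (- (L * t ^ 2)))) has_integral
       (integral {?g 0..?g R} ?f - integral {?g R..?g 0} ?f)) {0..R}"
      by (rule has_integral_eq[rotated])
    moreover have "((\<lambda>t. of_real e * ?m * (h t * cis (- (L * t ^ 2)))) has_integral of_real e * ?m * I) {0..R}"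
      unfolding I_def using h1
      by (intro has_integral_mult_right integrable_integral integrable_continuous_real continuous_intros
          continuous_on_vector_derivative) auto
    ultimately have "integral {?g 0..?g R} ?f - integral {?g R..?g 0} ?f = of_real e * ?m * I"
      by (rule has_integral_unique)
    then have eq: "of_real e * (integral {a * r0 ^ 2..?g R} ?f - integral {?g R..a * r0 ^ 2} ?f) = ?m * I"
      using e by auto
    have I: "norm (I - h 0 * fresnel_const / of_real (sqrt L)) \<le> D / L"
      unfolding I_def D_def
      by (rule fresnel_integral_asymptotic[where h' = h' and h'' = h'']) (use L R h1 h2 A in auto)
    have split: "2 * osc (2 * w + 1) 0 0 r0 * fresnel_const / of_real (sqrt (2 * pi * k))
          * cis (2 * pi * (a * k * r0 ^ 2)) * of_real a powr (w + 1/2) = ?m * (h 0 * fresnel_const / of_real (sqrt L))"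
    proof -
      have "of_real a powr (w + 1) = of_real a powr (w + 1/2) * (of_real (sqrt a) :: complex)"
      proof -
        have s: "of_real (sqrt a) = of_real a powr (1/2 :: complex)"
          using a powr_of_real[of a "1/2"] by (simp add: powr_half_sqrt)
        have e: "w + 1 = (w + 1/2) + 1/2" by simp
        show ?thesis unfolding s by (subst e) (rule powr_add)
      qed
      moreover have "of_real (sqrt L) = of_real (sqrt (2 * pi * k)) * (of_real (sqrt a) :: complex)"
        by (simp add: L_def real_sqrt_mult mult_ac)
      ultimately show ?thesis
        using a k by (simp add: h_def u_def field_simps)
    qed
    have "norm (?m * I - ?m * (h 0 * fresnel_const / of_real (sqrt L))) \<le> (2 * a powr (Re w + 1)) * (D / L)"
    proof -
      have m: "norm ?m = 2 * a powr (Re w + 1)" using a by (simp add: norm_mult norm_powr_real_powr)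
      have d: "norm (?m * I - ?m * Y) = norm ?m * norm (I - Y)" for Y
        by (simp only: right_diff_distrib[symmetric] norm_mult)
      show ?thesis unfolding d m by (intro mult_left_mono I) simp
    qed
    also have "\<dots> \<le> (2 * a powr (Re w + 1)) * (\<bar>D\<bar> / L)"
      using L by (intro mult_left_mono divide_right_mono) auto
    also have "\<dots> = \<bar>D\<bar> / (pi * k) * a powr Re w"
      using a k by (simp add: L_def powr_add)
    also have "\<dots> \<le> C * a powr Re w" by (simp add: C_def distrib_right)
    finally show "norm (of_real e * (integral {a * r0 ^ 2..?g R} ?f - integral {?g R..a * r0 ^ 2} ?f)
        - 2 * osc (2 * w + 1) 0 0 r0 * fresnel_const / of_real (sqrt (2 * pi * k))
          * cis (2 * pi * (a * k * r0 ^ 2)) * of_real a powr (w + 1/2)) \<le> C * a powr Re w"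
      unfolding eq split .
  qed
qed

text \<open>
  The interval consists of the points where the frequency \<open>2 \<pi> sqrt (a x / t)\<close> differs from
  \<open>2 \<pi> k\<close> by at most \<open>\<pi>\<close>. It contains the stationary point \<open>a x / k\<^sup>2\<close>, where the two halves meet.
\<close>
lemma stationary_phase:
  fixes w :: complex
  assumes x: "x > 0" and k: "k \<ge> 1"
  obtains g C where "C > 0"
    "\<And>a. a > 0 \<Longrightarrow>
      norm (integral {a * (x / (k + 1/2) ^ 2)..a * (x / (k - 1/2) ^ 2)} (osc w (2 * pi * sqrt (a * x)) (- (2 * pi * k)))
        - g * fresnel_const * cis (2 * pi * (a * x / k)) * of_real a powr (w + 1/2)) \<le> C * a powr Re w"
    "g = 4 * osc (2 * w + 1) 0 0 (sqrt x / k) / of_real (sqrt (2 * pi * k))"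
proof -
  define r0 where "r0 = sqrt x / k"
  define r1 where "r1 = sqrt x / (k + 1/2)"
  define r2 where "r2 = sqrt x / (k - 1/2)"
  have r: "r0 > 0" "r1 > 0" "r2 > 0" "r1 < r0" "r0 < r2"
    using x k by (auto simp: r0_def r1_def r2_def intro!: divide_strict_left_mono)
  have k0: "k > 0" using k by simp
  obtain C1 where C1: "C1 > 0" "\<And>a. a > 0 \<Longrightarrow>
      norm (of_real 1 * (integral {a * r0 ^ 2..a * (r0 + 1 * (r2 - r0)) ^ 2} (osc w (2 * pi * (sqrt a * (k * r0))) (- (2 * pi * k)))
                       - integral {a * (r0 + 1 * (r2 - r0)) ^ 2..a * r0 ^ 2} (osc w (2 * pi * (sqrt a * (k * r0))) (- (2 * pi * k))))
        - 2 * osc (2 * w + 1) 0 0 r0 * fresnel_const / of_real (sqrt (2 * pi * k))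
          * cis (2 * pi * (a * k * r0 ^ 2)) * of_real a powr (w + 1/2))
      \<le> C1 * a powr Re w"
    by (rule stationary_phase_half[of r0 k "r2 - r0" 1 w]) (use r k0 in auto)
  obtain C2 where C2: "C2 > 0" "\<And>a. a > 0 \<Longrightarrow>
      norm (of_real (-1) * (integral {a * r0 ^ 2..a * (r0 + (-1) * (r0 - r1)) ^ 2} (osc w (2 * pi * (sqrt a * (k * r0))) (- (2 * pi * k)))
                       - integral {a * (r0 + (-1) * (r0 - r1)) ^ 2..a * r0 ^ 2} (osc w (2 * pi * (sqrt a * (k * r0))) (- (2 * pi * k))))
        - 2 * osc (2 * w + 1) 0 0 r0 * fresnel_const / of_real (sqrt (2 * pi * k))
          * cis (2 * pi * (a * k * r0 ^ 2)) * of_real a powr (w + 1/2))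
      \<le> C2 * a powr Re w"
    by (rule stationary_phase_half[of r0 k "r0 - r1" "-1" w]) (use r k0 in auto)
  define g where "g = 4 * osc (2 * w + 1) 0 0 (sqrt x / k) / of_real (sqrt (2 * pi * k))"
  show ?thesis
  proof
    show "C1 + C2 > 0" using C1(1) C2(1) by simp
    show "g = 4 * osc (2 * w + 1) 0 0 (sqrt x / k) / of_real (sqrt (2 * pi * k))" by (fact g_def)
    fix a :: real assume a: "a > 0"
    let ?f = "osc w (2 * pi * (sqrt a * (k * r0))) (- (2 * pi * k))"
    define M where "M = 2 * osc (2 * w + 1) 0 0 r0 * fresnel_const / of_real (sqrt (2 * pi * k))
          * cis (2 * pi * (a * k * r0 ^ 2)) * of_real a powr (w + 1/2)"
    have lt: "a * r0 ^ 2 < a * r2 ^ 2" "a * r1 ^ 2 < a * r0 ^ 2" "a * r1 ^ 2 > 0"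
      using r a by (auto intro!: power_strict_mono)
    have 1: "norm (integral {a * r0 ^ 2..a * r2 ^ 2} ?f - M) \<le> C1 * a powr Re w"
      using C1(2)[OF a] lt by (simp add: M_def)
    have 2: "norm (integral {a * r1 ^ 2..a * r0 ^ 2} ?f - M) \<le> C2 * a powr Re w"
      using C2(2)[OF a] lt by (simp add: M_def)
    have "integral {a * r1 ^ 2..a * r0 ^ 2} ?f + integral {a * r0 ^ 2..a * r2 ^ 2} ?f = integral {a * r1 ^ 2..a * r2 ^ 2} ?f"
      by (rule osc_integral_combine) (use lt in auto)
    then have "integral {a * r1 ^ 2..a * r2 ^ 2} ?f - 2 * M
       = (integral {a * r0 ^ 2..a * r2 ^ 2} ?f - M) + (integral {a * r1 ^ 2..a * r0 ^ 2} ?f - M)"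
      by (simp add: algebra_simps)
    then have 3: "norm (integral {a * r1 ^ 2..a * r2 ^ 2} ?f - 2 * M) \<le> (C1 + C2) * a powr Re w"
      using norm_triangle_mono[OF 1 2] by (simp add: algebra_simps)
    have "r1 ^ 2 = x / (k + 1/2) ^ 2" "r2 ^ 2 = x / (k - 1/2) ^ 2"
      using x by (simp_all add: r1_def r2_def power_divide)
    moreover have "sqrt a * (k * r0) = sqrt (a * x)" using k0 by (simp add: r0_def real_sqrt_mult)
    moreover have "2 * M = g * fresnel_const * cis (2 * pi * (a * x / k)) * of_real a powr (w + 1/2)"
    proof -
      have "k * r0 ^ 2 = x / k" using k0 x by (simp add: r0_def power_divide power2_eq_square)
      then have "a * k * r0 ^ 2 = a * x / k" by (simp add: mult.assoc)
      then show ?thesis by (simp add: M_def g_def r0_def)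
    qed
    ultimately show "norm (integral {a * (x / (k + 1/2) ^ 2)..a * (x / (k - 1/2) ^ 2)} (osc w (2 * pi * sqrt (a * x)) (- (2 * pi * k)))
        - g * fresnel_const * cis (2 * pi * (a * x / k)) * of_real a powr (w + 1/2)) \<le> (C1 + C2) * a powr Re w"
      using 3 by simp
  qed
qed

section \<open>Asymptotics of the inner sum\<close>

text \<open>For fixed \<open>c\<close> the frequency tends to 0, so the tails are bounded by \<open>osc_sum_bound_sqrt\<close>.\<close>
lemma osc_summable:
  assumes w: "Re w < -1/2" and c: "c > 0" and p: "p \<ge> 0"
  shows "summable (\<lambda>n. osc w c 0 (p + real n))"
  unfolding summable_Cauchy
proof (intro allI impI)
  fix e :: real assume e: "e > 0"
  obtain C T where C: "C > 0" "T \<ge> 1" and bound: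
    "\<And>c p N. c > 0 \<Longrightarrow> p \<ge> T \<Longrightarrow> c \<le> 3 * pi / 2 * sqrt p \<Longrightarrow>
      norm (\<Sum>j<N. osc w c 0 (p + real j)) \<le> C * p powr (Re w + 1/2) / c"
    by (rule osc_sum_bound_sqrt[OF w]) blast
  have "((\<lambda>n. C * real n powr (Re w + 1/2) / c) \<longlongrightarrow> C * 0 / c) sequentially"
    using w c by (intro tendsto_intros tendsto_neg_powr filterlim_real_sequentially) auto
  then have "\<forall>\<^sub>F n in sequentially. C * real n powr (Re w + 1/2) / c < e"
    using e by (intro order_tendstoD) auto
  moreover have "\<forall>\<^sub>F n in sequentially. real n \<ge> max T (c ^ 2)"
    using filterlim_real_sequentially unfolding filterlim_at_top by blast
  ultimately have "\<forall>\<^sub>F n in sequentially. real n \<ge> max T (c ^ 2) \<and> C * real n powr (Re w + 1/2) / c < e"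
    by eventually_elim auto
  then obtain N where N: "\<And>n. n \<ge> N \<Longrightarrow> real n \<ge> max T (c ^ 2) \<and> C * real n powr (Re w + 1/2) / c < e"
    unfolding eventually_sequentially by blast
  show "\<exists>N. \<forall>m\<ge>N. \<forall>n. norm (sum (\<lambda>n. osc w c 0 (p + real n)) {m..<n}) < e"
  proof (intro exI allI impI)
    fix m n assume m: "m \<ge> N"
    have m1: "real m \<ge> T" "real m \<ge> c ^ 2" "real m \<ge> 1" using N[OF m] C by auto
    have "sum (\<lambda>n. osc w c 0 (p + real n)) {m..<n} = (\<Sum>j<n - m. osc w c 0 (p + real m + real j))"
      by (subst sum.atLeastLessThan_shift_0) (simp add: atLeast0LessThan add_ac)
    also have "norm \<dots> \<le> C * (p + real m) powr (Re w + 1/2) / c"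
    proof (rule bound[OF c])
      have "c \<le> sqrt (p + real m)" using m1 p by (intro real_le_rsqrt) auto
      also have "\<dots> \<le> 3 * pi / 2 * sqrt (p + real m)"
      proof -
        have "1 \<le> 3 * pi / 2" using pi_gt3 by simp
        from mult_right_mono[OF this, of "sqrt (p + real m)"] show ?thesis using p by simp
      qed
      finally show "c \<le> 3 * pi / 2 * sqrt (p + real m)" .
    qed (use m1 p in auto)
    also have "\<dots> \<le> C * real m powr (Re w + 1/2) / c"
      using C c w m1 p by (intro divide_right_mono mult_left_mono powr_mono2') auto
    also have "\<dots> < e" using N[OF m] by simp
    finally show "norm (sum (\<lambda>n. osc w c 0 (p + real n)) {m..<n}) < e" .
  qed
qed

lemma osc_suminf_bound_sqrt:
  fixes w :: complex
  assumes w: "Re w < -1/2"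
  obtains C T where "C > 0" "T \<ge> 1"
    "\<And>c p. c > 0 \<Longrightarrow> p \<ge> T \<Longrightarrow> c \<le> 3 * pi / 2 * sqrt p \<Longrightarrow>
      norm (\<Sum>j. osc w c 0 (p + real j)) \<le> C * p powr (Re w + 1/2) / c"
proof -
  obtain C T where C: "C > 0" "T \<ge> 1" and bound:
    "\<And>c p N. c > 0 \<Longrightarrow> p \<ge> T \<Longrightarrow> c \<le> 3 * pi / 2 * sqrt p \<Longrightarrow>
      norm (\<Sum>j<N. osc w c 0 (p + real j)) \<le> C * p powr (Re w + 1/2) / c"
    by (rule osc_sum_bound_sqrt[OF w]) blast
  show ?thesis
  proof
    fix c p :: real assume c: "c > 0" "p \<ge> T" "c \<le> 3 * pi / 2 * sqrt p"
    have "(\<lambda>N. norm (\<Sum>j<N. osc w c 0 (p + real j))) \<longlonglongrightarrow> norm (\<Sum>j. osc w c 0 (p + real j))"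
      using c C by (intro tendsto_norm summable_LIMSEQ osc_summable[OF w]) auto
    then show "norm (\<Sum>j. osc w c 0 (p + real j)) \<le> C * p powr (Re w + 1/2) / c"
      by (rule tendsto_upperbound) (auto intro: always_eventually bound c)
  qed (use C in auto)
qed

text \<open>The point where the frequency \<open>2 \<pi> sqrt (a x / b)\<close> of the inner sum equals \<open>2 \<pi> (k + 1/2)\<close>.\<close>
definition cutoff :: "real \<Rightarrow> nat \<Rightarrow> real \<Rightarrow> real" where
  "cutoff x k a = a * (x / (real k + 1/2) ^ 2)"

definition cutoff_index :: "real \<Rightarrow> nat \<Rightarrow> real \<Rightarrow> real \<Rightarrow> nat" where
  "cutoff_index x k a \<theta> = nat \<lceil>cutoff x k a - \<theta>\<rceil>"

definition stationary_coeff :: "real \<Rightarrow> complex \<Rightarrow> nat \<Rightarrow> complex" where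
  "stationary_coeff x w k = 4 * osc (2 * w + 1) 0 0 (sqrt x / real k) / of_real (sqrt (2 * pi * real k))"

lemma less_cutoff_index_iff: "n < cutoff_index x k a \<theta> \<longleftrightarrow> real n + \<theta> < cutoff x k a"
  unfolding cutoff_index_def by (auto simp: zless_nat_eq_int_zless less_ceiling_iff)

lemma cutoff_index_bounds:
  assumes "\<theta> \<le> cutoff x k a"
  shows "cutoff x k a \<le> real (cutoff_index x k a \<theta>) + \<theta>"
    and "real (cutoff_index x k a \<theta>) + \<theta> < cutoff x k a + 1"
proof -
  have "0 \<le> \<lceil>cutoff x k a - \<theta>\<rceil>" using assms by simp
  then have "real (cutoff_index x k a \<theta>) = of_int \<lceil>cutoff x k a - \<theta>\<rceil>"
    by (simp add: cutoff_index_def)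
  then show "cutoff x k a \<le> real (cutoff_index x k a \<theta>) + \<theta>"
    "real (cutoff_index x k a \<theta>) + \<theta> < cutoff x k a + 1"
    by linarith+
qed

lemma cutoff_antimono:
  assumes "x > 0" "a > 0" "j \<le> k"
  shows "cutoff x k a \<le> cutoff x j a"
  unfolding cutoff_def using assms
  by (intro mult_left_mono divide_left_mono power_mono) auto

lemma cutoff_index_antimono:
  assumes "x > 0" "a > 0" "j \<le> k"
  shows "cutoff_index x k a \<theta> \<le> cutoff_index x j a \<theta>"
  unfolding cutoff_index_def using cutoff_antimono[OF assms] by (intro nat_mono ceiling_mono) simp

text \<open>
  Between the cutoffs for \<open>k\<close> and \<open>k - 1\<close> the frequency is within \<open>\<pi>\<close> of \<open>2 \<pi> k\<close>. Passing to
  \<open>d = - 2 \<pi> k\<close> changes the terms by the factor \<open>exp (2 \<pi> \<i> k \<theta>)\<close> only, since \<open>k n\<close> is an integer;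
  then the sum is replaced by an integral, and \<open>stationary_phase\<close> evaluates the integral.
\<close>
lemma stationary_block:
  fixes w :: complex
  assumes x: "x > 0" and w: "Re w \<le> 0" and k: "k \<ge> 1"
  obtains C A where "C > 0" "A \<ge> 1"
    "\<And>a \<theta>. a \<ge> A \<Longrightarrow> \<theta> \<in> {0..1} \<Longrightarrow>
      norm ((\<Sum>n\<in>{cutoff_index x k a \<theta>..<cutoff_index x (k - 1) a \<theta>}. osc w (2 * pi * sqrt (a * x)) 0 (real n + \<theta>))
        - stationary_coeff x w k * fresnel_const * cis (2 * pi * (real k * \<theta> + a * x / real k)) * of_real a powr (w + 1/2))
      \<le> C * a powr Re w"
proof -
  define \<kappa> where "\<kappa> = real k"
  have \<kappa>: "\<kappa> \<ge> 1" using k by (simp add: \<kappa>_def)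
  have k1: "real (k - 1) + 1/2 = \<kappa> - 1/2" using k by (simp add: \<kappa>_def of_nat_diff)
  define G where "G = 2 * pi * (\<kappa> + 1/2)"
  have G: "G \<ge> 0" using \<kappa> by (simp add: G_def)
  obtain C1 T where C1: "C1 > 0" "T \<ge> 1" and sum:
    "\<And>c d p N. c \<ge> 0 \<Longrightarrow> p \<ge> T \<Longrightarrow> c \<le> G * sqrt p \<Longrightarrow>
      (\<And>t. t \<in> {p..p + real N} \<Longrightarrow> \<bar>c / sqrt t + d\<bar> \<le> 3 * pi / 2) \<Longrightarrow>
      norm ((\<Sum>j<N. osc w c d (p + real j)) - integral {p..p + real N} (osc w c d)) \<le> C1 * p powr Re w"
    by (rule osc_sum_integral[OF w G]) blast
  obtain g C2 where C2: "C2 > 0" and stat: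
    "\<And>a. a > 0 \<Longrightarrow>
      norm (integral {a * (x / (\<kappa> + 1/2) ^ 2)..a * (x / (\<kappa> - 1/2) ^ 2)} (osc w (2 * pi * sqrt (a * x)) (- (2 * pi * \<kappa>)))
        - g * fresnel_const * cis (2 * pi * (a * x / \<kappa>)) * of_real a powr (w + 1/2)) \<le> C2 * a powr Re w"
    and g: "g = 4 * osc (2 * w + 1) 0 0 (sqrt x / \<kappa>) / of_real (sqrt (2 * pi * \<kappa>))"
    by (rule stationary_phase[OF x \<kappa>]) blast
  have gk: "stationary_coeff x w k = g" by (simp add: g stationary_coeff_def \<kappa>_def)
  define q where "q = x / (\<kappa> + 1/2) ^ 2"
  have q: "q > 0" using x \<kappa> by (simp add: q_def)
  \<comment> \<open>The sum ends at most one step beyond the upper cutoff; as \<open>a r \<ge> 1\<close>, the frequency is still at least \<open>2 \<pi> (k - 3/4)\<close> there.\<close>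
  define r where "r = x / (\<kappa> - 3/4) ^ 2 - x / (\<kappa> - 1/2) ^ 2"
  have r: "r > 0" unfolding r_def using x \<kappa>
    by (auto intro!: divide_strict_left_mono power_strict_mono)
  define A where "A = max 1 (max (T / q) (max (1 / q) (1 / r)))"
  define C where "C = (C1 + 2) * q powr Re w + C2"
  show ?thesis
  proof
    show "C > 0" using C1 C2 q by (simp add: C_def add_nonneg_pos)
    show "A \<ge> 1" by (simp add: A_def)
    fix a \<theta> :: real assume a: "a \<ge> A" and \<theta>: "\<theta> \<in> {0..1}"
    have a1: "a \<ge> 1" "a \<ge> T / q" "a \<ge> 1 / q" "a \<ge> 1 / r" using a by (auto simp: A_def)
    then have aq: "a > 0" "a * q \<ge> T" "a * q \<ge> 1" "a * r \<ge> 1" using q r by (auto simp: field_simps)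
    define b1 where "b1 = cutoff x k a"
    define b2 where "b2 = cutoff x (k - 1) a"
    have b1: "b1 = a * q" by (simp add: b1_def cutoff_def q_def \<kappa>_def)
    have b2: "b2 = a * (x / (\<kappa> - 1/2) ^ 2)" unfolding b2_def cutoff_def k1 by simp
    have b12: "b1 \<le> b2" unfolding b1_def b2_def using x aq by (intro cutoff_antimono) auto
    define N1 where "N1 = cutoff_index x k a \<theta>"
    define N2 where "N2 = cutoff_index x (k - 1) a \<theta>"
    have N12: "N1 \<le> N2" unfolding N1_def N2_def using x aq by (intro cutoff_index_antimono) auto
    define p where "p = real N1 + \<theta>"
    define N where "N = N2 - N1"
    have pN: "p + real N = real N2 + \<theta>" using N12 by (simp add: p_def N_def of_nat_diff)
    have t1: "\<theta> \<le> cutoff x k a" using \<theta> aq b1 by (simp add: b1_def)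
    have t2: "\<theta> \<le> cutoff x (k - 1) a" using t1 b12 by (simp add: b1_def b2_def)
    have p: "b1 \<le> p" "p < b1 + 1"
      unfolding p_def N1_def b1_def using cutoff_index_bounds[OF t1] by simp_all
    have p': "b2 \<le> p + real N" "p + real N < b2 + 1"
      unfolding pN N2_def b2_def using cutoff_index_bounds[OF t2] by simp_all
    define c where "c = 2 * pi * sqrt (a * x)"
    define d where "d = - (2 * pi * \<kappa>)"
    have c: "c \<ge> 0" using x aq by (simp add: c_def)
    have sqrt_b1: "c = G * sqrt b1"
      using x aq \<kappa> by (simp add: b1 q_def c_def G_def real_sqrt_mult real_sqrt_divide)
    have b1_pos: "b1 > 0" using b1 aq q by simp
    have "(\<Sum>n\<in>{N1..<N2}. osc w c 0 (real n + \<theta>)) = cis (2 * pi * (\<kappa> * \<theta>)) * (\<Sum>j<N. osc w c d (p + real j))"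
    proof -
      have "osc w c 0 (real n + \<theta>) = cis (2 * pi * (\<kappa> * \<theta>)) * osc w c d (real n + \<theta>)" if "real n + \<theta> > 0" for n
      proof -
        let ?s = "2 * c * sqrt (real n + \<theta>)"
        have "cis (2 * pi * (\<kappa> * \<theta>)) * cis (?s + d * (real n + \<theta>)) = cis ?s * cis (- (2 * pi * (\<kappa> * real n)))"
          by (simp add: cis_mult d_def algebra_simps)
        also have "cis (- (2 * pi * (\<kappa> * real n))) = 1"
          using cis_multiple_2pi[of "\<kappa> * real n"] cis_cnj[of "2 * pi * (\<kappa> * real n)"] by (simp add: \<kappa>_def)
        finally show ?thesis using that by (simp add: osc_eq mult_ac)
      qed
      then have "(\<Sum>n\<in>{N1..<N2}. osc w c 0 (real n + \<theta>)) = (\<Sum>n\<in>{N1..<N2}. cis (2 * pi * (\<kappa> * \<theta>)) * osc w c d (real n + \<theta>))"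
        using p b1_pos by (intro sum.cong refl) (auto simp: p_def)
      also have "\<dots> = (\<Sum>j\<in>{0..<N}. cis (2 * pi * (\<kappa> * \<theta>)) * osc w c d (real (j + N1) + \<theta>))"
        using N12 by (subst sum.atLeastLessThan_shift_0) (simp add: N_def add.commute)
      finally show ?thesis by (simp add: sum_distrib_left p_def atLeast0LessThan add_ac)
    qed
    moreover have s1: "norm ((\<Sum>j<N. osc w c d (p + real j)) - integral {p..p + real N} (osc w c d)) \<le> C1 * p powr Re w"
    proof (rule sum[OF c])
      show "p \<ge> T" using p b1 aq by simp
      have "sqrt b1 \<le> sqrt p" using p by simp
      then show "c \<le> G * sqrt p" unfolding sqrt_b1 by (intro mult_left_mono G)
      fix t assume t: "t \<in> {p..p + real N}"
      have t0: "t > 0" "t \<ge> b1" using t p b1_pos by auto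
      have "c / sqrt t \<le> c / sqrt b1" using t0 b1_pos c by (intro divide_left_mono) auto
      also have "\<dots> = G" using sqrt_b1 b1_pos by simp
      finally have up: "c / sqrt t \<le> 2 * pi * \<kappa> + pi" by (simp add: G_def algebra_simps)
      have "t \<le> b2 + a * r" using t p' aq by simp
      also have "\<dots> = a * (x / (\<kappa> - 3/4) ^ 2)" by (simp add: b2 r_def algebra_simps)
      finally have "sqrt t \<le> sqrt (a * x) / (\<kappa> - 3/4)"
        using \<kappa> x aq by (intro real_le_lsqrt) (auto simp: power_divide)
      then have "sqrt t * (\<kappa> - 3/4) \<le> sqrt (a * x)" using \<kappa> by (simp add: pos_le_divide_eq)
      then have "2 * pi * (sqrt t * (\<kappa> - 3/4)) \<le> c" unfolding c_def by (rule mult_left_mono) simp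
      then have "2 * pi * (\<kappa> - 3/4) * sqrt t \<le> c" by (simp only: mult_ac)
      then have lo: "2 * pi * (\<kappa> - 3/4) \<le> c / sqrt t" using t0 by (simp add: pos_le_divide_eq)
      show "\<bar>c / sqrt t + d\<bar> \<le> 3 * pi / 2"
      proof (rule abs_leI)
        show "c / sqrt t + d \<le> 3 * pi / 2" using up pi_gt_zero unfolding d_def by linarith
        have "2 * pi * (\<kappa> - 3/4) = 2 * pi * \<kappa> - 3 * pi / 2" by (simp add: algebra_simps)
        then show "- (c / sqrt t + d) \<le> 3 * pi / 2" using lo unfolding d_def by linarith
      qed
    qed
    moreover have s2: "norm (integral {p..p + real N} (osc w c d) - integral {b1..b2} (osc w c d)) \<le> 2 * b1 powr Re w"
    proof -
      have e1: "integral {b1..p} (osc w c d) + integral {p..p + real N} (osc w c d) = integral {b1..p + real N} (osc w c d)"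
        using p b1_pos by (intro osc_integral_combine) auto
      have e2: "integral {b1..b2} (osc w c d) + integral {b2..p + real N} (osc w c d) = integral {b1..p + real N} (osc w c d)"
        using p' b12 b1_pos by (intro osc_integral_combine) auto
      have "norm (integral {b1..p} (osc w c d)) \<le> b1 powr Re w * (p - b1)"
        using p b1_pos w by (intro osc_integral_bound) auto
      also have "\<dots> \<le> b1 powr Re w * 1" using p by (intro mult_left_mono) auto
      finally have n1: "norm (integral {b1..p} (osc w c d)) \<le> b1 powr Re w" by simp
      have "norm (integral {b2..p + real N} (osc w c d)) \<le> b2 powr Re w * (p + real N - b2)"
        using p' b12 b1_pos w by (intro osc_integral_bound) auto
      also have "\<dots> \<le> b1 powr Re w * 1" using p' b12 b1_pos w by (intro mult_mono powr_mono2') auto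
      finally have n2: "norm (integral {b2..p + real N} (osc w c d)) \<le> b1 powr Re w" by simp
      have "integral {p..p + real N} (osc w c d) - integral {b1..b2} (osc w c d)
          = integral {b2..p + real N} (osc w c d) - integral {b1..p} (osc w c d)"
        using e1 e2 by (simp add: algebra_simps)
      then show ?thesis using norm_triangle_le_diff[OF add_mono[OF n2 n1]] by simp
    qed
    moreover have s3: "norm (integral {b1..b2} (osc w c d) - g * fresnel_const * cis (2 * pi * (a * x / \<kappa>)) * of_real a powr (w + 1/2))
        \<le> C2 * a powr Re w"
      using stat[of a] aq by (simp add: b1 b2 q_def c_def d_def)
    have "C1 * p powr Re w \<le> C1 * b1 powr Re w"
      using C1 p b1_pos w by (intro mult_left_mono powr_mono2') auto
    moreover have "b1 powr Re w = q powr Re w * a powr Re w"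
      using aq q by (simp add: b1 powr_mult mult.commute)
    ultimately have "norm (((\<Sum>j<N. osc w c d (p + real j)) - integral {p..p + real N} (osc w c d))
        + (integral {p..p + real N} (osc w c d) - integral {b1..b2} (osc w c d))
        + (integral {b1..b2} (osc w c d) - g * fresnel_const * cis (2 * pi * (a * x / \<kappa>)) * of_real a powr (w + 1/2)))
        \<le> C1 * (q powr Re w * a powr Re w) + 2 * (q powr Re w * a powr Re w) + C2 * a powr Re w"
      using s1 s2 s3 by (intro norm_triangle_mono) auto
    also have "\<dots> = C * a powr Re w" by (simp add: C_def algebra_simps)
    finally have fin: "norm ((\<Sum>j<N. osc w c d (p + real j)) - g * fresnel_const * cis (2 * pi * (a * x / \<kappa>)) * of_real a powr (w + 1/2))
        \<le> C * a powr Re w" by simp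
    have "cis (2 * pi * (\<kappa> * \<theta> + a * x / \<kappa>)) = cis (2 * pi * (\<kappa> * \<theta>)) * cis (2 * pi * (a * x / \<kappa>))"
      by (simp add: cis_mult distrib_left)
    then have "(\<Sum>n\<in>{N1..<N2}. osc w c 0 (real n + \<theta>)) - g * fresnel_const * cis (2 * pi * (\<kappa> * \<theta> + a * x / \<kappa>)) * of_real a powr (w + 1/2)
      = cis (2 * pi * (\<kappa> * \<theta>)) * ((\<Sum>j<N. osc w c d (p + real j)) - g * fresnel_const * cis (2 * pi * (a * x / \<kappa>)) * of_real a powr (w + 1/2))"
      using \<open>(\<Sum>n\<in>{N1..<N2}. osc w c 0 (real n + \<theta>)) = _\<close> by (simp add: algebra_simps)
    then have "norm ((\<Sum>n\<in>{N1..<N2}. osc w c 0 (real n + \<theta>)) - g * fresnel_const * cis (2 * pi * (\<kappa> * \<theta> + a * x / \<kappa>)) * of_real a powr (w + 1/2))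
       \<le> C * a powr Re w"
      using fin by (simp add: norm_mult)
    then show "norm ((\<Sum>n\<in>{cutoff_index x k a \<theta>..<cutoff_index x (k - 1) a \<theta>}. osc w (2 * pi * sqrt (a * x)) 0 (real n + \<theta>))
        - stationary_coeff x w k * fresnel_const * cis (2 * pi * (real k * \<theta> + a * x / real k)) * of_real a powr (w + 1/2))
      \<le> C * a powr Re w"
      unfolding gk by (simp add: N1_def N2_def c_def \<kappa>_def)
  qed
qed

text \<open>
  For \<open>K = 0\<close> the frequency is at most \<open>\<pi>\<close> with no stationary point, and the sum is bounded by
  \<open>osc_suminf_bound_sqrt\<close>. Each further \<open>k\<close> adds one block.
\<close>
lemma osc_tail_asymptotic:
  fixes w :: complex
  assumes x: "x > 0" and w: "Re w < -1/2"
  shows "\<exists>C A. C > 0 \<and> A \<ge> 1 \<and> (\<forall>a \<theta>. a \<ge> A \<longrightarrow> \<theta> \<in> {0..1} \<longrightarrow>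
      norm ((\<Sum>j. osc w (2 * pi * sqrt (a * x)) 0 (real (cutoff_index x K a \<theta>) + \<theta> + real j))
        - (\<Sum>k\<in>{1..K}. stationary_coeff x w k * fresnel_const * cis (2 * pi * (real k * \<theta> + a * x / real k))
            * of_real a powr (w + 1/2)))
      \<le> C * a powr Re w)"
proof (induction K)
  case 0
  obtain C T where C: "C > 0" "T \<ge> 1" and bound:
    "\<And>c p. c > 0 \<Longrightarrow> p \<ge> T \<Longrightarrow> c \<le> 3 * pi / 2 * sqrt p \<Longrightarrow>
      norm (\<Sum>j. osc w c 0 (p + real j)) \<le> C * p powr (Re w + 1/2) / c"
    by (rule osc_suminf_bound_sqrt[OF w]) blast
  define A where "A = max 1 (T / (4 * x))"
  define D where "D = C * (4 * x) powr (Re w + 1/2) / (2 * pi * sqrt x)"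
  have "norm (\<Sum>j. osc w (2 * pi * sqrt (a * x)) 0 (real (cutoff_index x 0 a \<theta>) + \<theta> + real j)) \<le> (D + 1) * a powr Re w"
    if a: "a \<ge> A" and \<theta>: "\<theta> \<in> {0..1}" for a \<theta>
  proof -
    have a1: "a \<ge> 1" "a * (4 * x) \<ge> T" using a x by (auto simp: A_def field_simps)
    have cut: "cutoff x 0 a = a * (4 * x)" by (simp add: cutoff_def power_divide)
    define p where "p = real (cutoff_index x 0 a \<theta>) + \<theta>"
    have p: "p \<ge> a * (4 * x)"
      unfolding p_def cut[symmetric] using a1 \<theta> C cut by (intro cutoff_index_bounds) auto
    have ax: "a * x > 0" using a1 x by simp
    have "norm (\<Sum>j. osc w (2 * pi * sqrt (a * x)) 0 (p + real j)) \<le> C * p powr (Re w + 1/2) / (2 * pi * sqrt (a * x))"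
    proof (rule bound)
      have "sqrt (4 * (a * x)) \<le> sqrt p" using p by (simp add: mult_ac)
      then have "2 * sqrt (a * x) \<le> sqrt p" by (simp add: real_sqrt_mult)
      then have "pi * (2 * sqrt (a * x)) \<le> (3 * pi / 2) * sqrt p"
        using ax by (intro mult_mono) auto
      then show "2 * pi * sqrt (a * x) \<le> 3 * pi / 2 * sqrt p" by (simp add: mult_ac)
    qed (use a1 p ax in auto)
    also have "\<dots> \<le> C * (a * (4 * x)) powr (Re w + 1/2) / (2 * pi * sqrt (a * x))"
      using C w p a1 x ax by (intro divide_right_mono mult_left_mono powr_mono2') auto
    also have "\<dots> = D * a powr Re w"
      using a1 x by (simp add: D_def powr_mult powr_add powr_half_sqrt real_sqrt_mult)
    also have "\<dots> \<le> (D + 1) * a powr Re w" by (simp add: distrib_right)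
    finally show ?thesis by (simp add: p_def)
  qed
  moreover have "D \<ge> 0" using C x by (simp add: D_def)
  ultimately show ?case by (intro exI[of _ "D + 1"] exI[of _ A]) (auto simp: A_def)
next
  case (Suc K)
  then obtain C1 A1 where 1: "C1 > 0" "A1 \<ge> 1" "\<And>a \<theta>. a \<ge> A1 \<Longrightarrow> \<theta> \<in> {0..1} \<Longrightarrow>
      norm ((\<Sum>j. osc w (2 * pi * sqrt (a * x)) 0 (real (cutoff_index x K a \<theta>) + \<theta> + real j))
        - (\<Sum>k\<in>{1..K}. stationary_coeff x w k * fresnel_const * cis (2 * pi * (real k * \<theta> + a * x / real k))
            * of_real a powr (w + 1/2)))
      \<le> C1 * a powr Re w" by blast
  have w0: "Re w \<le> 0" and K1: "Suc K \<ge> 1" using w by simp_all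
  obtain C2 A2 where 2: "C2 > 0" "A2 \<ge> 1" 
    "\<And>a \<theta>. a \<ge> A2 \<Longrightarrow> \<theta> \<in> {0..1} \<Longrightarrow>
      norm ((\<Sum>n\<in>{cutoff_index x (Suc K) a \<theta>..<cutoff_index x (Suc K - 1) a \<theta>}. osc w (2 * pi * sqrt (a * x)) 0 (real n + \<theta>))
        - stationary_coeff x w (Suc K) * fresnel_const * cis (2 * pi * (real (Suc K) * \<theta> + a * x / real (Suc K))) * of_real a powr (w + 1/2))
      \<le> C2 * a powr Re w"
    by (rule stationary_block[OF x w0 K1]) blast
  have "norm ((\<Sum>j. osc w (2 * pi * sqrt (a * x)) 0 (real (cutoff_index x (Suc K) a \<theta>) + \<theta> + real j))
        - (\<Sum>k\<in>{1..Suc K}. stationary_coeff x w k * fresnel_const * cis (2 * pi * (real k * \<theta> + a * x / real k))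
            * of_real a powr (w + 1/2)))
      \<le> (C1 + C2) * a powr Re w" if a: "a \<ge> max A1 A2" and \<theta>: "\<theta> \<in> {0..1}" for a \<theta>
  proof -
    have a0: "a > 0" using a 1 by auto
    let ?f = "osc w (2 * pi * sqrt (a * x)) 0"
    let ?N1 = "cutoff_index x (Suc K) a \<theta>" and ?N2 = "cutoff_index x K a \<theta>"
    have N: "?N1 \<le> ?N2" using x a0 by (intro cutoff_index_antimono) auto
    have "summable (\<lambda>j. ?f (real ?N1 + \<theta> + real j))"
      using a0 x \<theta> by (intro osc_summable w) auto
    from suminf_split_initial_segment[OF this, of "?N2 - ?N1"]
    have "(\<Sum>j. ?f (real ?N1 + \<theta> + real j)) = (\<Sum>j. ?f (real ?N2 + \<theta> + real j)) + (\<Sum>j<?N2 - ?N1. ?f (real ?N1 + \<theta> + real j))"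
      using N by (simp add: of_nat_diff add_ac)
    also have "(\<Sum>j<?N2 - ?N1. ?f (real ?N1 + \<theta> + real j)) = (\<Sum>n\<in>{?N1..<?N2}. ?f (real n + \<theta>))"
      using N by (subst sum.atLeastLessThan_shift_0) (simp add: atLeast0LessThan add_ac)
    finally have "(\<Sum>j. ?f (real ?N1 + \<theta> + real j)) - (\<Sum>k\<in>{1..Suc K}. stationary_coeff x w k * fresnel_const * cis (2 * pi * (real k * \<theta> + a * x / real k))
            * of_real a powr (w + 1/2))
      = ((\<Sum>j. ?f (real ?N2 + \<theta> + real j)) - (\<Sum>k\<in>{1..K}. stationary_coeff x w k * fresnel_const * cis (2 * pi * (real k * \<theta> + a * x / real k))
            * of_real a powr (w + 1/2)))
        + ((\<Sum>n\<in>{?N1..<?N2}. ?f (real n + \<theta>)) - stationary_coeff x w (Suc K) * fresnel_const * cis (2 * pi * (real (Suc K) * \<theta> + a * x / real (Suc K))) * of_real a powr (w + 1/2))"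
      by (simp add: algebra_simps)
    moreover have "norm \<dots> \<le> C1 * a powr Re w + C2 * a powr Re w"
      using 1(3)[of a \<theta>] 2(3)[of a \<theta>] a \<theta> by (intro norm_triangle_mono) auto
    ultimately show ?thesis by (simp only: distrib_right)
  qed
  then show ?case using 1 2 by (intro exI[of _ "C1 + C2"] exI[of _ "max A1 A2"]) auto
qed

section \<open>Uniform convergence of the outer sum\<close>

lemma shifted_powr_sum_bound:
  assumes e: "e < -1" and d: "d > 0"
  obtains S where "S \<ge> 0" "\<And>N \<theta>. \<theta> \<ge> d \<Longrightarrow> (\<Sum>n<N. (real n + \<theta>) powr e) \<le> S"
proof
  have sm: "summable (\<lambda>n. real n powr e)" using e by (simp add: summable_real_powr_iff)
  let ?S = "d powr e + (\<Sum>n. real n powr e)"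
  show "?S \<ge> 0" using sm by (intro add_nonneg_nonneg suminf_nonneg) auto
  fix N :: nat and \<theta> :: real assume \<theta>: "\<theta> \<ge> d"
  have "(\<Sum>n<N. (real n + \<theta>) powr e) \<le> (\<Sum>n<N. (if n = 0 then d powr e else 0) + real n powr e)"
  proof (rule sum_mono)
    fix n
    show "(real n + \<theta>) powr e \<le> (if n = 0 then d powr e else 0) + real n powr e"
      using d \<theta> e by (cases "n = 0") (auto intro: powr_mono2')
  qed
  also have "\<dots> \<le> d powr e + (\<Sum>n<N. real n powr e)"
    by (simp add: sum.distrib)
  also have "(\<Sum>n<N. real n powr e) \<le> (\<Sum>n. real n powr e)"
    by (intro sum_le_suminf sm) auto
  finally show "(\<Sum>n<N. (real n + \<theta>) powr e) \<le> ?S" by simp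
qed

lemma upward_closed_interval:
  fixes P :: "nat \<Rightarrow> bool"
  assumes "\<And>m m'. P m \<Longrightarrow> m \<le> m' \<Longrightarrow> P m'"
  shows "\<exists>m0\<ge>M1. {m \<in> {M1..<M2}. P m} = {m0..<M2} \<and> (m0 < M2 \<longrightarrow> P m0)"
proof (cases "\<exists>m\<ge>M1. P m")
  case True
  define m0 where "m0 = (LEAST m. m \<ge> M1 \<and> P m)"
  have m0: "m0 \<ge> M1" "P m0" using LeastI_ex[of "\<lambda>m. m \<ge> M1 \<and> P m"] True by (auto simp: m0_def)
  have "m0 \<le> m" if "m \<ge> M1" "P m" for m unfolding m0_def using that by (intro Least_le) auto
  then have "{m \<in> {M1..<M2}. P m} = {m0..<M2}" using m0 assms by auto
  then show ?thesis using m0 by blast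
next
  case False
  then have "{m \<in> {M1..<M2}. P m} = {max M1 M2..<M2}" by auto
  then show ?thesis by (intro exI[of _ "max M1 M2"]) auto
qed

lemma osc_swap:
  assumes "a > 0" "b > 0"
  shows "of_real a powr z * osc w (2 * pi * sqrt (a * x)) 0 b = of_real b powr w * osc z (2 * pi * sqrt (b * x)) 0 a"
  using assms by (simp add: osc_eq real_sqrt_mult mult_ac)

text \<open>
  After the exchange of the sums, the terms with a fixed \<open>n\<close> are those with \<open>m\<close> beyond some bound,
  and there the frequency in \<open>m\<close> is at most \<open>\<pi>\<close> because \<open>K \<ge> 2 x\<close>. Hence each \<open>n\<close> contributes
  \<open>O(M1 powr (Re z + 1/2) (n + \<theta>) powr (Re w - 1/2))\<close>, which is summable over \<open>n\<close>.
\<close>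
lemma low_part_bound:
  fixes z w :: complex
  assumes x: "x > 0" and z: "Re z < -1/2" and w: "Re w < -1/2" and d: "d > 0" and K: "real K \<ge> 2 * x"
  obtains C M where "C > 0"
    "\<And>M1 M2 \<sigma> \<theta>. M1 \<ge> M \<Longrightarrow> \<sigma> \<in> {0..1} \<Longrightarrow> \<theta> \<ge> d \<Longrightarrow>
      norm (\<Sum>m\<in>{M1..<M2}. of_real (real m + \<sigma>) powr z *
        (\<Sum>n<cutoff_index x K (real m + \<sigma>) \<theta>. osc w (2 * pi * sqrt ((real m + \<sigma>) * x)) 0 (real n + \<theta>)))
      \<le> C * real M1 powr (Re z + 1/2)"
proof -
  obtain C1 T where C1: "C1 > 0" "T \<ge> 1" and sum:
    "\<And>c p N. c > 0 \<Longrightarrow> p \<ge> T \<Longrightarrow> c \<le> 3 * pi / 2 * sqrt p \<Longrightarrow>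
      norm (\<Sum>j<N. osc z c 0 (p + real j)) \<le> C1 * p powr (Re z + 1/2) / c"
    by (rule osc_sum_bound_sqrt[OF z]) blast
  have "Re w - 1/2 < -1" using w by simp
  then obtain S where S: "S \<ge> 0" "\<And>N \<theta>. \<theta> \<ge> d \<Longrightarrow> (\<Sum>n<N. (real n + \<theta>) powr (Re w - 1/2)) \<le> S"
    using shifted_powr_sum_bound[OF _ d] by blast
  define M where "M = nat \<lceil>T\<rceil>"
  define C where "C = C1 / (2 * pi * sqrt x) * S + 1"
  show ?thesis
  proof
    show "C > 0" using C1 S x by (simp add: C_def add_nonneg_pos)
    fix M1 M2 :: nat and \<sigma> \<theta> :: real
    assume M1: "M1 \<ge> M" and \<sigma>: "\<sigma> \<in> {0..1}" and \<theta>: "\<theta> \<ge> d"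
    have M1T: "real M1 \<ge> T" using M1 by (simp add: M_def)
    have M1p: "real M1 \<ge> 1" using M1T C1 by simp
    define L where "L m = cutoff_index x K (real m + \<sigma>) \<theta>" for m
    define f where "f m n = of_real (real n + \<theta>) powr w * osc z (2 * pi * sqrt ((real n + \<theta>) * x)) 0 (real m + \<sigma>)" for m n
    \<comment> \<open>Any common upper bound of the finitely many \<open>L m\<close> would do.\<close>
    define N where "N = (\<Sum>m\<in>{M1..<M2}. L m)"
    let ?P = "real M1 powr (Re z + 1/2)"
    have LN: "L m \<le> N" if "m \<in> {M1..<M2}" for m
      unfolding N_def using that by (intro member_le_sum) auto
    have "(\<Sum>m\<in>{M1..<M2}. of_real (real m + \<sigma>) powr z *
        (\<Sum>n<cutoff_index x K (real m + \<sigma>) \<theta>. osc w (2 * pi * sqrt ((real m + \<sigma>) * x)) 0 (real n + \<theta>)))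
      = (\<Sum>m\<in>{M1..<M2}. \<Sum>n<L m. f m n)"
    proof (rule sum.cong[OF refl])
      fix m assume "m \<in> {M1..<M2}"
      then have m: "real m + \<sigma> > 0" using M1p \<sigma> by auto
      show "of_real (real m + \<sigma>) powr z *
        (\<Sum>n<cutoff_index x K (real m + \<sigma>) \<theta>. osc w (2 * pi * sqrt ((real m + \<sigma>) * x)) 0 (real n + \<theta>))
        = (\<Sum>n<L m. f m n)"
        unfolding sum_distrib_left L_def f_def using m \<theta> d
        by (intro sum.cong refl osc_swap) auto
    qed
    also have "\<dots> = (\<Sum>m\<in>{M1..<M2}. \<Sum>n<N. if n < L m then f m n else 0)"
    proof (rule sum.cong[OF refl])
      fix m assume "m \<in> {M1..<M2}"
      then have "{..<N} \<inter> {n. n < L m} = {..<L m}" using LN[of m] by auto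
      then show "(\<Sum>n<L m. f m n) = (\<Sum>n<N. if n < L m then f m n else 0)"
        by (simp add: sum.If_cases)
    qed
    also have "\<dots> = (\<Sum>n<N. \<Sum>m\<in>{M1..<M2}. if n < L m then f m n else 0)"
      by (rule sum.swap)
    also have "norm \<dots> \<le> (\<Sum>n<N. C1 / (2 * pi * sqrt x) * ?P * (real n + \<theta>) powr (Re w - 1/2))"
    proof (rule sum_norm_le)
      fix n
      define b where "b = real n + \<theta>"
      have b: "b > 0" using \<theta> d by (simp add: b_def)
      let ?c = "2 * pi * sqrt (b * x)"
      have up: "n < L m'" if "n < L m" "m \<le> m'" for m m'
      proof -
        have "cutoff x K (real m + \<sigma>) \<le> cutoff x K (real m' + \<sigma>)"
          unfolding cutoff_def using that x by (intro mult_right_mono) auto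
        then show ?thesis using that by (simp add: L_def less_cutoff_index_iff)
      qed
      obtain m0 where m0: "m0 \<ge> M1" "{m \<in> {M1..<M2}. n < L m} = {m0..<M2}" "m0 < M2 \<longrightarrow> n < L m0"
        using upward_closed_interval[of "\<lambda>m. n < L m" M1 M2] up by blast
      have "(\<Sum>m\<in>{M1..<M2}. if n < L m then f m n else 0) = (\<Sum>m\<in>{m0..<M2}. f m n)"
        unfolding m0(2)[symmetric] by (rule sum.inter_filter[symmetric]) simp
      also have "\<dots> = of_real b powr w * (\<Sum>j<M2 - m0. osc z ?c 0 (real m0 + \<sigma> + real j))"
      proof (cases "m0 \<le> M2")
        case True
        then show ?thesis
          by (subst sum.atLeastLessThan_shift_0)
             (simp add: f_def b_def atLeast0LessThan add_ac sum_distrib_left)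
      qed simp
      finally have eq: "(\<Sum>m\<in>{M1..<M2}. if n < L m then f m n else 0)
         = of_real b powr w * (\<Sum>j<M2 - m0. osc z ?c 0 (real m0 + \<sigma> + real j))" .
      have "norm (\<Sum>j<M2 - m0. osc z ?c 0 (real m0 + \<sigma> + real j)) \<le> C1 * ?P / ?c"
      proof (cases "m0 < M2")
        case True
        define a where "a = real m0 + \<sigma>"
        have a: "a \<ge> real M1" using m0(1) \<sigma> by (simp add: a_def)
        have "b < cutoff x K a" using m0(3) True by (simp add: L_def less_cutoff_index_iff b_def a_def)
        then have "b * x \<le> a * (x / (real K + 1/2) ^ 2) * x"
          unfolding cutoff_def using x by (intro mult_right_mono) auto
        also have "\<dots> = a * (x / (real K + 1/2)) ^ 2" by (simp add: power2_eq_square)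
        also have "\<dots> \<le> a * (1/2) ^ 2"
        proof -
          have "x / (real K + 1/2) \<le> 1/2" using K x by (simp add: field_simps)
          then show ?thesis using x a M1p by (intro mult_left_mono power_mono) auto
        qed
        finally have bx: "sqrt (b * x) \<le> sqrt a / 2"
          using a M1p by (intro real_le_lsqrt) (auto simp: power_divide)
        have "norm (\<Sum>j<M2 - m0. osc z ?c 0 (a + real j)) \<le> C1 * a powr (Re z + 1/2) / ?c"
        proof (rule sum)
          have "2 * pi * sqrt (b * x) \<le> 2 * pi * (sqrt a / 2)" using bx by (intro mult_left_mono) auto
          also have "\<dots> = pi * sqrt a" by simp
          also have "\<dots> \<le> 3 * pi / 2 * sqrt a" using a M1p by (intro mult_right_mono) auto
          finally show "?c \<le> 3 * pi / 2 * sqrt a" .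
        qed (use a M1T b x in auto)
        also have "\<dots> \<le> C1 * ?P / ?c"
          using C1 a M1p z b x by (intro divide_right_mono mult_left_mono powr_mono2') auto
        finally show ?thesis by (simp add: a_def)
      qed (use C1 b x in auto)
      then have "norm (\<Sum>m\<in>{M1..<M2}. if n < L m then f m n else 0) \<le> b powr Re w * (C1 * ?P / ?c)"
        unfolding eq norm_mult using b by (intro mult_mono) (auto simp: norm_powr_real_powr)
      also have "b powr (Re w - 1/2) = b powr Re w / sqrt b"
        using b by (simp add: powr_diff powr_half_sqrt)
      then have "b powr Re w * (C1 * ?P / ?c) = C1 / (2 * pi * sqrt x) * ?P * b powr (Re w - 1/2)"
        by (simp add: real_sqrt_mult mult_ac)
      finally show "norm (\<Sum>m\<in>{M1..<M2}. if n < L m then f m n else 0)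
          \<le> C1 / (2 * pi * sqrt x) * ?P * (real n + \<theta>) powr (Re w - 1/2)"
        by (simp add: b_def)
    qed
    also have "\<dots> = C1 / (2 * pi * sqrt x) * ?P * (\<Sum>n<N. (real n + \<theta>) powr (Re w - 1/2))"
      by (simp add: sum_distrib_left)
    also have "\<dots> \<le> C1 / (2 * pi * sqrt x) * ?P * S"
      using C1 x by (intro mult_left_mono S(2) \<theta>) auto
    also have "\<dots> \<le> C * ?P" by (simp add: C_def algebra_simps)
    finally show "norm (\<Sum>m\<in>{M1..<M2}. of_real (real m + \<sigma>) powr z *
        (\<Sum>n<cutoff_index x K (real m + \<sigma>) \<theta>. osc w (2 * pi * sqrt ((real m + \<sigma>) * x)) 0 (real n + \<theta>)))
      \<le> C * real M1 powr (Re z + 1/2)" .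
  qed
qed

abbreviation series_uniform_on :: "'a set \<Rightarrow> (nat \<Rightarrow> 'a \<Rightarrow> complex) \<Rightarrow> bool" where
  "series_uniform_on D g \<equiv> uniformly_convergent_on D (\<lambda>N p. \<Sum>n<N. g n p)"

lemma series_uniform_tail_bound:
  assumes tail: "\<And>M1 M2 p. M1 \<ge> M \<Longrightarrow> p \<in> D \<Longrightarrow> norm (\<Sum>m\<in>{M1..<M2}. g m p) \<le> b M1"
    and b: "b \<longlonglongrightarrow> 0"
  shows "series_uniform_on D g"
proof (rule Cauchy_uniformly_convergent, rule uniformly_Cauchy_onI)
  fix e :: real assume "e > 0"
  then have "\<forall>\<^sub>F n in sequentially. b n < e" using b by (rule order_tendstoD(2)[rotated])
  then obtain N where N: "\<And>n. n \<ge> N \<Longrightarrow> b n < e" unfolding eventually_sequentially by blast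
  have le: "dist (\<Sum>m<m1. g m p) (\<Sum>m<m2. g m p) < e" if "p \<in> D" "m1 \<ge> max M N" "m1 \<le> m2" for p m1 m2
  proof -
    have "(\<Sum>m<m2. g m p) - (\<Sum>m<m1. g m p) = (\<Sum>m\<in>{m1..<m2}. g m p)"
      using that sum_diff_nat_ivl[of 0 m1 m2 "\<lambda>m. g m p"] by (simp add: atLeast0LessThan)
    then have "dist (\<Sum>m<m1. g m p) (\<Sum>m<m2. g m p) \<le> b m1"
      using tail[of m1 p m2] that by (metis dist_commute dist_norm max.bounded_iff)
    also have "b m1 < e" using N that by auto
    finally show ?thesis .
  qed
  have "dist (\<Sum>m<m1. g m p) (\<Sum>m<m2. g m p) < e" if "p \<in> D" "m1 \<ge> max M N" "m2 \<ge> max M N" for p m1 m2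
    using le[of p m1 m2] le[of p m2 m1] that by (cases "m1 \<le> m2") (auto simp: dist_commute)
  then show "\<exists>M. \<forall>x\<in>D. \<forall>m\<ge>M. \<forall>n\<ge>M. dist (\<Sum>n<m. g n x) (\<Sum>m<n. g m x) < e" by blast
qed

lemma powr_tendsto_zero:
  "e < 0 \<Longrightarrow> (\<lambda>n. C * real n powr e) \<longlonglongrightarrow> 0"
  using tendsto_mult_right_zero[OF tendsto_neg_powr[OF _ filterlim_real_sequentially], of e C] by simp

lemma series_uniform_majorant:
  assumes le: "\<And>m p. m \<ge> M \<Longrightarrow> p \<in> D \<Longrightarrow> norm (g m p) \<le> C * real m powr e" and e: "e < -1"
  shows "series_uniform_on D g"
proof -
  have "uniform_limit D (\<lambda>N p. \<Sum>n<N. g n p) (\<lambda>p. \<Sum>n. g n p) sequentially"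
  proof (rule Weierstrass_m_test_ev)
  show "\<forall>\<^sub>F n in sequentially. \<forall>x\<in>D. norm (g n x) \<le> C * real n powr e"
    using le by (auto simp: eventually_sequentially)
  show "summable (\<lambda>n. C * real n powr e)"
    using e by (intro summable_mult) (simp add: summable_real_powr_iff)
  qed
  then show ?thesis by (auto simp: uniformly_convergent_on_def)
qed

lemma series_uniform_add:
  assumes "series_uniform_on D f" "series_uniform_on D g"
  shows "series_uniform_on D (\<lambda>n p. f n p + g n p)"
  using uniformly_convergent_add[OF assms] by (simp add: sum.distrib)

lemma series_uniform_cmult:
  assumes "series_uniform_on D f"
  shows "series_uniform_on D (\<lambda>n p. c * f n p)"
proof -
  from assms obtain l where "uniform_limit D (\<lambda>N p. \<Sum>n<N. f n p) l sequentially"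
    by (auto simp: uniformly_convergent_on_def)
  from bounded_linear.uniform_limit[OF bounded_linear_mult_right this, of c]
  show ?thesis by (auto simp: uniformly_convergent_on_def sum_distrib_left)
qed

lemma series_uniform_cnj:
  assumes "series_uniform_on D f"
  shows "series_uniform_on D (\<lambda>n p. cnj (f n p))"
proof -
  from assms obtain l where "uniform_limit D (\<lambda>N p. \<Sum>n<N. f n p) l sequentially"
    by (auto simp: uniformly_convergent_on_def)
  from bounded_linear.uniform_limit[OF bounded_linear_cnj this]
  show ?thesis by (auto simp: uniformly_convergent_on_def)
qed

lemma series_uniform_sum:
  assumes "finite I" "\<And>i. i \<in> I \<Longrightarrow> series_uniform_on D (f i)"
  shows "series_uniform_on D (\<lambda>n p. \<Sum>i\<in>I. f i n p)"
  using assms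
proof (induction I rule: finite_induct)
  case empty
  then show ?case by (simp add: uniformly_convergent_on_const)
next
  case (insert i I)
  then have "series_uniform_on D (\<lambda>n p. f i n p + (\<Sum>i\<in>I. f i n p))"
    by (intro series_uniform_add) auto
  then show ?case using insert by simp
qed

lemma series_uniform_compose:
  assumes "series_uniform_on D f" "\<And>p. p \<in> E \<Longrightarrow> h p \<in> D"
  shows "series_uniform_on E (\<lambda>n p. f n (h p))"
proof -
  from assms obtain l where "uniform_limit D (\<lambda>N p. \<Sum>n<N. f n p) l sequentially"
    by (auto simp: uniformly_convergent_on_def)
  then have "uniform_limit E (\<lambda>N p. \<Sum>n<N. f n (h p)) (\<lambda>p. l (h p)) sequentially"
    using assms(2) unfolding uniform_limit_iff by (auto elim!: eventually_mono)
  then show ?thesis by (auto simp: uniformly_convergent_on_def)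
qed

definition lattice_sum :: "real \<Rightarrow> complex \<Rightarrow> complex \<Rightarrow> nat \<Rightarrow> real \<Rightarrow> real \<Rightarrow> complex" where
  "lattice_sum x z w m \<sigma> \<theta> =
     of_real (real m + \<sigma>) powr z * (\<Sum>n. osc w (2 * pi * sqrt ((real m + \<sigma>) * x)) 0 (real n + \<theta>))"

text \<open>The contribution of the \<open>k\<close>-th stationary point of the inner sum.\<close>
definition resonance :: "real \<Rightarrow> complex \<Rightarrow> complex \<Rightarrow> nat \<Rightarrow> nat \<Rightarrow> real \<Rightarrow> real \<Rightarrow> complex" where
  "resonance x z w k m \<sigma> \<theta> =
     stationary_coeff x w k * fresnel_const * cis (2 * pi * (real k * \<theta> + (real m + \<sigma>) * x / real k))
       * of_real (real m + \<sigma>) powr (z + w + 1/2)"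

text \<open>
  The part below the cutoff converges by \<open>low_part_bound\<close>. The rest differs from the resonances by
  \<open>O(m powr (Re z + Re w))\<close>, and \<open>Re z + Re w < - 1\<close>.
\<close>
lemma regular_part_uniform:
  fixes z w :: complex
  assumes x: "x > 0" and z: "Re z < -1/2" and w: "Re w < -1/2" and d: "d > 0" and K: "real K \<ge> 2 * x"
  shows "series_uniform_on ({0..1} \<times> {d..1})
    (\<lambda>m (\<sigma>, \<theta>). lattice_sum x z w m \<sigma> \<theta> - (\<Sum>k\<in>{1..K}. resonance x z w k m \<sigma> \<theta>))"
proof -
  define low where "low m p = (case p of (\<sigma>, \<theta>) \<Rightarrow> of_real (real m + \<sigma>) powr z *
        (\<Sum>n<cutoff_index x K (real m + \<sigma>) \<theta>. osc w (2 * pi * sqrt ((real m + \<sigma>) * x)) 0 (real n + \<theta>)))"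
    for m :: nat and p :: "real \<times> real"
  define g where "g m p = (case p of (\<sigma>, \<theta>) \<Rightarrow>
      lattice_sum x z w m \<sigma> \<theta> - (\<Sum>k\<in>{1..K}. resonance x z w k m \<sigma> \<theta>))"
    for m :: nat and p :: "real \<times> real"
  obtain C1 M where C1: "C1 > 0" and low:
    "\<And>M1 M2 \<sigma> \<theta>. M1 \<ge> M \<Longrightarrow> \<sigma> \<in> {0..1} \<Longrightarrow> \<theta> \<ge> d \<Longrightarrow>
      norm (\<Sum>m\<in>{M1..<M2}. of_real (real m + \<sigma>) powr z *
        (\<Sum>n<cutoff_index x K (real m + \<sigma>) \<theta>. osc w (2 * pi * sqrt ((real m + \<sigma>) * x)) 0 (real n + \<theta>)))
      \<le> C1 * real M1 powr (Re z + 1/2)"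
    by (rule low_part_bound[OF x z w d K]) blast
  have "series_uniform_on ({0..1} \<times> {d..1}) low"
  proof (rule series_uniform_tail_bound)
    show "norm (\<Sum>m\<in>{M1..<M2}. low m p) \<le> C1 * real M1 powr (Re z + 1/2)"
      if "M1 \<ge> M" "p \<in> {0..1} \<times> {d..1}" for M1 M2 p
      using low[of M1 "fst p" "snd p" M2] that by (auto simp: low_def case_prod_unfold)
    show "(\<lambda>n. C1 * real n powr (Re z + 1/2)) \<longlonglongrightarrow> 0" using z by (intro powr_tendsto_zero) simp
  qed
  moreover obtain C A where C: "C > 0" "A \<ge> 1" and tail: "\<And>a \<theta>. a \<ge> A \<Longrightarrow> \<theta> \<in> {0..1} \<Longrightarrow>
      norm ((\<Sum>j. osc w (2 * pi * sqrt (a * x)) 0 (real (cutoff_index x K a \<theta>) + \<theta> + real j))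
        - (\<Sum>k\<in>{1..K}. stationary_coeff x w k * fresnel_const * cis (2 * pi * (real k * \<theta> + a * x / real k))
            * of_real a powr (w + 1/2)))
      \<le> C * a powr Re w"
    using osc_tail_asymptotic[OF x w, of K] by blast
  have "series_uniform_on ({0..1} \<times> {d..1}) (\<lambda>m p. g m p - low m p)"
  proof (rule series_uniform_majorant)
    show "Re z + Re w < -1" using z w by simp
    fix m :: nat and p :: "real \<times> real" assume m: "m \<ge> nat \<lceil>A\<rceil>" and p: "p \<in> {0..1} \<times> {d..1}"
    obtain \<sigma> \<theta> where p_eq: "p = (\<sigma>, \<theta>)" by (cases p)
    have st: "\<sigma> \<in> {0..1}" "\<theta> \<in> {0..1}" "\<theta> > 0" using p d by (auto simp: p_eq)
    define a where "a = real m + \<sigma>"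
    have mA: "real m \<ge> A" using m by (simp add: nat_le_iff ceiling_le_iff)
    have a: "a \<ge> A" "a > 0" "real m \<ge> 1" "a \<ge> real m" using mA C st by (auto simp: a_def)
    let ?f = "osc w (2 * pi * sqrt (a * x)) 0" and ?L = "cutoff_index x K a \<theta>"
    have "summable (\<lambda>n. ?f (real n + \<theta>))"
      using osc_summable[OF w, of "2 * pi * sqrt (a * x)" \<theta>] a x st by (simp add: add.commute)
    from suminf_split_initial_segment[OF this, of ?L]
    have "(\<Sum>n. ?f (real n + \<theta>)) = (\<Sum>j. ?f (real ?L + \<theta> + real j)) + (\<Sum>n<?L. ?f (real n + \<theta>))"
      by (simp add: add_ac)
    moreover have "(\<Sum>k\<in>{1..K}. resonance x z w k m \<sigma> \<theta>) = of_real a powr z * (\<Sum>k\<in>{1..K}. stationary_coeff x w k * fresnel_const * cis (2 * pi * (real k * \<theta> + a * x / real k))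
            * of_real a powr (w + 1/2))"
    proof -
      have "of_real a powr (z + w + 1/2) = of_real a powr z * (of_real a powr (w + 1/2) :: complex)"
        by (simp only: powr_add[symmetric] add.assoc)
      then show ?thesis by (simp add: resonance_def sum_distrib_left a_def mult_ac)
    qed
    ultimately have "g m p - low m p = of_real a powr z * ((\<Sum>j. ?f (real ?L + \<theta> + real j))
        - (\<Sum>k\<in>{1..K}. stationary_coeff x w k * fresnel_const * cis (2 * pi * (real k * \<theta> + a * x / real k))
            * of_real a powr (w + 1/2)))"
      unfolding g_def low_def p_eq prod.case lattice_sum_def a_def[symmetric]
      by (simp add: right_diff_distrib distrib_left)
    also have "norm \<dots> \<le> a powr Re z * (C * a powr Re w)"
      unfolding norm_mult using a st by (intro mult_mono tail) (auto simp: norm_powr_real_powr)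
    also have "\<dots> = C * a powr (Re z + Re w)" using a by (simp add: powr_add)
    also have "\<dots> \<le> C * real m powr (Re z + Re w)"
      using a C z w by (intro mult_left_mono powr_mono2') auto
    finally show "norm (g m p - low m p) \<le> C * real m powr (Re z + Re w)" .
  qed
  ultimately have "series_uniform_on ({0..1} \<times> {d..1}) (\<lambda>m p. low m p + (g m p - low m p))"
    by (rule series_uniform_add)
  then show ?thesis by (simp add: g_def case_prod_unfold)
qed

lemma osc_zero_diff_bound:
  assumes m: "m > 0" and y: "Re y \<le> 1" and s: "s \<ge> m" "s \<le> m + 1" and t: "t \<ge> m" "t \<le> m + 1"
  shows "norm (osc y 0 0 s - osc y 0 0 t) \<le> norm y * m powr (Re y - 1)"
proof -
  have "norm (osc y 0 0 s - osc y 0 0 t) \<le> (norm y * m powr (Re y - 1)) * norm (s - t)"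
  proof (rule differentiable_bound[where S = "{m..m + 1}" and f' = "\<lambda>r h. h *\<^sub>R (y / of_real r * osc y 0 0 r)"])
    fix r assume r: "r \<in> {m..m + 1}"
    then have r0: "r > 0" using m by auto
    show "(osc y 0 0 has_derivative (\<lambda>h. h *\<^sub>R (y / of_real r * osc y 0 0 r))) (at r within {m..m + 1})"
      using osc_vector_derivative[OF r0, of y 0 0] by (simp add: has_vector_derivative_def)
    have "norm (y / of_real r * osc y 0 0 r) = norm y * r powr (Re y - 1)"
      using r0 by (simp add: norm_mult norm_divide norm_osc powr_diff)
    also have "\<dots> \<le> norm y * m powr (Re y - 1)"
      using r m y by (intro mult_left_mono powr_mono2') auto
    finally show "onorm (\<lambda>h. h *\<^sub>R (y / of_real r * osc y 0 0 r)) \<le> norm y * m powr (Re y - 1)"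
      by (rule onorm_scaleR_le)
  qed (use s t in auto)
  also have "\<dots> \<le> (norm y * m powr (Re y - 1)) * 1" using s t by (intro mult_left_mono) auto
  finally show ?thesis by simp
qed

lemma cnj_osc: "cnj (osc w c d t) = osc (cnj w) (- c) (- d) t"
  by (simp add: osc_def exp_cnj algebra_simps)

lemma powr_eq_osc: "a > 0 \<Longrightarrow> of_real a powr y = osc y 0 0 a"
  by (simp add: osc_eq)

lemma cnj_resonance:
  assumes "real m + \<sigma> > 0"
  shows "cnj (resonance x (cnj z) (cnj w) k m \<sigma> \<theta>) =
     stationary_coeff x w k * cnj fresnel_const * cis (- (2 * pi * (real k * \<theta> + (real m + \<sigma>) * x / real k)))
       * of_real (real m + \<sigma>) powr (z + w + 1/2)"
  unfolding resonance_def stationary_coeff_def powr_eq_osc[OF assms]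
  by (simp add: cnj_osc cis_cnj)

text \<open>This is \<open>2 cos (\<phi> + p \<pi> / 2)\<close>.\<close>
definition phase_pair :: "nat \<Rightarrow> real \<Rightarrow> complex" where
  "phase_pair p \<phi> = \<i> ^ p * cis \<phi> + (- \<i>) ^ p * cis (- \<phi>)"

lemma phase_pair_minus: "phase_pair p (- \<phi>) = (- 1) ^ p * phase_pair p \<phi>"
proof -
  have "(- 1) ^ p * \<i> ^ p = (- \<i>) ^ p" "(- 1) ^ p * (- \<i>) ^ p = \<i> ^ p"
    by (simp_all add: power_mult_distrib[symmetric])
  then show ?thesis by (simp add: phase_pair_def distrib_left mult.assoc[symmetric])
qed

lemma phase_pair_periodic: "phase_pair p (\<phi> + 2 * pi * of_int j) = phase_pair p \<phi>"
proof -
  have 1: "cis (2 * pi * of_int j) = 1" by (rule cis_multiple_2pi) simp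
  have 2: "cis (- (2 * pi * of_int j)) = 1"
    using cis_multiple_2pi[of "- of_int j"] by simp
  have "cis (\<phi> + 2 * pi * of_int j) = cis \<phi>"
    unfolding cis_mult[symmetric] 1 by simp
  moreover have "cis (- (\<phi> + 2 * pi * of_int j)) = cis (- \<phi>)"
    unfolding minus_add_distrib cis_mult[symmetric] 2 by simp
  ultimately show ?thesis by (simp add: phase_pair_def)
qed

lemma norm_phase_pair_le: "norm (phase_pair p \<phi>) \<le> 2"
proof -
  have "norm (phase_pair p \<phi>) \<le> norm (\<i> ^ p * cis \<phi>) + norm ((- \<i>) ^ p * cis (- \<phi>))"
    unfolding phase_pair_def by (rule norm_triangle_ineq)
  then show ?thesis by (simp add: norm_mult norm_power)
qed

text \<open>
  The sum over the reflections of both variables. For \<open>\<alpha> = \<beta> = 0\<close> the signs are those of the bracket;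
  each derivative in \<open>\<sigma>\<close> or \<open>\<theta>\<close> adds a sign to the terms in which this variable is reflected.
\<close>
definition reflect_sum :: "nat \<Rightarrow> nat \<Rightarrow> (real \<Rightarrow> real \<Rightarrow> complex) \<Rightarrow> real \<Rightarrow> real \<Rightarrow> complex" where
  "reflect_sum \<alpha> \<beta> f \<sigma> \<theta> = f \<sigma> \<theta> + (- 1) ^ \<alpha> * f (1 - \<sigma>) \<theta> - (- 1) ^ \<beta> * f \<sigma> (1 - \<theta>)
     - (- 1) ^ (\<alpha> + \<beta>) * f (1 - \<sigma>) (1 - \<theta>)"

lemma reflect_sum_add:
  "reflect_sum \<alpha> \<beta> (\<lambda>\<sigma> \<theta>. f \<sigma> \<theta> + g \<sigma> \<theta>) \<sigma> \<theta> = reflect_sum \<alpha> \<beta> f \<sigma> \<theta> + reflect_sum \<alpha> \<beta> g \<sigma> \<theta>"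
  by (simp add: reflect_sum_def algebra_simps)

lemma reflect_sum_sum:
  "finite I \<Longrightarrow> reflect_sum \<alpha> \<beta> (\<lambda>\<sigma> \<theta>. \<Sum>i\<in>I. f i \<sigma> \<theta>) \<sigma> \<theta> = (\<Sum>i\<in>I. reflect_sum \<alpha> \<beta> (f i) \<sigma> \<theta>)"
  by (simp add: reflect_sum_def sum.distrib sum_subtractf sum_distrib_left)

text \<open>
  The square is invariant under both reflections, so uniform convergence carries over to each of the
  four summands.
\<close>
lemma series_uniform_reflect_sum:
  assumes f: "series_uniform_on ({d..1 - d} \<times> {d..1 - d}) (\<lambda>m (\<sigma>, \<theta>). f m \<sigma> \<theta>)"
  shows "series_uniform_on ({d..1 - d} \<times> {d..1 - d}) (\<lambda>m (\<sigma>, \<theta>). reflect_sum \<alpha> \<beta> (f m) \<sigma> \<theta>)"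
proof -
  let ?D = "{d..1 - d} \<times> {d..1 - d}"
  have "series_uniform_on ?D (\<lambda>m p. c * f m (fst p) (snd p))" for c
    using series_uniform_cmult[OF f, of c] by (simp add: case_prod_unfold)
  from series_uniform_compose[OF this, of ?D "\<lambda>p. (1 - fst p, snd p)"]
    series_uniform_compose[OF this, of ?D "\<lambda>p. (fst p, 1 - snd p)"]
    series_uniform_compose[OF this, of ?D "\<lambda>p. (1 - fst p, 1 - snd p)"]
  have "series_uniform_on ?D (\<lambda>m p. c * f m (1 - fst p) (snd p))"
    "series_uniform_on ?D (\<lambda>m p. c * f m (fst p) (1 - snd p))"
    "series_uniform_on ?D (\<lambda>m p. c * f m (1 - fst p) (1 - snd p))" for c
    by auto
  note * = this
  have "series_uniform_on ?D (\<lambda>m p. f m (fst p) (snd p) + (- 1) ^ \<alpha> * f m (1 - fst p) (snd p)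
     + (- ((- 1) ^ \<beta>)) * f m (fst p) (1 - snd p) + (- ((- 1) ^ (\<alpha> + \<beta>))) * f m (1 - fst p) (1 - snd p))"
    using f by (intro series_uniform_add *) (simp add: case_prod_unfold)
  then show ?thesis by (simp add: reflect_sum_def case_prod_unfold)
qed

text \<open>The resonance oscillates in \<open>m\<close> with the frequency \<open>2 \<pi> x / k\<close>, which is not a multiple of \<open>2 \<pi>\<close>.\<close>
lemma resonance_uniform_nonintegral:
  assumes y: "Re (z + w + 1/2) < 0" and nint: "x / real k \<notin> \<int>"
  shows "series_uniform_on ({0..1} \<times> D) (\<lambda>m (\<sigma>, \<theta>). resonance x z w k m \<sigma> \<theta>)"
proof -
  let ?y = "z + w + 1/2"
  obtain C T where C: "C > 0" "T \<ge> 1" and sum: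
    "\<And>p N. p \<ge> T \<Longrightarrow> norm (\<Sum>j<N. osc ?y 0 (2 * pi * (x / real k)) (p + real j)) \<le> C * p powr Re ?y"
    by (rule osc_sum_bound_linear[OF y nint]) blast
  define B where "B = norm (stationary_coeff x w k * fresnel_const)"
  show ?thesis
  proof (rule series_uniform_tail_bound)
    show "(\<lambda>n. (B * C) * real n powr Re ?y) \<longlonglongrightarrow> 0" by (rule powr_tendsto_zero[OF y])
    fix M1 M2 :: nat and p :: "real \<times> real"
    assume M1: "nat \<lceil>T\<rceil> \<le> M1" and p: "p \<in> {0..1} \<times> D"
    obtain \<sigma> \<theta> where p_eq: "p = (\<sigma>, \<theta>)" by (cases p)
    have \<sigma>: "\<sigma> \<in> {0..1}" using p by (auto simp: p_eq)
    have M1T: "real M1 \<ge> T" using M1 by (simp add: nat_le_iff ceiling_le_iff)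
    let ?s = "\<Sum>j<M2 - M1. osc ?y 0 (2 * pi * (x / real k)) (real M1 + \<sigma> + real j)"
    let ?c = "stationary_coeff x w k * fresnel_const * cis (2 * pi * (real k * \<theta>))"
    have res: "resonance x z w k m \<sigma> \<theta> = ?c * osc ?y 0 (2 * pi * (x / real k)) (real m + \<sigma>)" if "m \<ge> M1" for m
    proof -
      have "real m + \<sigma> > 0" using that M1T C \<sigma> by auto
      moreover have "cis (2 * pi * (real k * \<theta> + (real m + \<sigma>) * x / real k))
          = cis (2 * pi * (real k * \<theta>)) * cis (2 * pi * (x / real k) * (real m + \<sigma>))"
        by (simp add: cis_mult distrib_left mult_ac)
      ultimately show ?thesis by (simp add: resonance_def osc_eq mult_ac)
    qed
    have "(\<Sum>m\<in>{M1..<M2}. resonance x z w k m \<sigma> \<theta>) = ?c * ?s"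
    proof (cases "M1 \<le> M2")
      case True
      have "(\<Sum>m\<in>{M1..<M2}. resonance x z w k m \<sigma> \<theta>) = (\<Sum>m\<in>{M1..<M2}. ?c * osc ?y 0 (2 * pi * (x / real k)) (real m + \<sigma>))"
        by (intro sum.cong refl res) auto
      also have "\<dots> = ?c * ?s"
        using True by (subst sum.atLeastLessThan_shift_0) (simp add: atLeast0LessThan add_ac sum_distrib_left)
      finally show ?thesis .
    qed simp
    also have "norm \<dots> \<le> B * (C * (real M1 + \<sigma>) powr Re ?y)"
      unfolding norm_mult[of ?c] using \<sigma> M1T
      by (intro mult_mono sum) (auto simp: B_def norm_mult)
    also have "\<dots> \<le> B * (C * real M1 powr Re ?y)"
      using \<sigma> M1T C y by (intro mult_left_mono powr_mono2') (auto simp: B_def)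
    finally show "norm (\<Sum>m\<in>{M1..<M2}. case p of (\<sigma>, \<theta>) \<Rightarrow> resonance x z w k m \<sigma> \<theta>) \<le> (B * C) * real M1 powr Re ?y"
      by (simp add: p_eq mult.assoc)
  qed
qed

text \<open>
  If \<open>x / k\<close> is an integer, then \<open>m\<close> drops out of the phase, and a reflection of \<open>\<sigma>\<close> or \<open>\<theta>\<close> just
  changes the sign of its part of the phase. By the parity \<open>phase_pair_minus\<close> the terms at
  \<open>(\<sigma>, \<theta>)\<close> and \<open>(1 - \<sigma>, 1 - \<theta>)\<close> cancel, and so do the other two, except that the power is taken
  at \<open>m + \<sigma>\<close> in one term and at \<open>m + 1 - \<sigma>\<close> in the other. This difference is \<open>O(m powr (Re y - 1))\<close>.
\<close>
lemma resonance_cancellation: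
  fixes y c :: complex
  assumes d: "d > 0" and y: "Re y < 0" and int: "x / real k \<in> \<int>"
  shows "series_uniform_on ({d..1 - d} \<times> {d..1 - d})
    (\<lambda>m (\<sigma>, \<theta>). reflect_sum \<alpha> \<beta> (\<lambda>\<sigma> \<theta>. c * phase_pair (\<alpha> + \<beta>) (2 * pi * (real k * \<theta> + (real m + \<sigma>) * x / real k))
        * of_real (real m + \<sigma>) powr y) \<sigma> \<theta>)"
proof (rule series_uniform_majorant)
  show "Re y - 1 < -1" using y by simp
  from int obtain l :: int where l: "x / real k = of_int l" by (auto elim: Ints_cases)
  fix m :: nat and p :: "real \<times> real"
  assume m: "m \<ge> 1" and p: "p \<in> {d..1 - d} \<times> {d..1 - d}"
  obtain \<sigma> \<theta> where p_eq: "p = (\<sigma>, \<theta>)" by (cases p)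
  have st: "\<sigma> \<in> {0<..<1}" "\<theta> \<in> {0<..<1}" using p d by (auto simp: p_eq)
  let ?t = "phase_pair (\<alpha> + \<beta>)"
  define \<phi> where "\<phi> = 2 * pi * (real k * \<theta> + of_int l * \<sigma>)"
  define \<psi> where "\<psi> = 2 * pi * (real k * \<theta> - of_int l * \<sigma>)"
  define Y where "Y = osc y 0 0 (real m + \<sigma>)"
  define Y' where "Y' = osc y 0 0 (real m + (1 - \<sigma>))"
  have ml: "(real m + s) * x / real k = of_int (int m * l) + of_int l * s" for s
  proof -
    have "(real m + s) * x / real k = (real m + s) * (x / real k)" by simp
    then show ?thesis unfolding l by (simp add: algebra_simps)
  qed
  have 1: "?t (2 * pi * (real k * \<theta> + (real m + \<sigma>) * x / real k)) = ?t \<phi>"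
    using phase_pair_periodic[of _ \<phi> "int m * l"] unfolding ml \<phi>_def by (simp add: algebra_simps)
  have 2: "?t (2 * pi * (real k * \<theta> + (real m + (1 - \<sigma>)) * x / real k)) = ?t \<psi>"
    using phase_pair_periodic[of _ \<psi> "int m * l + l"] unfolding ml \<psi>_def by (simp add: algebra_simps)
  have 3: "?t (2 * pi * (real k * (1 - \<theta>) + (real m + \<sigma>) * x / real k)) = ?t (- \<psi>)"
    using phase_pair_periodic[of _ "- \<psi>" "int m * l + int k"] unfolding ml \<psi>_def by (simp add: algebra_simps)
  have 4: "?t (2 * pi * (real k * (1 - \<theta>) + (real m + (1 - \<sigma>)) * x / real k)) = ?t (- \<phi>)"
    using phase_pair_periodic[of _ "- \<phi>" "int m * l + int k + l"] unfolding ml \<phi>_def by (simp add: algebra_simps)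
  have sgn: "(- 1) ^ \<beta> * (- 1) ^ (\<alpha> + \<beta>) = ((- 1) ^ \<alpha> :: complex)" "(- 1) ^ (\<alpha> + \<beta>) * (- 1) ^ (\<alpha> + \<beta>) = (1 :: complex)"
    by (simp_all add: power_add mult_ac flip: power_mult_distrib)
  have "reflect_sum \<alpha> \<beta> (\<lambda>\<sigma> \<theta>. c * ?t (2 * pi * (real k * \<theta> + (real m + \<sigma>) * x / real k)) * of_real (real m + \<sigma>) powr y) \<sigma> \<theta>
     = c * ?t \<phi> * Y + (- 1) ^ \<alpha> * (c * ?t \<psi> * Y') - ((- 1) ^ \<beta> * (- 1) ^ (\<alpha> + \<beta>)) * (c * ?t \<psi> * Y)
        - ((- 1) ^ (\<alpha> + \<beta>) * (- 1) ^ (\<alpha> + \<beta>)) * (c * ?t \<phi> * Y')"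
    unfolding reflect_sum_def 1 2 3 4 phase_pair_minus
    using st powr_eq_osc[of "real m + \<sigma>" y] powr_eq_osc[of "real m + (1 - \<sigma>)" y]
    by (simp add: Y_def Y'_def mult_ac)
  also have "\<dots> = c * (Y - Y') * (?t \<phi> - (- 1) ^ \<alpha> * ?t \<psi>)"
    unfolding sgn by (simp add: algebra_simps)
  also have "norm \<dots> \<le> norm c * (norm y * real m powr (Re y - 1)) * (2 + 2)"
    unfolding norm_mult
  proof (intro mult_mono)
    show "norm (Y - Y') \<le> norm y * real m powr (Re y - 1)"
      unfolding Y_def Y'_def using m y st by (intro osc_zero_diff_bound) auto
    have "norm (?t \<phi> - (- 1) ^ \<alpha> * ?t \<psi>) \<le> norm (?t \<phi>) + norm ((- 1) ^ \<alpha> * ?t \<psi>)"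
      by (rule norm_triangle_ineq4)
    also have "\<dots> \<le> 2 + 2" using norm_phase_pair_le[of "\<alpha> + \<beta>"] by (intro add_mono) (auto simp: norm_mult norm_power)
    finally show "norm (?t \<phi> - (- 1) ^ \<alpha> * ?t \<psi>) \<le> 2 + 2" .
  qed auto
  finally show "norm (case p of (\<sigma>, \<theta>) \<Rightarrow> reflect_sum \<alpha> \<beta> (\<lambda>\<sigma> \<theta>. c * ?t (2 * pi * (real k * \<theta> + (real m + \<sigma>) * x / real k)) * of_real (real m + \<sigma>) powr y) \<sigma> \<theta>)
     \<le> (4 * norm c * norm y) * real m powr (Re y - 1)"
    by (simp add: p_eq mult_ac)
qed

text \<open>
  The hypothesis on \<open>V\<close> gives the resonances of the two conjugate parts the same real factor, so that
  together they form a \<open>phase_pair\<close>, and \<open>resonance_cancellation\<close> applies.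
\<close>
lemma outer_series_uniform:
  fixes z w V :: complex and \<alpha> \<beta> :: nat
  assumes x: "x > 0" and z: "Re z < -1/2" and w: "Re w < -1/2" and d: "d > 0"
    and V: "V * fresnel_const = of_real \<rho>"
  shows "series_uniform_on ({d..1 - d} \<times> {d..1 - d}) (\<lambda>m (\<sigma>, \<theta>). reflect_sum \<alpha> \<beta>
    (\<lambda>\<sigma> \<theta>. \<i> ^ (\<alpha> + \<beta>) * V * lattice_sum x z w m \<sigma> \<theta>
        + (- \<i>) ^ (\<alpha> + \<beta>) * cnj V * cnj (lattice_sum x (cnj z) (cnj w) m \<sigma> \<theta>)) \<sigma> \<theta>)"
proof -
  define p where "p = \<alpha> + \<beta>"
  define K where "K = nat \<lceil>2 * x\<rceil>"
  have K: "real K \<ge> 2 * x" unfolding K_def by linarith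
  let ?D = "{d..1 - d} \<times> {d..1 - d}"
  let ?E = "{0..1} \<times> {d..1}"
  have DE: "q \<in> ?E" if "q \<in> ?D" for q using that d by auto
  define A where "A = \<i> ^ p * V"
  define B where "B = (- \<i>) ^ p * cnj V"
  define R where "R z w m \<sigma> \<theta> = lattice_sum x z w m \<sigma> \<theta> - (\<Sum>k\<in>{1..K}. resonance x z w k m \<sigma> \<theta>)" for z w m \<sigma> \<theta>
  define y where "y = z + w + 1/2"
  have y: "Re y < 0" using z w by (simp add: y_def)
  define f where "f m \<sigma> \<theta> = A * R z w m \<sigma> \<theta> + B * cnj (R (cnj z) (cnj w) m \<sigma> \<theta>)" for m \<sigma> \<theta>
  define h where "h k m \<sigma> \<theta> = A * resonance x z w k m \<sigma> \<theta> + B * cnj (resonance x (cnj z) (cnj w) k m \<sigma> \<theta>)" for k m \<sigma> \<theta>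
  have Runi: "series_uniform_on ?D (\<lambda>m q. R z w m (fst q) (snd q))" if "Re z < -1/2" "Re w < -1/2" for z w
    using series_uniform_compose[where h = "\<lambda>q. q", OF regular_part_uniform[OF x that d K] DE]
    by (simp add: R_def case_prod_unfold)
  have "series_uniform_on ?D (\<lambda>m q. A * R z w m (fst q) (snd q) + B * cnj (R (cnj z) (cnj w) m (fst q) (snd q)))"
    using z w by (intro series_uniform_add series_uniform_cmult series_uniform_cnj Runi) auto
  then have f: "series_uniform_on ?D (\<lambda>m (\<sigma>, \<theta>). reflect_sum \<alpha> \<beta> (f m) \<sigma> \<theta>)"
    by (intro series_uniform_reflect_sum) (simp add: f_def case_prod_unfold)
  have h: "series_uniform_on ?D (\<lambda>m (\<sigma>, \<theta>). reflect_sum \<alpha> \<beta> (h k m) \<sigma> \<theta>)" if k: "k \<in> {1..K}" for k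
  proof (cases "x / real k \<in> \<int>")
    case True
    define c where "c = stationary_coeff x w k * of_real \<rho>"
    have heq: "h k m \<sigma> \<theta> = c * phase_pair p (2 * pi * (real k * \<theta> + (real m + \<sigma>) * x / real k)) * of_real (real m + \<sigma>) powr y"
      if "\<sigma> > 0" for m \<sigma> \<theta>
    proof -
      let ?\<Phi> = "2 * pi * (real k * \<theta> + (real m + \<sigma>) * x / real k)"
      have V': "cnj V * cnj fresnel_const = of_real \<rho>"
        using arg_cong[OF V, of cnj] by simp
      have "h k m \<sigma> \<theta> = stationary_coeff x w k * of_real (real m + \<sigma>) powr y *
          (\<i> ^ p * (V * fresnel_const) * cis ?\<Phi> + (- \<i>) ^ p * (cnj V * cnj fresnel_const) * cis (- ?\<Phi>))"
        unfolding h_def A_def B_def y_def using that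
        by (subst cnj_resonance) (simp_all add: resonance_def algebra_simps)
      also have "\<dots> = c * phase_pair p ?\<Phi> * of_real (real m + \<sigma>) powr y"
        unfolding V V' by (simp add: c_def phase_pair_def algebra_simps)
      finally show ?thesis .
    qed
    have eq: "(\<Sum>m<N. case q of (\<sigma>, \<theta>) \<Rightarrow> reflect_sum \<alpha> \<beta> (\<lambda>\<sigma> \<theta>. c * phase_pair (\<alpha> + \<beta>) (2 * pi * (real k * \<theta> + (real m + \<sigma>) * x / real k))
        * of_real (real m + \<sigma>) powr y) \<sigma> \<theta>) = (\<Sum>m<N. case q of (\<sigma>, \<theta>) \<Rightarrow> reflect_sum \<alpha> \<beta> (h k m) \<sigma> \<theta>)"
      if "q \<in> ?D" for q N
    proof (rule sum.cong[OF refl])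
      fix m
      obtain \<sigma> \<theta> where q: "q = (\<sigma>, \<theta>)" by (cases q)
      have "\<sigma> > 0" "1 - \<sigma> > 0" using that d by (auto simp: q)
      then show "(case q of (\<sigma>, \<theta>) \<Rightarrow> reflect_sum \<alpha> \<beta> (\<lambda>\<sigma> \<theta>. c * phase_pair (\<alpha> + \<beta>) (2 * pi * (real k * \<theta> + (real m + \<sigma>) * x / real k))
        * of_real (real m + \<sigma>) powr y) \<sigma> \<theta>) = (case q of (\<sigma>, \<theta>) \<Rightarrow> reflect_sum \<alpha> \<beta> (h k m) \<sigma> \<theta>)"
        unfolding q prod.case reflect_sum_def by (simp only: heq p_def)
    qed
    from resonance_cancellation[OF d y True, of \<alpha> \<beta> c] show ?thesis
      by (rule uniformly_convergent_cong[THEN iffD1, rotated -1]) (use eq in auto)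
  next
    case False
    have "series_uniform_on ?D (\<lambda>m q. resonance x z w k m (fst q) (snd q))"
      if "Re (z + w + 1/2) < 0" for z w
      using series_uniform_compose[where h = "\<lambda>q. q", OF resonance_uniform_nonintegral[OF that False] DE]
      by (simp add: case_prod_unfold)
    then have "series_uniform_on ?D (\<lambda>m q. A * resonance x z w k m (fst q) (snd q)
        + B * cnj (resonance x (cnj z) (cnj w) k m (fst q) (snd q)))"
      using z w by (intro series_uniform_add series_uniform_cmult series_uniform_cnj) auto
    then show ?thesis by (intro series_uniform_reflect_sum) (simp add: h_def case_prod_unfold)
  qed
  have "series_uniform_on ?D (\<lambda>m q. reflect_sum \<alpha> \<beta> (f m) (fst q) (snd q)
      + (\<Sum>k\<in>{1..K}. reflect_sum \<alpha> \<beta> (h k m) (fst q) (snd q)))"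
    using f h by (intro series_uniform_add series_uniform_sum) (auto simp: case_prod_unfold)
  moreover have "reflect_sum \<alpha> \<beta> (f m) \<sigma> \<theta> + (\<Sum>k\<in>{1..K}. reflect_sum \<alpha> \<beta> (h k m) \<sigma> \<theta>)
    = reflect_sum \<alpha> \<beta> (\<lambda>\<sigma> \<theta>. \<i> ^ (\<alpha> + \<beta>) * V * lattice_sum x z w m \<sigma> \<theta>
        + (- \<i>) ^ (\<alpha> + \<beta>) * cnj V * cnj (lattice_sum x (cnj z) (cnj w) m \<sigma> \<theta>)) \<sigma> \<theta>" for m \<sigma> \<theta>
  proof -
    have "f m \<sigma> \<theta> + (\<Sum>k\<in>{1..K}. h k m \<sigma> \<theta>) = \<i> ^ (\<alpha> + \<beta>) * V * lattice_sum x z w m \<sigma> \<theta>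
        + (- \<i>) ^ (\<alpha> + \<beta>) * cnj V * cnj (lattice_sum x (cnj z) (cnj w) m \<sigma> \<theta>)" for \<sigma> \<theta>
      by (simp add: f_def h_def R_def A_def B_def p_def sum.distrib sum_distrib_left algebra_simps)
    then show ?thesis
      by (simp flip: reflect_sum_add add: reflect_sum_sum[symmetric])
  qed
  ultimately show ?thesis by (simp add: case_prod_unfold)
qed

section \<open>Asymptotics of the Bessel functions of order zero and one\<close>

text \<open>
  Up to the factor \<open>2 / \<pi>\<close>, the real part for \<open>n = 0\<close> is \<open>J\<^sub>0\<close> and the imaginary part for
  \<open>n = 1\<close> is \<open>J\<^sub>1\<close>.
\<close>
definition poisson_integral :: "nat \<Rightarrow> real \<Rightarrow> complex" where
  "poisson_integral n z = integral {0..pi / 2} (\<lambda>t. of_real (cos t ^ n) * cis (z * cos t))"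

text \<open>
  This is \<open>J\<^sub>1 - \<i> J\<^sub>0\<close>, whose real part is \<open>J\<^sub>1\<close>. At infinity it behaves like the single oscillation
  \<open>exp (\<i> z) / sqrt z\<close> up to a constant, and its conjugate like \<open>exp (- \<i> z) / sqrt z\<close>. The derivatives
  of both are combinations of both.
\<close>
definition hankel :: "real \<Rightarrow> complex" where
  "hankel z = of_real (2 / pi * Im (poisson_integral 1 z)) - \<i> * of_real (2 / pi * Re (poisson_integral 0 z))"

lemma poisson_integral_has_integral:
  "((\<lambda>t. of_real (cos t ^ n) * cis (z * cos t)) has_integral poisson_integral n z) {0..pi / 2}"
  unfolding poisson_integral_def
  by (intro integrable_integral integrable_continuous_real continuous_intros)

lemma poisson_integral_vector_derivative:
  "(poisson_integral n has_vector_derivative \<i> * poisson_integral (Suc n) z) (at z)"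
proof -
  have "((\<lambda>z. integral (cbox 0 (pi / 2)) (\<lambda>t. of_real (cos t ^ n) * cis (z * cos t))) has_vector_derivative
     integral (cbox 0 (pi / 2)) (\<lambda>t. \<i> * (of_real (cos t ^ Suc n) * cis (z * cos t)))) (at z within UNIV)"
  proof (rule leibniz_rule_vector_derivative)
    fix s t :: real
    have "((\<lambda>s. cis (s * cos t)) has_vector_derivative \<i> * of_real (cos t) * cis (s * cos t)) (at s within UNIV)"
      by (rule cis_vector_derivative) (auto intro!: derivative_eq_intros)
    from has_vector_derivative_mult_right[OF this, of "of_real (cos t ^ n)"]
    show "((\<lambda>s. of_real (cos t ^ n) * cis (s * cos t)) has_vector_derivative
        \<i> * (of_real (cos t ^ Suc n) * cis (s * cos t))) (at s within UNIV)"
      by (simp add: mult_ac)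
  next
    fix s :: real
    show "(\<lambda>t. of_real (cos t ^ n) * cis (s * cos t)) integrable_on cbox 0 (pi / 2)"
      by (intro integrable_continuous continuous_intros)
  next
    show "continuous_on (UNIV \<times> cbox 0 (pi / 2)) (\<lambda>(s, t). \<i> * (of_real (cos t ^ Suc n) * cis (s * cos t)))"
      unfolding case_prod_unfold by (intro continuous_intros)
  qed auto
  moreover have "integral (cbox 0 (pi / 2)) (\<lambda>t. \<i> * (of_real (cos t ^ Suc n) * cis (z * cos t))) = \<i> * poisson_integral (Suc n) z"
    using integral_unique[OF has_integral_mult_right[OF poisson_integral_has_integral[of "Suc n" z], of \<i>]]
    by (simp only: box_real)
  ultimately show ?thesis by (simp add: poisson_integral_def[abs_def])
qed

lemma norm_poisson_integral_le: "norm (poisson_integral n z) \<le> pi / 2"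
proof -
  have "norm (poisson_integral n z) \<le> 1 * (pi / 2 - 0)"
    unfolding poisson_integral_def
  proof (rule integral_bound)
    show "norm (of_real (cos t ^ n) * cis (z * cos t)) \<le> 1" for t
      by (simp add: norm_mult norm_power power_le_one)
  qed (auto intro!: continuous_intros)
  then show ?thesis by simp
qed

text \<open>The derivative of \<open>sin t sin (z cos t)\<close> integrates to 0.\<close>
lemma poisson_integral_recurrence:
  "z * Re (poisson_integral 0 z - poisson_integral 2 z) = Im (poisson_integral 1 z)"
proof -
  have "((\<lambda>t. Im (of_real (cos t ^ 1) * cis (z * cos t)) - z * Re (of_real (cos t ^ 0) * cis (z * cos t) - of_real (cos t ^ 2) * cis (z * cos t)))
      has_integral (sin (pi / 2) * sin (z * cos (pi / 2)) - sin 0 * sin (z * cos 0))) {0..pi / 2}"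
  proof (rule fundamental_theorem_of_calculus)
    fix t assume "t \<in> {0..pi / 2}"
    have "((\<lambda>t. sin t * sin (z * cos t)) has_real_derivative
       cos t * sin (z * cos t) - z * (sin t * sin t) * cos (z * cos t)) (at t within {0..pi / 2})"
      by (auto intro!: derivative_eq_intros)
    also have "sin t * sin t = 1 - cos t ^ 2" using sin_cos_squared_add[of t] by (simp add: power2_eq_square)
    finally show "((\<lambda>t. sin t * sin (z * cos t)) has_vector_derivative
        Im (of_real (cos t ^ 1) * cis (z * cos t)) - z * Re (of_real (cos t ^ 0) * cis (z * cos t) - of_real (cos t ^ 2) * cis (z * cos t)))
        (at t within {0..pi / 2})"
      unfolding has_real_derivative_iff_has_vector_derivative[symmetric]
      by (simp add: algebra_simps flip: of_real_power)
  qed simp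
  moreover have "((\<lambda>t. Im (of_real (cos t ^ 1) * cis (z * cos t)) - z * Re (of_real (cos t ^ 0) * cis (z * cos t) - of_real (cos t ^ 2) * cis (z * cos t)))
      has_integral (Im (poisson_integral 1 z) - z * Re (poisson_integral 0 z - poisson_integral 2 z))) {0..pi / 2}"
    by (intro has_integral_diff has_integral_mult_right has_integral_Im has_integral_Re poisson_integral_has_integral)
  ultimately have "Im (poisson_integral 1 z) - z * Re (poisson_integral 0 z - poisson_integral 2 z)
      = sin (pi / 2) * sin (z * cos (pi / 2)) - sin 0 * sin (z * cos 0)"
    by (rule has_integral_unique[rotated])
  then show ?thesis by simp
qed

text \<open>In terms of Bessel functions: \<open>J\<^sub>0' = - J\<^sub>1\<close> and \<open>J\<^sub>1' = J\<^sub>0 - J\<^sub>1 / z\<close>.\<close>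
lemma hankel_vector_derivative:
  assumes z: "z > 0"
  shows "(hankel has_vector_derivative \<i> * hankel z - (hankel z + cnj (hankel z)) / (2 * of_real z)) (at z)"
proof -
  let ?P = poisson_integral
  have d: "((\<lambda>z. Im (?P 1 z)) has_real_derivative Re (?P 2 z)) (at z)"
    "((\<lambda>z. Re (?P 0 z)) has_real_derivative - Im (?P 1 z)) (at z)"
    using poisson_integral_vector_derivative[of 1 z] poisson_integral_vector_derivative[of 0 z]
    by (simp_all add: has_vector_derivative_complex_iff numeral_2_eq_2)
  have "(hankel has_vector_derivative of_real (2 / pi * Re (?P 2 z)) - \<i> * of_real (2 / pi * (- Im (?P 1 z)))) (at z)"
    unfolding hankel_def[abs_def]
    by (intro has_vector_derivative_diff has_vector_derivative_mult_right has_vector_derivative_of_real DERIV_cmult d)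
  moreover have e: "Re (?P 2 z) = Re (?P 0 z) - Im (?P 1 z) / z"
    using poisson_integral_recurrence[of z] z by (simp add: field_simps)
  have "of_real (2 / pi * Re (?P 2 z)) - \<i> * of_real (2 / pi * (- Im (?P 1 z)))
     = \<i> * hankel z - (hankel z + cnj (hankel z)) / (2 * of_real z)"
    unfolding e using z by (simp add: hankel_def complex_eq_iff field_simps)
  ultimately show ?thesis by simp
qed

lemma norm_hankel_le: "norm (hankel z) \<le> 2"
proof -
  have "norm (hankel z) \<le> 2 / pi * \<bar>Im (poisson_integral 1 z)\<bar> + 2 / pi * \<bar>Re (poisson_integral 0 z)\<bar>"
    unfolding hankel_def
    by (rule order_trans[OF norm_triangle_ineq4])
       (simp only: norm_mult norm_of_real norm_ii abs_mult abs_divide, simp)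
  also have "\<dots> \<le> 2 / pi * (pi / 2) + 2 / pi * (pi / 2)"
    using norm_poisson_integral_le[of 1 z] norm_poisson_integral_le[of 0 z]
      abs_Im_le_cmod[of "poisson_integral 1 z"] abs_Re_le_cmod[of "poisson_integral 0 z"]
    by (intro add_mono mult_left_mono) (auto intro: order_trans)
  also have "\<dots> = 2" by simp
  finally show ?thesis .
qed

text \<open>With \<open>r = sqrt 2 sin (t / 2)\<close> the phase \<open>cos t\<close> becomes \<open>1 - r\<^sup>2\<close>.\<close>
lemma poisson_integral_substitution:
  fixes h :: "real \<Rightarrow> complex"
  assumes h: "continuous_on {0..1} h"
    and eq: "\<And>t. t \<in> {0..pi / 2} \<Longrightarrow> of_real (sqrt 2 / 2 * cos (t / 2)) * h (sqrt 2 * sin (t / 2)) = of_real (cos t ^ n)"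
  shows "poisson_integral n z = cis z * integral {0..1} (\<lambda>r. h r * cis (- (z * r ^ 2)))"
proof -
  let ?g = "\<lambda>t. sqrt 2 * sin (t / 2)"
  let ?f = "\<lambda>r. h r * cis (- (z * r ^ 2))"
  have g_end: "?g 0 = 0" "?g (pi / 2) = 1" by (simp_all add: sin_45)
  have "((\<lambda>t. (sqrt 2 / 2 * cos (t / 2)) *\<^sub>R ?f (?g t)) has_integral (integral {?g 0..?g (pi / 2)} ?f)) {0..pi / 2}"
  proof (rule has_integral_substitution[where c = 0 and d = 1])
    show "?g ` {0..pi / 2} \<subseteq> {0..1}"
    proof
      fix y assume "y \<in> ?g ` {0..pi / 2}"
      then obtain t where t: "t \<in> {0..pi / 2}" "y = ?g t" by auto
      have "0 \<le> sin (t / 2)" using t by (intro sin_ge_zero) auto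
      moreover have "sin (t / 2) \<le> sin (pi / 4)" using t by (subst sin_mono_le_eq) auto
      then have "?g t \<le> sqrt 2 * sin (pi / 4)" by (intro mult_left_mono) auto
      ultimately show "y \<in> {0..1}" using t by (simp add: sin_45)
    qed
    show "continuous_on {0..1} ?f" by (intro continuous_intros h)
    fix t assume "t \<in> {0..pi / 2}"
    show "(?g has_field_derivative sqrt 2 / 2 * cos (t / 2)) (at t within {0..pi / 2})"
      by (auto intro!: derivative_eq_intros)
  qed (use g_end in auto)
  then have "((\<lambda>t. cis z * ((sqrt 2 / 2 * cos (t / 2)) *\<^sub>R ?f (?g t))) has_integral cis z * integral {0..1} ?f) {0..pi / 2}"
    unfolding g_end by (rule has_integral_mult_right)
  moreover have "cis z * ((sqrt 2 / 2 * cos (t / 2)) *\<^sub>R ?f (?g t)) = of_real (cos t ^ n) * cis (z * cos t)"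
    if t: "t \<in> {0..pi / 2}" for t
  proof -
    have c: "cos t = 1 - 2 * sin (t / 2) ^ 2" using cos_double_sin[of "t / 2"] by simp
    have "z * cos t = z + - (z * ?g t ^ 2)" unfolding c by (simp add: power_mult_distrib right_diff_distrib)
    then have "cis (z * cos t) = cis z * cis (- (z * ?g t ^ 2))" by (simp add: cis_mult)
    then show ?thesis unfolding eq[OF t, symmetric] by (simp add: scaleR_conv_of_real mult_ac)
  qed
  ultimately have "((\<lambda>t. of_real (cos t ^ n) * cis (z * cos t)) has_integral cis z * integral {0..1} ?f) {0..pi / 2}"
    by (rule has_integral_eq[rotated])
  then show ?thesis using poisson_integral_has_integral has_integral_unique by blast
qed

text \<open>
  After the substitution the amplitude is \<open>h r = 2 / sqrt (2 - r\<^sup>2)\<close> for \<open>n = 0\<close> and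
  \<open>g r = (1 - r\<^sup>2) h r\<close> for \<open>n = 1\<close>. Both are smooth on the unit interval with value \<open>sqrt 2\<close> at 0,
  so \<open>fresnel_integral_asymptotic\<close> applies.
\<close>
lemma poisson_integral_weak_asymptotic:
  assumes z: "z > 0" and n: "n = 0 \<or> n = 1"
  shows "norm (poisson_integral n z - cis z * (of_real (sqrt 2) * fresnel_const / of_real (sqrt z))) \<le> 30 / z"
proof -
  define q where "q r = sqrt (2 - r ^ 2)" for r :: real
  have r2: "r ^ 2 \<le> 1" if "r \<in> {0..1}" for r :: real using that by (simp add: power_le_one)
  have q1: "q r \<ge> 1" if "r \<in> {0..1}" for r using r2[OF that] by (simp add: q_def)
  have q_deriv: "(q has_real_derivative - (r / q r)) (at r within {0..1})" if r: "r \<in> {0..1}" for r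
  proof -
    have pos: "2 - r ^ 2 > 0" using r2[OF r] by simp
    have "((\<lambda>r. 2 - r ^ 2) has_real_derivative - (2 * r)) (at r within {0..1})"
      by (auto intro!: derivative_eq_intros)
    from DERIV_chain2[where f = sqrt and g = "\<lambda>r. 2 - r ^ 2", OF DERIV_real_sqrt[OF pos] this]
    have d: "((\<lambda>r. sqrt (2 - r ^ 2)) has_real_derivative inverse (sqrt (2 - r ^ 2)) / 2 * - (2 * r)) (at r within {0..1})" .
    have q_eq: "q = (\<lambda>r. sqrt (2 - r ^ 2))" by (rule ext) (rule q_def)
    have "inverse s / 2 * - (2 * r) = - (r / s)" for s :: real by (cases "s = 0") (simp_all add: field_simps)
    from d[unfolded this] show ?thesis unfolding q_eq .
  qed
  define h where "h r = 2 / q r" for r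
  define h' where "h' r = 2 * r / q r ^ 3" for r
  define h'' where "h'' r = 2 / q r ^ 3 + 6 * r ^ 2 / q r ^ 5" for r
  have h: "(h has_real_derivative h' r) (at r within {0..1})" if r: "r \<in> {0..1}" for r
  proof -
    have q0: "q r \<noteq> 0" using q1[OF r] by simp
    have "((\<lambda>r. 2 / q r) has_real_derivative (0 * q r - 2 * (- (r / q r))) / (q r * q r)) (at r within {0..1})"
      by (rule DERIV_divide[OF DERIV_const q_deriv[OF r] q0])
    also have "(0 * q r - 2 * (- (r / q r))) / (q r * q r) = h' r"
      using q0 by (simp add: h'_def power3_eq_cube)
    finally show ?thesis by (simp only: h_def[abs_def])
  qed
  have h': "(h' has_real_derivative h'' r) (at r within {0..1})" if r: "r \<in> {0..1}" for r
  proof -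
    have q0: "q r \<noteq> 0" using q1[OF r] by simp
    have "((\<lambda>r. 2 * r / q r ^ 3) has_real_derivative
        (2 * q r ^ 3 - 2 * r * (3 * q r ^ 2 * (- (r / q r)))) / (q r ^ 3 * q r ^ 3)) (at r within {0..1})"
    proof (rule DERIV_divide)
      show "((\<lambda>r. q r ^ 3) has_real_derivative 3 * q r ^ 2 * (- (r / q r))) (at r within {0..1})"
        using DERIV_power[OF q_deriv[OF r], of 3] by (simp add: mult_ac)
    qed (use q0 in \<open>auto intro!: derivative_eq_intros\<close>)
    also have "(2 * q r ^ 3 - 2 * r * (3 * q r ^ 2 * (- (r / q r)))) / (q r ^ 3 * q r ^ 3) = h'' r"
      using q0 by (simp add: h''_def field_simps power_numeral_reduce)
    finally show ?thesis by (simp add: h'_def[abs_def])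
  qed
  have h_le: "\<bar>h r\<bar> \<le> 2" "\<bar>h' r\<bar> \<le> 2" "\<bar>h'' r\<bar> \<le> 8" if r: "r \<in> {0..1}" for r
  proof -
    have q: "q r ^ k \<ge> 1" for k using q1[OF r] by simp
    have "2 / q r \<le> 2 / 1" using q1[OF r] by (intro divide_left_mono) auto
    then show "\<bar>h r\<bar> \<le> 2" using q1[OF r] by (simp add: h_def)
    have "2 * r / q r ^ 3 \<le> 2 / 1" using q[of 3] r by (intro frac_le) auto
    then show "\<bar>h' r\<bar> \<le> 2" using q1[OF r] r by (simp add: h'_def)
    have "2 / q r ^ 3 \<le> 2 / 1" "6 * r ^ 2 / q r ^ 5 \<le> 6 / 1"
      using q[of 3] q[of 5] r2[OF r] by (intro frac_le; simp)+
    then show "\<bar>h'' r\<bar> \<le> 8" using q1[OF r] by (simp add: h''_def)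
  qed
  define g where "g r = 2 * q r - h r" for r
  define g' where "g' r = - r * h r - h' r" for r
  define g'' where "g'' r = - h r - r * h' r - h'' r" for r
  have g: "(g has_real_derivative g' r) (at r within {0..1})" if r: "r \<in> {0..1}" for r
    unfolding g_def[abs_def]
    by (rule derivative_eq_intros q_deriv[OF r] h[OF r] refl)+ (simp add: g'_def h_def)
  have g': "(g' has_real_derivative g'' r) (at r within {0..1})" if r: "r \<in> {0..1}" for r
    unfolding g'_def[abs_def]
    by (rule derivative_eq_intros h'[OF r] h[OF r] refl)+ (simp add: g''_def)
  have g_le: "\<bar>g'' r\<bar> \<le> 12" if r: "r \<in> {0..1}" for r
  proof -
    have "\<bar>r * h' r\<bar> \<le> 1 * 2" unfolding abs_mult using r h_le(2)[OF r] by (intro mult_mono) auto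
    then show ?thesis using h_le[OF r] unfolding g''_def by linarith
  qed
  have qt: "q (sqrt 2 * sin (t / 2)) = sqrt 2 * cos (t / 2)" if t: "t \<in> {0..pi / 2}" for t
  proof -
    have "cos (t / 2) \<ge> 0" using t by (intro cos_ge_zero) auto
    moreover have "2 - (sqrt 2 * sin (t / 2)) ^ 2 = (sqrt 2 * cos (t / 2)) ^ 2"
      by (simp add: power_mult_distrib sin_squared_eq)
    ultimately show ?thesis unfolding q_def by (simp add: real_sqrt_abs abs_mult)
  qed
  have cpos: "cos (t / 2) > 0" if t: "t \<in> {0..pi / 2}" for t
  proof -
    from t have "0 \<le> t" "t \<le> pi / 2" by auto
    then have "- (pi / 2) < t / 2" "t / 2 < pi / 2" using pi_gt_zero by linarith+
    then show ?thesis by (rule cos_gt_zero_pi)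
  qed
  have gen: ?thesis if f: "\<And>r. r \<in> {0..1} \<Longrightarrow> (f has_real_derivative f' r) (at r within {0..1})"
      and f': "\<And>r. r \<in> {0..1} \<Longrightarrow> (f' has_real_derivative f'' r) (at r within {0..1})"
      and A: "\<And>r. r \<in> {0..1} \<Longrightarrow> \<bar>f'' r\<bar> \<le> 12"
      and f0: "f 0 = sqrt 2" "f' 0 = 0"
      and ft: "\<And>t. t \<in> {0..pi / 2} \<Longrightarrow> sqrt 2 / 2 * cos (t / 2) * f (sqrt 2 * sin (t / 2)) = cos t ^ n" for f f' f''
  proof -
    let ?F = "\<lambda>r. complex_of_real (f r)"
    have fc: "continuous_on {0..1} f" using f DERIV_continuous_on by blast
    have eq: "poisson_integral n z = cis z * integral {0..1} (\<lambda>r. ?F r * cis (- (z * r ^ 2)))"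
      by (rule poisson_integral_substitution) (use ft fc in \<open>auto intro!: continuous_intros simp flip: of_real_mult of_real_divide of_real_power\<close>)
    have "norm (integral {0..1} (\<lambda>r. ?F r * cis (- (z * r ^ 2))) - ?F 0 * fresnel_const / of_real (sqrt z))
        \<le> (2 * norm (?F 0) / 1 + norm (complex_of_real (f' 0)) + 2 * 12 * 1) / z"
      by (rule fresnel_integral_asymptotic[OF z, where h'' = "\<lambda>r. complex_of_real (f'' r)"])
         (use f f' A in \<open>auto intro: has_vector_derivative_of_real\<close>)
    also have "\<dots> = (2 * sqrt 2 + 24) / z" by (simp add: f0)
    finally have "norm (cis z * (integral {0..1} (\<lambda>r. ?F r * cis (- (z * r ^ 2))) - of_real (sqrt 2) * fresnel_const / of_real (sqrt z)))
       \<le> (2 * sqrt 2 + 24) / z" by (simp add: norm_mult f0)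
    also have "(2 * sqrt 2 + 24) / z \<le> 30 / z"
    proof -
      have "sqrt 2 \<le> 2" by (rule real_le_lsqrt) auto
      then show ?thesis using z by (intro divide_right_mono) auto
    qed
    finally show ?thesis unfolding eq by (simp add: right_diff_distrib)
  qed
  have s2: "2 / sqrt 2 = sqrt 2" by (simp add: real_div_sqrt)
  show ?thesis
    using n
  proof
    assume n0: "n = 0"
    show ?thesis
    proof (rule gen[OF h h'])
      show "\<bar>h'' r\<bar> \<le> 12" if "r \<in> {0..1}" for r using h_le(3)[OF that] by simp
      show "h 0 = sqrt 2" "h' 0 = 0" by (simp_all add: h_def h'_def q_def s2)
      fix t assume t: "t \<in> {0..pi / 2}"
      show "sqrt 2 / 2 * cos (t / 2) * h (sqrt 2 * sin (t / 2)) = cos t ^ n"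
        unfolding h_def qt[OF t] using cpos[OF t] by (simp add: n0)
    qed
  next
    assume n1: "n = 1"
    show ?thesis
    proof (rule gen[OF g g' g_le])
      show "g 0 = sqrt 2" "g' 0 = 0" using s2 by (simp_all add: g_def g'_def h_def h'_def q_def)
      fix t assume t: "t \<in> {0..pi / 2}"
      have "sqrt 2 / 2 * cos (t / 2) * g (sqrt 2 * sin (t / 2)) = 2 * cos (t / 2) ^ 2 - 1"
        unfolding g_def h_def qt[OF t] using cpos[OF t] by (simp add: right_diff_distrib power2_eq_square)
      also have "\<dots> = cos t" using cos_double_cos[of "t / 2"] by simp
      finally show "sqrt 2 / 2 * cos (t / 2) * g (sqrt 2 * sin (t / 2)) = cos t ^ n" by (simp add: n1)
    qed
  qed
qed

text \<open>The limit of \<open>exp (- \<i> z) sqrt z hankel z\<close> at infinity.\<close>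
definition hankel_const :: complex where
  "hankel_const = - \<i> * of_real (2 / pi * sqrt 2) * fresnel_const"

lemma hankel_const_times_fresnel: "hankel_const * fresnel_const = of_real (- (sqrt 2 / 2))"
proof -
  have "hankel_const * fresnel_const = - \<i> * of_real (2 / pi * sqrt 2) * fresnel_const ^ 2"
    by (simp add: hankel_const_def power2_eq_square)
  then show ?thesis unfolding fresnel_const_square by (simp add: complex_eq_iff)
qed

lemma hankel_weak_asymptotic:
  assumes z: "z > 0"
  shows "norm (hankel z - hankel_const * cis z / of_real (sqrt z)) \<le> 60 / z"
proof -
  define X where "X = cis z * (of_real (sqrt 2) * fresnel_const / of_real (sqrt z))"
  have X: "hankel_const * cis z / of_real (sqrt z) = of_real (2 / pi * Im X) - \<i> * of_real (2 / pi * Re X)"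
  proof -
    have "hankel_const * cis z / of_real (sqrt z) = - \<i> * of_real (2 / pi) * X"
      by (simp add: hankel_const_def X_def mult_ac)
    then show ?thesis by (simp add: complex_eq_iff)
  qed
  have "hankel z - hankel_const * cis z / of_real (sqrt z)
      = of_real (2 / pi * Im (poisson_integral 1 z - X)) - \<i> * of_real (2 / pi * Re (poisson_integral 0 z - X))"
    unfolding X hankel_def by (simp add: complex_eq_iff right_diff_distrib)
  also have "norm \<dots> \<le> 2 / pi * \<bar>Im (poisson_integral 1 z - X)\<bar> + 2 / pi * \<bar>Re (poisson_integral 0 z - X)\<bar>"
    by (rule order_trans[OF norm_triangle_ineq4])
       (simp only: norm_mult norm_of_real norm_ii abs_mult abs_divide, simp)
  also have "\<dots> \<le> 1 * (30 / z) + 1 * (30 / z)"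
  proof (intro add_mono mult_mono)
    show "2 / pi \<le> 1" "2 / pi \<le> 1" using pi_gt3 by simp_all
    show "\<bar>Im (poisson_integral 1 z - X)\<bar> \<le> 30 / z"
      using abs_Im_le_cmod poisson_integral_weak_asymptotic[OF z, of 1] unfolding X_def by (rule order_trans) simp
    show "\<bar>Re (poisson_integral 0 z - X)\<bar> \<le> 30 / z"
      using abs_Re_le_cmod poisson_integral_weak_asymptotic[OF z, of 0] unfolding X_def by (rule order_trans) simp
  qed auto
  finally show ?thesis by simp
qed

text \<open>
  The function \<open>V z = exp (- \<i> z) sqrt z hankel z\<close> satisfies \<open>V' = - exp (- 2 \<i> z) cnj V / (2 z)\<close>. It
  is bounded by \<open>hankel_weak_asymptotic\<close>, so an integration by parts shows that \<open>V\<close> tends to its limit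
  at the rate \<open>1 / z\<close>. The rate \<open>1 / sqrt z\<close> of \<open>hankel_weak_asymptotic\<close> would leave an error that is
  not summable in general.
\<close>
lemma hankel_asymptotic:
  assumes z0: "z0 > 0"
  obtains C where "C > 0"
    "\<And>z. z \<ge> z0 \<Longrightarrow> norm (hankel z - hankel_const * cis z / of_real (sqrt z)) \<le> C / (z * sqrt z)"
proof -
  define V where "V z = cis (- z) * (of_real (sqrt z) * hankel z)" for z
  have V_weak: "norm (V z - hankel_const) \<le> 60 / sqrt z" if z: "z > 0" for z
  proof -
    have "cis (- z) * cis z = 1" by (simp add: cis_mult)
    then have "V z - hankel_const = cis (- z) * (of_real (sqrt z) * (hankel z - hankel_const * cis z / of_real (sqrt z)))"
      using z by (simp add: V_def right_diff_distrib mult.left_commute[of _ hankel_const])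
    then have "norm (V z - hankel_const) = sqrt z * norm (hankel z - hankel_const * cis z / of_real (sqrt z))"
      using z by (simp add: norm_mult)
    also have "\<dots> \<le> sqrt z * (60 / z)" using z by (intro mult_left_mono hankel_weak_asymptotic) auto
    also have "\<dots> = 60 / sqrt z" using z by (simp add: field_simps)
    finally show ?thesis .
  qed
  define B where "B = norm hankel_const + 60"
  have V_le: "norm (V z) \<le> B" if z: "z \<ge> 1" for z
  proof -
    have "norm (V z) \<le> norm hankel_const + norm (V z - hankel_const)" by (metis norm_triangle_sub)
    also have "norm (V z - hankel_const) \<le> 60 / sqrt z" using z by (intro V_weak) simp
    also have "60 / sqrt z \<le> 60 / 1" using z by (intro divide_left_mono) auto
    finally show ?thesis by (simp add: B_def)
  qed
  have B0: "B \<ge> 0" by (simp add: B_def)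
  define V' where "V' z = - (cis (- (2 * z)) * cnj (V z)) / of_real (2 * z)" for z
  have V_deriv: "(V has_vector_derivative V' z) (at z)" if z: "z > 0" for z
  proof -
    have 1: "((\<lambda>z. cis (- z)) has_vector_derivative \<i> * of_real (- 1) * cis (- z)) (at z)"
      by (rule cis_vector_derivative) (auto intro!: derivative_eq_intros)
    have 2: "((\<lambda>z. of_real (sqrt z) :: complex) has_vector_derivative of_real (1 / (2 * sqrt z))) (at z)"
      using z by (intro has_vector_derivative_of_real) (auto intro!: derivative_eq_intros simp: field_simps)
    have "(V has_vector_derivative cis (- z) * (of_real (sqrt z) * (\<i> * hankel z - (hankel z + cnj (hankel z)) / (2 * of_real z))
        + of_real (1 / (2 * sqrt z)) * hankel z) + \<i> * of_real (- 1) * cis (- z) * (of_real (sqrt z) * hankel z)) (at z)"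
      unfolding V_def[abs_def] by (intro has_vector_derivative_mult 1 2 hankel_vector_derivative z)
    moreover have "cis (- z) * (of_real (sqrt z) * (\<i> * hankel z - (hankel z + cnj (hankel z)) / (2 * of_real z))
        + of_real (1 / (2 * sqrt z)) * hankel z) + \<i> * of_real (- 1) * cis (- z) * (of_real (sqrt z) * hankel z) = V' z"
    proof -
      have s: "of_real z = of_real (sqrt z) * (of_real (sqrt z) :: complex)" using z by (simp flip: of_real_mult)
      have c: "cis (- (2 * z)) * cnj (cis (- z)) = cis (- z)" by (simp add: cis_cnj cis_mult)
      have "V' z = - ((cis (- (2 * z)) * cnj (cis (- z))) * (of_real (sqrt z) * cnj (hankel z))) / of_real (2 * z)"
        unfolding V'_def V_def by (simp only: complex_cnj_mult complex_cnj_complex_of_real mult.assoc)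
      also have "\<dots> = - (cis (- z) * (of_real (sqrt z) * cnj (hankel z))) / of_real (2 * z)"
        unfolding c ..
      also have "\<dots> = cis (- z) * (- (of_real (sqrt z) * cnj (hankel z)) / of_real (2 * z))" by simp
      also have "- (of_real (sqrt z) * cnj (hankel z)) / of_real (2 * z) =
         of_real (1 / (2 * sqrt z)) * hankel z - of_real (sqrt z) * ((hankel z + cnj (hankel z)) / (2 * of_real z))"
      proof -
        have "- (r * k) / (2 * (r * r)) = 1 / (2 * r) * h - r * ((h + k) / (2 * (r * r)))" if "r \<noteq> 0" for r h k :: complex
          using that by (simp add: field_simps)
        from this[of "of_real (sqrt z)" "cnj (hankel z)" "hankel z"] z show ?thesis
          unfolding s[symmetric] by simp
      qed
      finally show ?thesis by (simp add: algebra_simps)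
    qed
    ultimately show ?thesis by simp
  qed
  have V'_le: "norm (V' z) \<le> B / (2 * z)" if z: "z \<ge> 1" for z
    using V_le[OF z] z by (simp add: V'_def norm_divide norm_mult divide_right_mono)
  \<comment> \<open>The boundary term of the integration by parts: its derivative is \<open>V'\<close> up to \<open>O(z powr (- 2))\<close>.\<close>
  define G where "G z = cis (- (2 * z)) * cnj (V z) * (of_real (1 / z) / (4 * \<i>))" for z
  define E where "E z = (cis (- (2 * z)) * cnj (V' z) * of_real (1 / z) - cis (- (2 * z)) * cnj (V z) * of_real (1 / z ^ 2)) / (4 * \<i>)" for z
  have G_deriv: "(G has_vector_derivative V' z + E z) (at z)" if z: "z > 0" for z
  proof -
    have 1: "((\<lambda>z. cis (- (2 * z))) has_vector_derivative \<i> * of_real (- 2) * cis (- (2 * z))) (at z)"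
      by (rule cis_vector_derivative) (auto intro!: derivative_eq_intros)
    have 2: "((\<lambda>z. of_real (1 / z) :: complex) has_vector_derivative of_real (- (1 / z ^ 2))) (at z)"
      using z by (intro has_vector_derivative_of_real) (auto intro!: derivative_eq_intros simp: power2_eq_square)
    have "(G has_vector_derivative cis (- (2 * z)) * cnj (V z) * (of_real (- (1 / z ^ 2)) / (4 * \<i>))
        + (cis (- (2 * z)) * cnj (V' z) + \<i> * of_real (- 2) * cis (- (2 * z)) * cnj (V z)) * (of_real (1 / z) / (4 * \<i>))) (at z)"
      unfolding G_def[abs_def]
      by (intro has_vector_derivative_mult has_vector_derivative_divide 1 2 has_vector_derivative_cnj V_deriv z)
    moreover have "cis (- (2 * z)) * cnj (V z) * (of_real (- (1 / z ^ 2)) / (4 * \<i>))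
        + (cis (- (2 * z)) * cnj (V' z) + \<i> * of_real (- 2) * cis (- (2 * z)) * cnj (V z)) * (of_real (1 / z) / (4 * \<i>)) = V' z + E z"
      using z by (simp add: V'_def E_def field_simps power2_eq_square)
    ultimately show ?thesis by simp
  qed
  have E_le: "norm (E z) \<le> B / z ^ 2" if z: "z \<ge> 1" for z
  proof -
    have "norm (E z) \<le> (norm (V' z) * (1 / z) + norm (V z) * (1 / z ^ 2)) / 4"
      unfolding E_def norm_divide using z
      by (auto intro!: divide_right_mono order_trans[OF norm_triangle_ineq4] simp: norm_mult norm_divide norm_power)
    also have "\<dots> \<le> (B / (2 * z) * (1 / z) + B * (1 / z ^ 2)) / 4"
      using z V'_le[OF z] V_le[OF z] by (intro divide_right_mono add_mono mult_right_mono) auto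
    also have "\<dots> = 3 / 8 * (B / z ^ 2)" using z by (simp add: field_simps power2_eq_square)
    also have "\<dots> \<le> 1 * (B / z ^ 2)" using B0 by (intro mult_right_mono) auto
    also have "\<dots> = B / z ^ 2" by simp
    finally show ?thesis .
  qed
  have V_diff: "norm (V y - V z) \<le> 2 * B / z" if z: "1 \<le> z" "z < y" for y z
  proof -
    have d: "((\<lambda>t. V t - G t) has_vector_derivative V' t - (V' t + E t)) (at t)" if "t \<ge> z" for t
      using that z by (intro has_vector_derivative_diff V_deriv G_deriv) auto
    have "norm ((V y - G y) - (V z - G z)) \<le> - (B / y) - (- (B / z))"
    proof (rule differentiable_bound_general[where \<phi> = "\<lambda>t. - (B / t)" and f = "\<lambda>t. V t - G t"])
      show "continuous_on {z..y} (\<lambda>t. V t - G t)"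
        by (rule continuous_on_vector_derivative[OF has_vector_derivative_at_within[OF d]]) auto
      show "continuous_on {z..y} (\<lambda>t. - (B / t))" using z by (intro continuous_intros) auto
      fix t assume t: "z < t" "t < y"
      show "((\<lambda>t. V t - G t) has_vector_derivative V' t - (V' t + E t)) (at t)" using t by (intro d) auto
      show "((\<lambda>t. - (B / t)) has_vector_derivative B / t ^ 2) (at t)"
        unfolding has_real_derivative_iff_has_vector_derivative[symmetric]
        using t z by (auto intro!: derivative_eq_intros simp: power2_eq_square)
      show "norm (V' t - (V' t + E t)) \<le> B / t ^ 2" using E_le[of t] t z by simp
    qed (use z in auto)
    also have "\<dots> \<le> B / z" using B0 z by simp
    finally have 1: "norm ((V y - G y) - (V z - G z)) \<le> B / z" .
    have G_le: "norm (G t) \<le> B / (4 * z)" if "t \<ge> z" for t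
    proof -
      have "norm (G t) = norm (V t) / (4 * t)" using that z by (simp add: G_def norm_mult norm_divide)
      also have "\<dots> \<le> B / (4 * z)" using that z V_le[of t] B0 by (intro frac_le) auto
      finally show ?thesis .
    qed
    have "norm (((V y - G y) - (V z - G z)) + (G y - G z)) \<le> B / z + (B / (4 * z) + B / (4 * z))"
      using z by (intro norm_triangle_mono 1 norm_triangle_le_diff add_mono G_le) auto
    also have "\<dots> \<le> 2 * B / z" using B0 z by (simp add: field_simps)
    finally show ?thesis by simp
  qed
  have V_strong: "norm (hankel_const - V z) \<le> 2 * B / z" if z: "z \<ge> 1" for z
  proof -
    have "((\<lambda>y. V y - hankel_const) \<longlongrightarrow> 0) at_top"
    proof (rule Lim_null_comparison)
      show "\<forall>\<^sub>F y in at_top. norm (V y - hankel_const) \<le> 60 / sqrt y"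
        using eventually_gt_at_top[of 0] by eventually_elim (rule V_weak)
      show "((\<lambda>y. 60 / sqrt y) \<longlongrightarrow> 0) at_top"
        by (intro tendsto_divide_0[OF tendsto_const] filterlim_at_top_imp_at_infinity sqrt_at_top)
    qed
    then have "(V \<longlongrightarrow> hankel_const) at_top" by (rule LIM_zero_cancel)
    then have "((\<lambda>y. norm (V y - V z)) \<longlongrightarrow> norm (hankel_const - V z)) at_top" by (intro tendsto_intros)
    moreover have "\<forall>\<^sub>F y in at_top. norm (V y - V z) \<le> 2 * B / z"
      using eventually_gt_at_top[of z] by eventually_elim (use V_diff z in auto)
    ultimately show ?thesis by (rule tendsto_upperbound) simp
  qed
  define C where "C = 2 * B + (2 + norm hankel_const / sqrt z0) + 1"
  show ?thesis
  proof
    have "norm hankel_const / sqrt z0 \<ge> 0" using z0 by simp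
    then show Cpos: "C > 0" using B0 unfolding C_def by linarith
    fix z assume z: "z \<ge> z0"
    have zp: "z > 0" using z z0 by simp
    show "norm (hankel z - hankel_const * cis z / of_real (sqrt z)) \<le> C / (z * sqrt z)"
    proof (cases "z \<ge> 1")
      case True
      have "cis z * cis (- z) = 1" by (simp add: cis_mult)
      then have "hankel z = cis z * V z / of_real (sqrt z)"
        using zp by (simp add: V_def mult.assoc[symmetric])
      then have "hankel z - hankel_const * cis z / of_real (sqrt z) = - (cis z * (hankel_const - V z) / of_real (sqrt z))"
        by (simp add: algebra_simps diff_divide_distrib)
      then have "norm (hankel z - hankel_const * cis z / of_real (sqrt z)) = norm (hankel_const - V z) / sqrt z"
        using zp by (simp add: norm_mult norm_divide)
      also have "\<dots> \<le> (2 * B / z) / sqrt z" using zp True by (intro divide_right_mono V_strong) auto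
      also have "\<dots> = 2 * B / (z * sqrt z)" by simp
      also have "\<dots> \<le> C / (z * sqrt z)" using zp z0 by (intro divide_right_mono) (auto simp: C_def)
      finally show ?thesis .
    next
      case False
      have "norm (hankel z - hankel_const * cis z / of_real (sqrt z)) \<le> norm (hankel z) + norm (hankel_const * cis z / of_real (sqrt z))"
        by (rule norm_triangle_ineq4)
      also have "\<dots> \<le> 2 + norm hankel_const / sqrt z0"
        using norm_hankel_le[of z] z z0 zp
        by (intro add_mono) (auto simp: norm_divide norm_mult intro!: divide_left_mono)
      also have "\<dots> \<le> C" using B0 by (simp add: C_def)
      also have "\<dots> \<le> C / (z * sqrt z)"
      proof -
        have "z * sqrt z \<le> 1 * 1" using False zp by (intro mult_mono) auto
        then show ?thesis using Cpos zp by (simp add: pos_le_divide_eq mult_left_le)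
      qed
      finally show ?thesis .
    qed
  qed
qed

lemma wallis_integral:
  "((\<lambda>t. cos t ^ (2 * k)) has_integral (pi / 2 * (fact (2 * k) / (4 ^ k * fact k ^ 2)))) {0..pi / 2}"
proof (induction k)
  case 0
  then show ?case using has_integral_const_real[of "1::real" 0 "pi / 2"] by simp
next
  case (Suc k)
  define I where "I = pi / 2 * (fact (2 * k) / (4 ^ k * fact k ^ 2) :: real)"
  have "((\<lambda>t. real (2 * k + 2) * cos t ^ (2 * Suc k) - real (2 * k + 1) * cos t ^ (2 * k))
      has_integral (cos (pi / 2) ^ (2 * k + 1) * sin (pi / 2) - cos 0 ^ (2 * k + 1) * sin 0)) {0..pi / 2}"
  proof (rule fundamental_theorem_of_calculus)
    fix t :: real assume "t \<in> {0..pi / 2}"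
    from DERIV_power[OF has_field_derivative_at_within[OF DERIV_cos], of "2 * k + 1" t "{0..pi / 2}"]
    have c: "((\<lambda>t. cos t ^ (2 * k + 1)) has_real_derivative real (2 * k + 1) * (- sin t * cos t ^ (2 * k))) (at t within {0..pi / 2})"
      by simp
    have "((\<lambda>t. cos t ^ (2 * k + 1) * sin t) has_real_derivative
       real (2 * k + 1) * cos t ^ (2 * k) * (- sin t) * sin t + cos t ^ (2 * k + 1) * cos t) (at t within {0..pi / 2})"
      by (rule DERIV_cong[OF DERIV_mult[OF c has_field_derivative_at_within[OF DERIV_sin]]]) (simp add: mult_ac)
    moreover have "real (2 * k + 1) * cos t ^ (2 * k) * (- sin t) * sin t + cos t ^ (2 * k + 1) * cos t
       = real (2 * k + 2) * cos t ^ (2 * Suc k) - real (2 * k + 1) * cos t ^ (2 * k)"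
    proof -
      have s: "sin t * sin t = 1 - cos t * cos t"
        using sin_squared_eq[of t] by (simp add: power2_eq_square)
      have eq: "real (2 * k + 1) * cos t ^ (2 * k) * (- sin t) * sin t = - (real (2 * k + 1) * cos t ^ (2 * k) * (1 - cos t * cos t))"
        unfolding s[symmetric] by (simp only: mult_minus_left mult_minus_right mult.assoc)
      show ?thesis unfolding eq by (simp add: algebra_simps)
    qed
    ultimately show "((\<lambda>t. cos t ^ (2 * k + 1) * sin t) has_vector_derivative
       real (2 * k + 2) * cos t ^ (2 * Suc k) - real (2 * k + 1) * cos t ^ (2 * k)) (at t within {0..pi / 2})"
      by (simp only: has_real_derivative_iff_has_vector_derivative)
  qed simp
  then have 1: "((\<lambda>t. real (2 * k + 2) * cos t ^ (2 * Suc k) - real (2 * k + 1) * cos t ^ (2 * k)) has_integral 0) {0..pi / 2}"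
    by simp
  have "((\<lambda>t. (1 / real (2 * k + 2)) * ((real (2 * k + 2) * cos t ^ (2 * Suc k) - real (2 * k + 1) * cos t ^ (2 * k)) + real (2 * k + 1) * cos t ^ (2 * k)))
     has_integral ((1 / real (2 * k + 2)) * (0 + real (2 * k + 1) * I))) {0..pi / 2}"
    using Suc.IH unfolding I_def by (intro has_integral_mult_right has_integral_add 1)
  moreover have "(1 / real (2 * k + 2)) * (0 + real (2 * k + 1) * I) = pi / 2 * (fact (2 * Suc k) / (4 ^ Suc k * fact (Suc k) ^ 2))"
    by (simp add: I_def divide_simps power2_eq_square) (simp add: algebra_simps)
  ultimately show ?case by simp
qed

text \<open>
  Expanding the sine in \<open>cos t sin (z cos t)\<close> and integrating term by term with \<open>wallis_integral\<close>
  reproduces the power series of \<open>J\<^sub>1\<close>.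
\<close>
lemma bessel_J1_eq:
  assumes z: "z > 0"
  shows "bessel_J 1 (of_real z) = of_real (Re (hankel z))"
proof -
  define a where "a k t = (- 1) ^ k / fact (2 * k + 1) * z ^ (2 * k + 1) * cos t ^ (2 * (k + 1))" for k and t :: real
  define S where "S = (\<lambda>t. \<Sum>k. a k t)"
  define b where "b k = (- 1) ^ k / fact (2 * k + 1) * z ^ (2 * k + 1) * (pi / 2 * (fact (2 * (k + 1)) / (4 ^ (k + 1) * fact (k + 1) ^ 2)))" for k
  have S: "S t = cos t * sin (z * cos t)" for t
  proof -
    have "(\<lambda>k. cos t * ((- 1) ^ k / fact (2 * k + 1) * (z * cos t) ^ (2 * k + 1))) sums (cos t * sin (z * cos t))"
      by (intro sums_mult sin_paired)
    moreover have "cos t * ((- 1) ^ k / fact (2 * k + 1) * (z * cos t) ^ (2 * k + 1)) = a k t" for k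
      by (simp add: a_def power_mult_distrib)
    ultimately show ?thesis by (simp add: S_def sums_iff)
  qed
  have "uniform_limit {0..pi / 2} (\<lambda>N t. \<Sum>k<N. a k t) S sequentially"
    unfolding S_def
  proof (rule Weierstrass_m_test)
    fix k :: nat and t :: real
    have "\<bar>cos t\<bar> ^ (2 * (k + 1)) \<le> 1" by (rule power_le_one) auto
    then have "\<bar>cos t ^ (2 * (k + 1))\<bar> \<le> 1" by (simp only: power_abs)
    then have "norm (a k t) \<le> (1 / fact (2 * k + 1) * z ^ (2 * k + 1)) * 1"
      unfolding a_def norm_mult using z by (intro mult_mono) auto
    then show "norm (a k t) \<le> inverse (fact (2 * k + 1)) * z ^ (2 * k + 1)" by (simp add: divide_inverse)
  next
    have "summable ((\<lambda>k. inverse (fact k) * z ^ k) \<circ> (\<lambda>k. 2 * k + 1))"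
      using z by (intro summable_reindex summable_exp) (auto simp: inj_on_def)
    then show "summable (\<lambda>k. inverse (fact (2 * k + 1)) * z ^ (2 * k + 1))" by (simp add: o_def)
  qed
  then obtain I J where I: "\<And>N. ((\<lambda>t. \<Sum>k<N. a k t) has_integral I N) {0..pi / 2}"
    and J: "(S has_integral J) {0..pi / 2}" and lim: "I \<longlonglongrightarrow> J"
  proof (rule uniform_limit_integral)
    show "continuous_on {0..pi / 2} (\<lambda>t. \<Sum>k<N. a k t)" for N
      unfolding a_def by (intro continuous_intros)
  qed (rule sequentially_bot, rule that)
  have "((\<lambda>t. \<Sum>k<N. a k t) has_integral (\<Sum>k<N. b k)) {0..pi / 2}" for N
    unfolding a_def b_def by (intro has_integral_sum has_integral_mult_right wallis_integral) auto
  then have "I = (\<lambda>N. \<Sum>k<N. b k)" using I has_integral_unique by blast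
  then have "b sums J" using lim by (simp add: sums_def)
  moreover have "J = Im (poisson_integral 1 z)"
  proof -
    have "((\<lambda>t. Im (of_real (cos t ^ 1) * cis (z * cos t))) has_integral Im (poisson_integral 1 z)) {0..pi / 2}"
      by (intro has_integral_Im poisson_integral_has_integral)
    then have "(S has_integral Im (poisson_integral 1 z)) {0..pi / 2}" by (simp add: S[abs_def])
    then show ?thesis using J has_integral_unique by blast
  qed
  ultimately have "(\<lambda>k. 2 / pi * b k) sums (2 / pi * Im (poisson_integral 1 z))" by (intro sums_mult) simp
  moreover have "2 / pi * b k = z / 2 * ((- 1) ^ k / (fact (k + 1) * fact k) * (z / 2) ^ (2 * k))" for k
  proof -
    have f1: "(fact (2 * (k + 1)) :: real) = 2 * (real k + 1) * fact (2 * k + 1)"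
      by (simp add: algebra_simps)
    have f2: "(fact (k + 1) :: real) = (real k + 1) * fact k" by simp
    have p: "(z / 2) ^ (2 * k) = z ^ (2 * k) / 4 ^ k" "z ^ (2 * k + 1) = z * z ^ (2 * k)"
      "(4 :: real) ^ (k + 1) = 4 * 4 ^ k"
      by (simp_all add: power_divide power_mult)
    have gen: "2 / pi * (s / F * (z * Z) * (pi / 2 * (2 * K * F / (4 * P * (K * f) ^ 2)))) = z / 2 * (s / (K * f * f) * (Z / P))"
      if "F \<noteq> 0" "f \<noteq> 0" "K \<noteq> 0" "P \<noteq> 0" for s F Z K P f :: real
      using that by (simp add: field_simps power2_eq_square)
    show ?thesis
      unfolding b_def f1 f2 p by (rule gen) auto
  qed
  ultimately have "(\<lambda>k. z / 2 * ((- 1) ^ k / (fact (k + 1) * fact k) * (z / 2) ^ (2 * k))) sums Re (hankel z)"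
    by (simp add: hankel_def)
  from sums_divide[OF this, of "z / 2"]
  have "(\<lambda>k. (- 1) ^ k / (fact (k + 1) * fact k) * (z / 2) ^ (2 * k)) sums (Re (hankel z) / (z / 2))"
    using z by (simp del: fact_Suc)
  then have "(\<lambda>k. complex_of_real ((- 1) ^ k / (fact (k + 1) * fact k) * (z / 2) ^ (2 * k))) sums of_real (Re (hankel z) / (z / 2))"
    by (rule sums_of_real)
  moreover have "complex_of_real ((- 1) ^ k / (fact (k + 1) * fact k) * (z / 2) ^ (2 * k))
     = (- 1) ^ k * rGamma (1 + of_nat k + 1) / fact k * (of_real z / 2) ^ (2 * k)" for k
  proof -
    have r: "rGamma (1 + of_nat k + 1 :: complex) = inverse (fact (k + 1))"
      using Gamma_fact[of "k + 1", where 'a = complex] by (simp add: rGamma_inverse_Gamma add_ac)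
    show ?thesis unfolding r by (simp add: field_simps del: fact_Suc)
  qed
  ultimately have "(\<Sum>k. (- 1) ^ k * rGamma (1 + of_nat k + 1) / fact k * (of_real z / 2) ^ (2 * k)) = complex_of_real (Re (hankel z) / (z / 2))"
    by (simp add: sums_iff)
  then show ?thesis using z by (simp add: bessel_J_def)
qed

section \<open>Mixed partial derivatives of the bracket\<close>

text \<open>
  The span of the functions \<open>z powr (- j) hankel z\<close> with \<open>j \<ge> 1\<close> and their conjugates. It is closed
  under differentiation and under multiplication by \<open>1 / z\<close>. Away from 0 its members are
  \<open>O(z powr (- 3/2))\<close>, smaller than \<open>hankel\<close> by the factor \<open>1 / z\<close>.
\<close>
inductive lower_order :: "(real \<Rightarrow> complex) \<Rightarrow> bool" where
  zero: "lower_order (\<lambda>z. 0)"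
| hankel: "lower_order (\<lambda>z. c * of_real (1 / z) ^ Suc j * hankel z)"
| cnj_hankel: "lower_order (\<lambda>z. c * of_real (1 / z) ^ Suc j * cnj (hankel z))"
| add: "lower_order f \<Longrightarrow> lower_order g \<Longrightarrow> lower_order (\<lambda>z. f z + g z)"

lemma lower_order_cmult_inverse:
  assumes "lower_order L"
  shows "lower_order (\<lambda>z. c * of_real (1 / z) * L z)"
  using assms
proof induction
  case zero
  then show ?case using lower_order.zero by simp
next
  case (hankel c' j)
  have "(\<lambda>z. c * of_real (1 / z) * (c' * of_real (1 / z) ^ Suc j * hankel z))
     = (\<lambda>z. (c * c') * of_real (1 / z) ^ Suc (Suc j) * hankel z)"
    by (simp add: mult_ac)
  then show ?case by (simp only: lower_order.hankel)
next
  case (cnj_hankel c' j)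
  have "(\<lambda>z. c * of_real (1 / z) * (c' * of_real (1 / z) ^ Suc j * cnj (hankel z)))
     = (\<lambda>z. (c * c') * of_real (1 / z) ^ Suc (Suc j) * cnj (hankel z))"
    by (simp add: mult_ac)
  then show ?case by (simp only: lower_order.cnj_hankel)
next
  case (add f g)
  then show ?case unfolding distrib_left by (intro lower_order.add)
qed

lemma inverse_power_vector_derivative:
  assumes "z > 0"
  shows "((\<lambda>z. of_real (1 / z) ^ n :: complex) has_vector_derivative (- of_nat n * of_real (1 / z) ^ Suc n)) (at z)"
proof -
  have "((\<lambda>z. (1 / z) ^ n) has_real_derivative - real n * (1 / z) ^ Suc n) (at z)"
  proof (cases n)
    case (Suc k)
    have "((\<lambda>z. 1 / z) has_real_derivative - ((1 / z) ^ 2)) (at z)"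
      using assms by (auto intro!: derivative_eq_intros simp: power2_eq_square)
    from DERIV_power[OF this, of n] show ?thesis
      by (rule DERIV_cong) (use assms in \<open>simp add: Suc power2_eq_square field_simps\<close>)
  qed simp
  then have "((\<lambda>z. of_real ((1 / z) ^ n) :: complex) has_vector_derivative of_real (- real n * (1 / z) ^ Suc n)) (at z)"
    by (rule has_vector_derivative_of_real)
  then show ?thesis by simp
qed

lemma hankel_term_derivative:
  assumes "z > 0"
  shows "((\<lambda>z. c * of_real (1 / z) ^ n * hankel z) has_vector_derivative
     ((- of_nat n * c - c / 2) * of_real (1 / z) ^ Suc n * hankel z + (c * \<i>) * of_real (1 / z) ^ n * hankel z
       + (- c / 2) * of_real (1 / z) ^ Suc n * cnj (hankel z))) (at z)"
proof -
  have "((\<lambda>z. c * (of_real (1 / z) ^ n * hankel z)) has_vector_derivative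
     c * (of_real (1 / z) ^ n * (\<i> * hankel z - (hankel z + cnj (hankel z)) / (2 * of_real z))
        + (- of_nat n * of_real (1 / z) ^ Suc n) * hankel z)) (at z)"
    by (intro has_vector_derivative_mult_right has_vector_derivative_mult
        inverse_power_vector_derivative hankel_vector_derivative assms)
  moreover have "c * (of_real (1 / z) ^ n * (\<i> * hankel z - (hankel z + cnj (hankel z)) / (2 * of_real z))
        + (- of_nat n * of_real (1 / z) ^ Suc n) * hankel z)
     = (- of_nat n * c - c / 2) * of_real (1 / z) ^ Suc n * hankel z + (c * \<i>) * of_real (1 / z) ^ n * hankel z
       + (- c / 2) * of_real (1 / z) ^ Suc n * cnj (hankel z)"
  proof -
    have d: "(hankel z + cnj (hankel z)) / (2 * of_real z) = of_real (1 / z) * (hankel z + cnj (hankel z)) / 2" by simp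
    show ?thesis unfolding d power_Suc by (simp add: algebra_simps del: of_real_divide)
  qed
  ultimately show ?thesis by (simp add: mult.assoc)
qed

lemma cnj_hankel_term_derivative:
  assumes "z > 0"
  shows "((\<lambda>z. c * of_real (1 / z) ^ n * cnj (hankel z)) has_vector_derivative
     ((- of_nat n * c - c / 2) * of_real (1 / z) ^ Suc n * cnj (hankel z) + (- c * \<i>) * of_real (1 / z) ^ n * cnj (hankel z)
       + (- c / 2) * of_real (1 / z) ^ Suc n * hankel z)) (at z)"
  using has_vector_derivative_cnj[OF hankel_term_derivative[OF assms, of "cnj c" n]] by simp

lemma lower_order_derivative:
  assumes "lower_order L"
  shows "\<exists>L'. lower_order L' \<and> (\<forall>z>0. (L has_vector_derivative L' z) (at z))"
  using assms
proof induction
  case zero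
  then show ?case using lower_order.zero by (intro exI[of _ "\<lambda>z. 0"]) simp
next
  case (hankel c j)
  show ?case
    by (intro exI conjI allI impI; (rule hankel_term_derivative, assumption)?)
       (intro lower_order.intros)
next
  case (cnj_hankel c j)
  show ?case
    by (intro exI conjI allI impI; (rule cnj_hankel_term_derivative, assumption)?)
       (intro lower_order.intros)
next
  case (add f g)
  then obtain f' g' where "lower_order f'" "\<forall>z>0. (f has_vector_derivative f' z) (at z)"
    "lower_order g'" "\<forall>z>0. (g has_vector_derivative g' z) (at z)" by blast
  then show ?case
    by (intro exI[of _ "\<lambda>z. f' z + g' z"]) (auto intro: lower_order.add has_vector_derivative_add)
qed

lemma hankel_bound:
  assumes z0: "z0 > 0"
  obtains C where "C > 0" "\<And>z. z \<ge> z0 \<Longrightarrow> norm (hankel z) \<le> C / sqrt z"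
proof -
  obtain C where C: "C > 0"
    "\<And>z. z \<ge> z0 \<Longrightarrow> norm (hankel z - hankel_const * cis z / of_real (sqrt z)) \<le> C / (z * sqrt z)"
    by (rule hankel_asymptotic[OF z0]) blast
  show ?thesis
  proof
    show "norm hankel_const + C / z0 > 0" using C z0 by (simp add: add_nonneg_pos)
    fix z assume z: "z \<ge> z0"
    have "norm (hankel z) \<le> norm (hankel_const * cis z / of_real (sqrt z)) + norm (hankel z - hankel_const * cis z / of_real (sqrt z))"
      by (metis norm_triangle_sub)
    also have "norm (hankel_const * cis z / of_real (sqrt z)) = norm hankel_const / sqrt z"
      using z z0 by (simp add: norm_divide norm_mult)
    also have "norm (hankel z - hankel_const * cis z / of_real (sqrt z)) \<le> C / (z0 * sqrt z)"
      using C(2)[OF z] by (rule order_trans) (use C z z0 in \<open>auto intro!: divide_left_mono mult_right_mono\<close>)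
    finally show "norm (hankel z) \<le> (norm hankel_const + C / z0) / sqrt z"
      by (simp add: add_divide_distrib)
  qed
qed

lemma lower_order_bound:
  assumes "lower_order L" and z0: "z0 > 0"
  shows "\<exists>C\<ge>0. \<forall>z\<ge>z0. norm (L z) \<le> C / (z * sqrt z)"
proof -
  obtain B where B: "B > 0" "\<And>z. z \<ge> z0 \<Longrightarrow> norm (hankel z) \<le> B / sqrt z"
    by (rule hankel_bound[OF z0]) blast
  have term_le: "norm c * (1 / z) ^ Suc j * norm (hankel z) \<le> (norm c * (1 / z0) ^ j * B) / (z * sqrt z)"
    if z: "z \<ge> z0" for c :: complex and j z
  proof -
    have "norm c * ((1 / z) ^ j * (1 / z)) * norm (hankel z) \<le> norm c * ((1 / z0) ^ j * (1 / z)) * (B / sqrt z)"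
      using z z0 B by (intro mult_mono power_mono divide_left_mono) auto
    then show ?thesis by (simp add: mult_ac)
  qed
  show ?thesis
    using assms(1)
  proof induction
    case zero
    then show ?case using z0 by (intro exI[of _ 0]) auto
  next
    case (hankel c j)
    show ?case
    proof (intro exI conjI allI impI)
      show "norm c * (1 / z0) ^ j * B \<ge> 0" using B z0 by simp
      show "norm (c * of_real (1 / z) ^ Suc j * hankel z) \<le> (norm c * (1 / z0) ^ j * B) / (z * sqrt z)"
        if "z \<ge> z0" for z using term_le[OF that, of c j] that z0 by (simp add: norm_mult norm_power norm_divide)
    qed
  next
    case (cnj_hankel c j)
    show ?case
    proof (intro exI conjI allI impI)
      show "norm c * (1 / z0) ^ j * B \<ge> 0" using B z0 by simp
      show "norm (c * of_real (1 / z) ^ Suc j * cnj (hankel z)) \<le> (norm c * (1 / z0) ^ j * B) / (z * sqrt z)"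
        if "z \<ge> z0" for z using term_le[OF that, of c j] that z0 by (simp add: norm_mult norm_power norm_divide)
    qed
  next
    case (add f g)
    then obtain C1 C2 where C: "C1 \<ge> 0" "C2 \<ge> 0" "\<forall>z\<ge>z0. norm (f z) \<le> C1 / (z * sqrt z)"
      "\<forall>z\<ge>z0. norm (g z) \<le> C2 / (z * sqrt z)" by blast
    then have "norm (f z + g z) \<le> (C1 + C2) / (z * sqrt z)" if "z \<ge> z0" for z
      unfolding add_divide_distrib using that by (intro norm_triangle_mono) auto
    then show ?case using C by (intro exI[of _ "C1 + C2"]) auto
  qed
qed

text \<open>The \<open>p\<close>-th derivative of \<open>J\<^sub>1\<close> up to terms of lower order.\<close>
definition leading_part :: "nat \<Rightarrow> real \<Rightarrow> complex" where
  "leading_part p z = (\<i> ^ p * hankel z + (- \<i>) ^ p * cnj (hankel z)) / 2"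

text \<open>
  The term with \<open>2 s / z\<close> is split off because it cancels the derivative of the power in
  \<open>bessel_term_derivative\<close>; what it takes away from \<open>L1\<close> is of lower order.
\<close>
lemma leading_part_step:
  assumes L: "lower_order L"
  shows "\<exists>L1. lower_order L1 \<and> (\<forall>z>0. ((\<lambda>z. leading_part p z + L z) has_vector_derivative
     (leading_part (Suc p) z + L1 z + 2 * s / of_real z * (leading_part p z + L z))) (at z))"
proof -
  obtain L' where L': "lower_order L'" "\<And>z. z > 0 \<Longrightarrow> (L has_vector_derivative L' z) (at z)"
    using lower_order_derivative[OF L] by blast
  define A where "A = \<i> ^ p / 2"
  define B where "B = (- \<i>) ^ p / 2"
  define M where "M z = (((- A / 2 - B / 2 - 2 * s * A) * of_real (1 / z) ^ Suc 0 * hankel z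
     + (- A / 2 - B / 2 - 2 * s * B) * of_real (1 / z) ^ Suc 0 * cnj (hankel z)) + L' z)
     + (- 2 * s) * of_real (1 / z) * L z" for z :: real
  have M: "lower_order M"
    unfolding M_def[abs_def] by (intro lower_order.intros lower_order_cmult_inverse L L')
  have "((\<lambda>z. leading_part p z + L z) has_vector_derivative
     (leading_part (Suc p) z + M z + 2 * s / of_real z * (leading_part p z + L z))) (at z)" if z: "z > 0" for z
  proof -
    have eq: "(\<lambda>z. leading_part p z + L z) = (\<lambda>z. (A * of_real (1 / z) ^ 0 * hankel z + B * of_real (1 / z) ^ 0 * cnj (hankel z)) + L z)"
      by (simp add: leading_part_def A_def B_def add_divide_distrib)
    have "((\<lambda>z. (A * of_real (1 / z) ^ 0 * hankel z + B * of_real (1 / z) ^ 0 * cnj (hankel z)) + L z) has_vector_derivative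
       ((((- of_nat 0 * A - A / 2) * of_real (1 / z) ^ Suc 0 * hankel z + (A * \<i>) * of_real (1 / z) ^ 0 * hankel z
       + (- A / 2) * of_real (1 / z) ^ Suc 0 * cnj (hankel z))
       + ((- of_nat 0 * B - B / 2) * of_real (1 / z) ^ Suc 0 * cnj (hankel z) + (- B * \<i>) * of_real (1 / z) ^ 0 * cnj (hankel z)
       + (- B / 2) * of_real (1 / z) ^ Suc 0 * hankel z)) + L' z)) (at z)"
      by (intro has_vector_derivative_add hankel_term_derivative cnj_hankel_term_derivative L' z)
    moreover have "(((- of_nat 0 * A - A / 2) * of_real (1 / z) ^ Suc 0 * hankel z + (A * \<i>) * of_real (1 / z) ^ 0 * hankel z
       + (- A / 2) * of_real (1 / z) ^ Suc 0 * cnj (hankel z))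
       + ((- of_nat 0 * B - B / 2) * of_real (1 / z) ^ Suc 0 * cnj (hankel z) + (- B * \<i>) * of_real (1 / z) ^ 0 * cnj (hankel z)
       + (- B / 2) * of_real (1 / z) ^ Suc 0 * hankel z)) + L' z
      = leading_part (Suc p) z + M z + 2 * s / of_real z * (leading_part p z + L z)"
    proof -
      have 1: "leading_part p z = A * hankel z + B * cnj (hankel z)"
        by (simp add: leading_part_def A_def B_def add_divide_distrib)
      have 2: "leading_part (Suc p) z = A * \<i> * hankel z + (- B * \<i>) * cnj (hankel z)"
        by (simp add: leading_part_def A_def B_def add_divide_distrib)
      have 3: "2 * s / of_real z = 2 * s * of_real (1 / z)" by simp
      show ?thesis unfolding 1 2 3 M_def by (simp add: algebra_simps del: of_real_divide)
    qed
    ultimately show ?thesis unfolding eq by simp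
  qed
  with M show ?thesis by blast
qed

text \<open>
  The shape of all mixed derivatives of a term of the bracket: powers of \<open>a\<close> and \<open>b\<close> times a
  function of \<open>z = 4 \<pi> sqrt (a b x)\<close> that behaves like the \<open>p\<close>-th derivative of \<open>J\<^sub>1\<close>.
\<close>
definition bessel_term :: "real \<Rightarrow> complex \<Rightarrow> complex \<Rightarrow> nat \<Rightarrow> (real \<Rightarrow> complex) \<Rightarrow> real \<Rightarrow> real \<Rightarrow> complex" where
  "bessel_term x s w p L a b =
     osc (- s) 0 0 a * osc (- w) 0 0 b * (leading_part p (4 * pi * sqrt (a * b * x)) + L (4 * pi * sqrt (a * b * x)))"

lemma bessel_term_commute: "bessel_term x s w p L a b = bessel_term x w s p L b a"
  by (simp add: bessel_term_def mult_ac)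

text \<open>
  The inner derivative of \<open>4 \<pi> sqrt (a b x)\<close> is \<open>2 \<pi> sqrt x\<close> times \<open>a powr (- 1/2) b powr (1/2)\<close>,
  which shifts both exponents. The derivative \<open>- s / a\<close> of the power is absorbed by
  \<open>leading_part_step\<close>.
\<close>
lemma bessel_term_derivative:
  assumes x: "x > 0" and L: "lower_order L"
  shows "\<exists>L1. lower_order L1 \<and> (\<forall>a>0. \<forall>b>0. ((\<lambda>a. bessel_term x s w p L a b) has_vector_derivative
     of_real (2 * pi * sqrt x) * bessel_term x (s + 1/2) (w - 1/2) (Suc p) L1 a b) (at a))"
proof -
  obtain L1 where L1: "lower_order L1" and step: "\<And>z. z > 0 \<Longrightarrow> ((\<lambda>z. leading_part p z + L z) has_vector_derivative
     (leading_part (Suc p) z + L1 z + 2 * s / of_real z * (leading_part p z + L z))) (at z)"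
    using leading_part_step[OF L, of p s] by blast
  have "((\<lambda>a. bessel_term x s w p L a b) has_vector_derivative
     of_real (2 * pi * sqrt x) * bessel_term x (s + 1/2) (w - 1/2) (Suc p) L1 a b) (at a)"
    if a: "a > 0" and b: "b > 0" for a b
  proof -
    define z where "z = 4 * pi * sqrt (a * b * x)"
    define S where "S = sqrt (a * b * x)"
    have S: "S > 0" using a b x by (simp add: S_def)
    have z: "z > 0" using a b x by (simp add: z_def)
    let ?R = "\<lambda>z. leading_part p z + L z"
    let ?Q = "leading_part (Suc p) z + L1 z"
    have dz: "((\<lambda>a. 4 * pi * sqrt (a * b * x)) has_vector_derivative z / (2 * a)) (at a)"
    proof -
      have "((\<lambda>a. a * b * x) has_real_derivative b * x) (at a)" by (auto intro!: derivative_eq_intros)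
      from DERIV_chain2[where f = sqrt and g = "\<lambda>a. a * b * x", OF DERIV_real_sqrt this] a b x
      have "((\<lambda>a. sqrt (a * b * x)) has_real_derivative inverse S / 2 * (b * x)) (at a)"
        by (simp add: S_def)
      then have "((\<lambda>a. 4 * pi * sqrt (a * b * x)) has_real_derivative 4 * pi * (inverse S / 2 * (b * x))) (at a)"
        by (rule DERIV_cmult)
      moreover have "4 * pi * (inverse S / 2 * (b * x)) = z / (2 * a)"
      proof -
        have "a * (b * x) = S * S" using a b x by (simp add: S_def mult_ac)
        then have "b * x = S * S / a" using a by (simp add: field_simps)
        then show ?thesis using S a unfolding z_def S_def[symmetric] by (simp add: field_simps)
      qed
      ultimately show ?thesis by (simp add: has_real_derivative_iff_has_vector_derivative)
    qed
    have dR: "((\<lambda>a. ?R (4 * pi * sqrt (a * b * x))) has_vector_derivative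
       (z / (2 * a)) *\<^sub>R (?Q + 2 * s / of_real z * ?R z)) (at a)"
      using vector_diff_chain_at[OF dz] step[OF z] unfolding z_def[symmetric] by (simp add: o_def z_def)
    have dE: "(osc (- s) 0 0 has_vector_derivative (- s / of_real a) * osc (- s) 0 0 a) (at a)"
      using osc_vector_derivative[OF a, of "- s" 0 0 UNIV] by simp
    have "((\<lambda>a. osc (- s) 0 0 a * (osc (- w) 0 0 b * ?R (4 * pi * sqrt (a * b * x)))) has_vector_derivative
        osc (- s) 0 0 a * (osc (- w) 0 0 b * ((z / (2 * a)) *\<^sub>R (?Q + 2 * s / of_real z * ?R z)))
        + (- s / of_real a) * osc (- s) 0 0 a * (osc (- w) 0 0 b * ?R (4 * pi * sqrt (a * b * x)))) (at a)"
      by (intro has_vector_derivative_mult dE has_vector_derivative_mult_right dR)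
    moreover have "osc (- s) 0 0 a * (osc (- w) 0 0 b * ((z / (2 * a)) *\<^sub>R (?Q + 2 * s / of_real z * ?R z)))
        + (- s / of_real a) * osc (- s) 0 0 a * (osc (- w) 0 0 b * ?R (4 * pi * sqrt (a * b * x)))
       = of_real (2 * pi * sqrt x) * bessel_term x (s + 1/2) (w - 1/2) (Suc p) L1 a b"
    proof -
      have "(z / (2 * a)) *\<^sub>R (?Q + 2 * s / of_real z * ?R z) = of_real (z / (2 * a)) * ?Q + s / of_real a * ?R z"
        using z a by (simp add: scaleR_conv_of_real field_simps)
      then have "osc (- s) 0 0 a * (osc (- w) 0 0 b * ((z / (2 * a)) *\<^sub>R (?Q + 2 * s / of_real z * ?R z)))
        + (- s / of_real a) * osc (- s) 0 0 a * (osc (- w) 0 0 b * ?R (4 * pi * sqrt (a * b * x)))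
        = osc (- s) 0 0 a * osc (- w) 0 0 b * of_real (z / (2 * a)) * ?Q"
        unfolding z_def[symmetric] by (simp add: algebra_simps)
      also have "\<dots> = of_real (2 * pi * sqrt x) * ((osc (- s) 0 0 a * of_real (a powr (- 1/2))) * (osc (- w) 0 0 b * of_real (b powr (1/2)))) * ?Q"
      proof -
        have "z / (2 * a) = 2 * pi * sqrt x * (a powr (- 1/2) * b powr (1/2))"
          using a b x by (simp add: z_def real_sqrt_mult powr_minus powr_half_sqrt field_simps)
        then show ?thesis by (simp add: mult_ac)
      qed
      also have "osc (- s) 0 0 a * of_real (a powr (- 1/2)) = osc (- (s + 1/2)) 0 0 a"
        using osc_shift[OF a, of "- s" "- 1/2" 0 0] by (simp add: mult.commute)
      also have "osc (- w) 0 0 b * of_real (b powr (1/2)) = osc (- (w - 1/2)) 0 0 b"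
        using osc_shift[OF b, of "- w" "1/2" 0 0] by (simp add: mult.commute)
      finally show ?thesis by (simp add: bessel_term_def z_def mult_ac)
    qed
    ultimately show ?thesis by (simp add: bessel_term_def mult.assoc)
  qed
  with L1 show ?thesis by blast
qed

lemma shifted_vector_derivative:
  assumes "(g has_vector_derivative g') (at (c + t))"
  shows "((\<lambda>t. g (c + t)) has_vector_derivative g') (at t)"
proof -
  have "((\<lambda>t. c + t) has_vector_derivative 1) (at t)" by (auto intro!: derivative_eq_intros)
  from vector_diff_chain_at[OF this assms] show ?thesis by (simp add: o_def)
qed

lemma reflected_vector_derivative:
  assumes "(g has_vector_derivative g') (at (c + (1 - t)))"
  shows "((\<lambda>t. g (c + (1 - t))) has_vector_derivative - g') (at t)"
proof -
  have "((\<lambda>t. c + (1 - t)) has_vector_derivative - 1) (at t)" by (auto intro!: derivative_eq_intros)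
  from vector_diff_chain_at[OF this assms] show ?thesis by (simp add: o_def)
qed

lemma reflect_sum_derivative_fst:
  assumes d: "\<And>a b. a > 0 \<Longrightarrow> b > 0 \<Longrightarrow> ((\<lambda>a. f a b) has_vector_derivative f' a b) (at a)"
    and \<sigma>: "\<sigma> \<in> {0<..<1}" and \<theta>: "\<theta> \<in> {0<..<1}"
  shows "((\<lambda>\<sigma>. reflect_sum \<alpha> \<beta> (\<lambda>\<sigma> \<theta>. f (real m + \<sigma>) (real n + \<theta>)) \<sigma> \<theta>) has_vector_derivative
     reflect_sum (Suc \<alpha>) \<beta> (\<lambda>\<sigma> \<theta>. f' (real m + \<sigma>) (real n + \<theta>)) \<sigma> \<theta>) (at \<sigma>)"
proof -
  have 1: "((\<lambda>\<sigma>. f (real m + \<sigma>) b) has_vector_derivative f' (real m + \<sigma>) b) (at \<sigma>)"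
    "((\<lambda>\<sigma>. f (real m + (1 - \<sigma>)) b) has_vector_derivative - f' (real m + (1 - \<sigma>)) b) (at \<sigma>)" if "b > 0" for b
    using \<sigma> that by (intro shifted_vector_derivative reflected_vector_derivative d; simp)+
  have "((\<lambda>\<sigma>. f (real m + \<sigma>) (real n + \<theta>) + (- 1) ^ \<alpha> * f (real m + (1 - \<sigma>)) (real n + \<theta>)
      - (- 1) ^ \<beta> * f (real m + \<sigma>) (real n + (1 - \<theta>)) - (- 1) ^ (\<alpha> + \<beta>) * f (real m + (1 - \<sigma>)) (real n + (1 - \<theta>)))
     has_vector_derivative (f' (real m + \<sigma>) (real n + \<theta>) + (- 1) ^ \<alpha> * (- f' (real m + (1 - \<sigma>)) (real n + \<theta>))
      - (- 1) ^ \<beta> * f' (real m + \<sigma>) (real n + (1 - \<theta>)) - (- 1) ^ (\<alpha> + \<beta>) * (- f' (real m + (1 - \<sigma>)) (real n + (1 - \<theta>))))) (at \<sigma>)"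
    using \<theta> by (intro has_vector_derivative_add has_vector_derivative_diff has_vector_derivative_mult_right 1) auto
  then show ?thesis by (simp add: reflect_sum_def)
qed

lemma reflect_sum_derivative_snd:
  assumes d: "\<And>a b. a > 0 \<Longrightarrow> b > 0 \<Longrightarrow> ((\<lambda>b. f a b) has_vector_derivative f' a b) (at b)"
    and \<sigma>: "\<sigma> \<in> {0<..<1}" and \<theta>: "\<theta> \<in> {0<..<1}"
  shows "((\<lambda>\<theta>. reflect_sum \<alpha> \<beta> (\<lambda>\<sigma> \<theta>. f (real m + \<sigma>) (real n + \<theta>)) \<sigma> \<theta>) has_vector_derivative
     reflect_sum \<alpha> (Suc \<beta>) (\<lambda>\<sigma> \<theta>. f' (real m + \<sigma>) (real n + \<theta>)) \<sigma> \<theta>) (at \<theta>)"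
proof -
  have 1: "((\<lambda>\<theta>. f a (real n + \<theta>)) has_vector_derivative f' a (real n + \<theta>)) (at \<theta>)"
    "((\<lambda>\<theta>. f a (real n + (1 - \<theta>))) has_vector_derivative - f' a (real n + (1 - \<theta>))) (at \<theta>)" if "a > 0" for a
    using \<theta> that by (intro shifted_vector_derivative reflected_vector_derivative d; simp)+
  have "((\<lambda>\<theta>. f (real m + \<sigma>) (real n + \<theta>) + (- 1) ^ \<alpha> * f (real m + (1 - \<sigma>)) (real n + \<theta>)
      - (- 1) ^ \<beta> * f (real m + \<sigma>) (real n + (1 - \<theta>)) - (- 1) ^ (\<alpha> + \<beta>) * f (real m + (1 - \<sigma>)) (real n + (1 - \<theta>)))
     has_vector_derivative (f' (real m + \<sigma>) (real n + \<theta>) + (- 1) ^ \<alpha> * f' (real m + (1 - \<sigma>)) (real n + \<theta>)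
      - (- 1) ^ \<beta> * (- f' (real m + \<sigma>) (real n + (1 - \<theta>))) - (- 1) ^ (\<alpha> + \<beta>) * (- f' (real m + (1 - \<sigma>)) (real n + (1 - \<theta>))))) (at \<theta>)"
    using \<sigma> by (intro has_vector_derivative_add has_vector_derivative_diff has_vector_derivative_mult_right 1) auto
  then show ?thesis by (simp add: reflect_sum_def)
qed

lemma reflect_sum_cmult: "reflect_sum \<alpha> \<beta> (\<lambda>\<sigma> \<theta>. c * f \<sigma> \<theta>) \<sigma> \<theta> = c * reflect_sum \<alpha> \<beta> f \<sigma> \<theta>"
  by (simp add: reflect_sum_def algebra_simps)

lemma J1_quotient_eq:
  assumes "x > 0" "a > 0" "b > 0"
  shows "J1_quotient x s w a b = bessel_term x s w 0 (\<lambda>z. 0) a b"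
proof -
  have "bessel_J 1 (of_real (4 * pi * sqrt (a * b * x))) = leading_part 0 (4 * pi * sqrt (a * b * x))"
    using assms by (subst bessel_J1_eq) (auto simp: leading_part_def complex_eq_iff)
  then show ?thesis
    using assms powr_eq_osc[of a "- s"] powr_eq_osc[of b "- w"]
    by (simp add: J1_quotient_def bessel_term_def powr_minus divide_inverse mult_ac)
qed

lemma higher_vector_derivative_0 [simp]: "higher_vector_derivative 0 f = f"
  by (simp add: higher_vector_derivative_def)

lemma higher_vector_derivative_Suc:
  "higher_vector_derivative (Suc k) f t = vector_derivative (higher_vector_derivative k f) (at t)"
  by (simp add: higher_vector_derivative_def)

lemma vector_derivative_eq_on_open:
  assumes "\<And>t. t \<in> S \<Longrightarrow> f t = g t" "open S" "t \<in> S" "(g has_vector_derivative D) (at t)"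
  shows "vector_derivative f (at t) = D"
  using has_vector_derivative_transform_within_open[OF assms(4,2,3)] assms(1)
  by (intro vector_derivative_at) auto

text \<open>The same \<open>L\<close> serves for all \<open>m\<close> and \<open>n\<close>, so that bounds for its size are uniform in the series.\<close>
lemma theta_derivative:
  assumes x: "x > 0"
  shows "\<exists>L. lower_order L \<and> (\<forall>m n \<sigma> \<theta>. \<sigma> \<in> {0<..<1} \<longrightarrow> \<theta> \<in> {0<..<1} \<longrightarrow>
     higher_vector_derivative \<beta> (G_bracket x s w m n \<sigma>) \<theta> =
     of_real (2 * pi * sqrt x) ^ \<beta> * reflect_sum 0 \<beta>
       (\<lambda>\<sigma> \<theta>. bessel_term x (s - of_nat \<beta> / 2) (w + of_nat \<beta> / 2) \<beta> L (real m + \<sigma>) (real n + \<theta>)) \<sigma> \<theta>)"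
proof (induction \<beta>)
  case 0
  have "G_bracket x s w m n \<sigma> \<theta> = reflect_sum 0 0 (\<lambda>\<sigma> \<theta>. bessel_term x s w 0 (\<lambda>z. 0) (real m + \<sigma>) (real n + \<theta>)) \<sigma> \<theta>"
    if "\<sigma> \<in> {0<..<1}" "\<theta> \<in> {0<..<1}" for m n \<sigma> \<theta>
    using that x by (simp add: G_bracket_def reflect_sum_def J1_quotient_eq add_diff_eq)
  then show ?case using lower_order.zero by (intro exI[of _ "\<lambda>z. 0"]) simp
next
  case (Suc \<beta>)
  then obtain L where L: "lower_order L" and IH: "\<And>m n \<sigma> \<theta>. \<sigma> \<in> {0<..<1} \<Longrightarrow> \<theta> \<in> {0<..<1} \<Longrightarrow>
     higher_vector_derivative \<beta> (G_bracket x s w m n \<sigma>) \<theta> =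
     of_real (2 * pi * sqrt x) ^ \<beta> * reflect_sum 0 \<beta>
       (\<lambda>\<sigma> \<theta>. bessel_term x (s - of_nat \<beta> / 2) (w + of_nat \<beta> / 2) \<beta> L (real m + \<sigma>) (real n + \<theta>)) \<sigma> \<theta>"
    by blast
  let ?s = "s - of_nat \<beta> / 2" and ?w = "w + of_nat \<beta> / 2" and ?k = "of_real (2 * pi * sqrt x) :: complex"
  obtain L1 where L1: "lower_order L1" and d: "\<And>a b. a > 0 \<Longrightarrow> b > 0 \<Longrightarrow> ((\<lambda>b. bessel_term x ?w ?s \<beta> L b a) has_vector_derivative
     ?k * bessel_term x (?w + 1/2) (?s - 1/2) (Suc \<beta>) L1 b a) (at b)"
    using bessel_term_derivative[OF x L, of ?w ?s \<beta>] by blast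
  have e: "?w + 1/2 = w + of_nat (Suc \<beta>) / 2" "?s - 1/2 = s - of_nat (Suc \<beta>) / 2"
    by (simp_all add: add_divide_distrib)
  show ?case
  proof (intro exI[of _ L1] conjI allI impI L1)
    fix m n :: nat and \<sigma> \<theta> :: real assume st: "\<sigma> \<in> {0<..<1}" "\<theta> \<in> {0<..<1}"
    let ?f = "\<lambda>\<sigma> \<theta>. bessel_term x (s - of_nat (Suc \<beta>) / 2) (w + of_nat (Suc \<beta>) / 2) (Suc \<beta>) L1 (real m + \<sigma>) (real n + \<theta>)"
    have "((\<lambda>\<theta>. reflect_sum 0 \<beta> (\<lambda>\<sigma> \<theta>. bessel_term x ?s ?w \<beta> L (real m + \<sigma>) (real n + \<theta>)) \<sigma> \<theta>) has_vector_derivative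
       reflect_sum 0 (Suc \<beta>) (\<lambda>\<sigma> \<theta>. ?k * ?f \<sigma> \<theta>) \<sigma> \<theta>) (at \<theta>)"
    proof (rule reflect_sum_derivative_snd[OF _ st])
      show "((\<lambda>b. bessel_term x ?s ?w \<beta> L a b) has_vector_derivative
         ?k * bessel_term x (s - of_nat (Suc \<beta>) / 2) (w + of_nat (Suc \<beta>) / 2) (Suc \<beta>) L1 a b) (at b)"
        if "a > 0" "b > 0" for a b
        using d[OF that] unfolding e bessel_term_commute[of x ?w ?s] bessel_term_commute[of x "w + of_nat (Suc \<beta>) / 2"] .
    qed
    then have "((\<lambda>\<theta>. ?k ^ \<beta> * reflect_sum 0 \<beta> (\<lambda>\<sigma> \<theta>. bessel_term x ?s ?w \<beta> L (real m + \<sigma>) (real n + \<theta>)) \<sigma> \<theta>) has_vector_derivative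
       ?k ^ \<beta> * (?k * reflect_sum 0 (Suc \<beta>) ?f \<sigma> \<theta>)) (at \<theta>)"
      unfolding reflect_sum_cmult by (rule has_vector_derivative_mult_right)
    then have "higher_vector_derivative (Suc \<beta>) (G_bracket x s w m n \<sigma>) \<theta> = ?k ^ \<beta> * (?k * reflect_sum 0 (Suc \<beta>) ?f \<sigma> \<theta>)"
      unfolding higher_vector_derivative_Suc
      by (rule vector_derivative_eq_on_open[where S = "{0<..<1}", rotated 3]) (use IH st in auto)
    then show "higher_vector_derivative (Suc \<beta>) (G_bracket x s w m n \<sigma>) \<theta> = ?k ^ Suc \<beta> * reflect_sum 0 (Suc \<beta>) ?f \<sigma> \<theta>"
      by (simp only: power_Suc2 mult.assoc)
  qed
qed

lemma G_term_eq:
  assumes x: "x > 0"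
  shows "\<exists>L. lower_order L \<and> (\<forall>m n \<sigma> \<theta>. \<sigma> \<in> {0<..<1} \<longrightarrow> \<theta> \<in> {0<..<1} \<longrightarrow>
     G_term \<alpha> \<beta> x \<sigma> \<theta> s w m n =
     of_real (2 * pi * sqrt x) ^ (\<alpha> + \<beta>) * reflect_sum \<alpha> \<beta>
       (\<lambda>\<sigma> \<theta>. bessel_term x (s + of_nat \<alpha> / 2 - of_nat \<beta> / 2) (w + of_nat \<beta> / 2 - of_nat \<alpha> / 2) (\<alpha> + \<beta>) L
          (real m + \<sigma>) (real n + \<theta>)) \<sigma> \<theta>)"
proof (induction \<alpha>)
  case 0
  show ?case using theta_derivative[OF x, of \<beta> s w] by (simp add: G_term_def mixed_partial_def)
next
  case (Suc \<alpha>)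
  let ?s = "s + of_nat \<alpha> / 2 - of_nat \<beta> / 2" and ?w = "w + of_nat \<beta> / 2 - of_nat \<alpha> / 2"
  let ?k = "of_real (2 * pi * sqrt x) :: complex"
  obtain L where L: "lower_order L" and IH: "\<And>m n \<sigma> \<theta>. \<sigma> \<in> {0<..<1} \<Longrightarrow> \<theta> \<in> {0<..<1} \<Longrightarrow>
     G_term \<alpha> \<beta> x \<sigma> \<theta> s w m n = ?k ^ (\<alpha> + \<beta>) * reflect_sum \<alpha> \<beta>
       (\<lambda>\<sigma> \<theta>. bessel_term x ?s ?w (\<alpha> + \<beta>) L (real m + \<sigma>) (real n + \<theta>)) \<sigma> \<theta>"
    using Suc by blast
  obtain L1 where L1: "lower_order L1" and d: "\<And>a b. a > 0 \<Longrightarrow> b > 0 \<Longrightarrow> ((\<lambda>a. bessel_term x ?s ?w (\<alpha> + \<beta>) L a b) has_vector_derivative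
     ?k * bessel_term x (?s + 1/2) (?w - 1/2) (Suc (\<alpha> + \<beta>)) L1 a b) (at a)"
    using bessel_term_derivative[OF x L, of ?s ?w "\<alpha> + \<beta>"] by blast
  have e: "?s + 1/2 = s + of_nat (Suc \<alpha>) / 2 - of_nat \<beta> / 2" "?w - 1/2 = w + of_nat \<beta> / 2 - of_nat (Suc \<alpha>) / 2"
    by (simp_all add: add_divide_distrib)
  show ?case
  proof (intro exI[of _ L1] conjI allI impI L1)
    fix m n :: nat and \<sigma> \<theta> :: real assume st: "\<sigma> \<in> {0<..<1}" "\<theta> \<in> {0<..<1}"
    let ?f = "\<lambda>\<sigma> \<theta>. bessel_term x (s + of_nat (Suc \<alpha>) / 2 - of_nat \<beta> / 2) (w + of_nat \<beta> / 2 - of_nat (Suc \<alpha>) / 2)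
        (Suc \<alpha> + \<beta>) L1 (real m + \<sigma>) (real n + \<theta>)"
    have "((\<lambda>\<sigma>. reflect_sum \<alpha> \<beta> (\<lambda>\<sigma> \<theta>. bessel_term x ?s ?w (\<alpha> + \<beta>) L (real m + \<sigma>) (real n + \<theta>)) \<sigma> \<theta>) has_vector_derivative
       reflect_sum (Suc \<alpha>) \<beta> (\<lambda>\<sigma> \<theta>. ?k * ?f \<sigma> \<theta>) \<sigma> \<theta>) (at \<sigma>)"
      by (rule reflect_sum_derivative_fst[OF _ st]) (use d in \<open>simp only: e add_Suc\<close>)
    then have "((\<lambda>\<sigma>. ?k ^ (\<alpha> + \<beta>) * reflect_sum \<alpha> \<beta> (\<lambda>\<sigma> \<theta>. bessel_term x ?s ?w (\<alpha> + \<beta>) L (real m + \<sigma>) (real n + \<theta>)) \<sigma> \<theta>) has_vector_derivative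
       ?k ^ (\<alpha> + \<beta>) * (?k * reflect_sum (Suc \<alpha>) \<beta> ?f \<sigma> \<theta>)) (at \<sigma>)"
      unfolding reflect_sum_cmult by (rule has_vector_derivative_mult_right)
    then have "vector_derivative (\<lambda>\<sigma>. G_term \<alpha> \<beta> x \<sigma> \<theta> s w m n) (at \<sigma>) = ?k ^ (\<alpha> + \<beta>) * (?k * reflect_sum (Suc \<alpha>) \<beta> ?f \<sigma> \<theta>)"
      by (rule vector_derivative_eq_on_open[where S = "{0<..<1}", rotated 3]) (use IH st in auto)
    moreover have "G_term (Suc \<alpha>) \<beta> x \<sigma> \<theta> s w m n = vector_derivative (\<lambda>\<sigma>. G_term \<alpha> \<beta> x \<sigma> \<theta> s w m n) (at \<sigma>)"
      by (simp add: G_term_def mixed_partial_def higher_vector_derivative_Suc)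
    ultimately show "G_term (Suc \<alpha>) \<beta> x \<sigma> \<theta> s w m n = ?k ^ (Suc \<alpha> + \<beta>) * reflect_sum (Suc \<alpha>) \<beta> ?f \<sigma> \<theta>"
      by (simp only: add_Suc power_Suc2 mult.assoc)
  qed
qed

section \<open>Uniform convergence of the double series\<close>

definition lattice_term :: "real \<Rightarrow> complex \<Rightarrow> complex \<Rightarrow> real \<Rightarrow> real \<Rightarrow> complex" where
  "lattice_term x z w a b = of_real a powr z * osc w (2 * pi * sqrt (a * x)) 0 b"

lemma lattice_term_eq:
  assumes "a > 0" "b > 0"
  shows "lattice_term x z w a b = osc z 0 0 a * osc w 0 0 b * cis (4 * pi * sqrt (a * b * x))"
  using assms by (simp add: lattice_term_def osc_eq real_sqrt_mult mult_ac)

lemma cnj_lattice_term_eq: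
  assumes "a > 0" "b > 0"
  shows "cnj (lattice_term x (cnj z) (cnj w) a b) = osc z 0 0 a * osc w 0 0 b * cis (- (4 * pi * sqrt (a * b * x)))"
  unfolding lattice_term_eq[OF assms] by (simp add: cnj_osc cis_cnj)

text \<open>
  The asymptotics of \<open>hankel\<close> at \<open>4 \<pi> sqrt (a b x)\<close> give \<open>(a b) powr (- 1/4)\<close> in the main term and
  \<open>(a b) powr (- 3/4)\<close> in the error.
\<close>
lemma bessel_term_asymptotic:
  assumes x: "x > 0" and L: "lower_order L" and d: "d > 0"
  shows "\<exists>C\<ge>0. \<forall>a\<ge>d. \<forall>b\<ge>d. norm (bessel_term x s w p L a b
     - of_real (1 / (2 * sqrt (4 * pi * sqrt x))) *
        (\<i> ^ p * hankel_const * lattice_term x (- s - 1/4) (- w - 1/4) a b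
         + (- \<i>) ^ p * cnj hankel_const * cnj (lattice_term x (cnj (- s - 1/4)) (cnj (- w - 1/4)) a b)))
     \<le> C * a powr (- Re s - 3/4) * b powr (- Re w - 3/4)"
proof -
  define k where "k = 4 * pi * sqrt x"
  have k: "k > 0" using x by (simp add: k_def)
  define z0 where "z0 = k * sqrt (d * d)"
  have z0: "z0 > 0" using k d by (simp add: z0_def)
  obtain C1 where C1: "C1 > 0" and H: "\<And>z. z \<ge> z0 \<Longrightarrow> norm (hankel z - hankel_const * cis z / of_real (sqrt z)) \<le> C1 / (z * sqrt z)"
    by (rule hankel_asymptotic[OF z0]) blast
  obtain C2 where C2: "C2 \<ge> 0" and Lb: "\<And>z. z \<ge> z0 \<Longrightarrow> norm (L z) \<le> C2 / (z * sqrt z)"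
    using lower_order_bound[OF L z0] by blast
  define C where "C = (C1 + C2) / (k * sqrt k)"
  show ?thesis
  proof (intro exI[of _ C] conjI allI impI)
    show "C \<ge> 0" using C1 C2 k by (simp add: C_def)
    fix a b :: real assume ab: "a \<ge> d" "b \<ge> d"
    have a: "a > 0" and b: "b > 0" using ab d by auto
    define z where "z = 4 * pi * sqrt (a * b * x)"
    have zk: "z = k * sqrt (a * b)" by (simp add: z_def k_def real_sqrt_mult mult_ac)
    have z: "z \<ge> z0" unfolding zk z0_def using k ab d by (intro mult_left_mono real_sqrt_le_mono mult_mono) auto
    have zp: "z > 0" using z z0 by simp
    define h where "h = hankel_const * cis z / of_real (sqrt z)"
    define M where "M = (\<i> ^ p * h + (- \<i>) ^ p * cnj h) / 2"
    have P: "norm (leading_part p z - M) \<le> C1 / (z * sqrt z)"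
    proof -
      have "leading_part p z - M = (\<i> ^ p * (hankel z - h) + (- \<i>) ^ p * cnj (hankel z - h)) / 2"
        by (simp add: leading_part_def M_def algebra_simps diff_divide_distrib add_divide_distrib)
      also have "norm \<dots> \<le> (norm (hankel z - h) + norm (hankel z - h)) / 2"
        unfolding norm_divide
        by (intro divide_mono order_trans[OF norm_triangle_ineq])
           (simp_all add: norm_mult norm_power del: complex_cnj_diff)
      also have "\<dots> \<le> C1 / (z * sqrt z)" using H[OF z] by (simp add: h_def)
      finally show ?thesis .
    qed
    have sz: "1 / sqrt z = 1 / sqrt k * (a powr (- 1/4) * b powr (- 1/4))"
    proof -
      have "sqrt z = sqrt k * (a powr (1/4) * b powr (1/4))"
        using a b k by (simp add: zk real_sqrt_mult powr_half_sqrt[symmetric] powr_powr)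
      then show ?thesis using a b by (simp add: powr_minus field_simps)
    qed
    have sh: "osc (- s - 1/4) 0 0 a = of_real (a powr (- 1/4)) * osc (- s) 0 0 a"
      "osc (- w - 1/4) 0 0 b = of_real (b powr (- 1/4)) * osc (- w) 0 0 b"
      using osc_shift[OF a, of "- s" "- 1/4" 0 0] osc_shift[OF b, of "- w" "- 1/4" 0 0] by simp_all
    have main: "osc (- s) 0 0 a * osc (- w) 0 0 b * M = of_real (1 / (2 * sqrt k)) *
        (\<i> ^ p * hankel_const * lattice_term x (- s - 1/4) (- w - 1/4) a b
         + (- \<i>) ^ p * cnj hankel_const * cnj (lattice_term x (cnj (- s - 1/4)) (cnj (- w - 1/4)) a b))"
    proof -
      have "h = hankel_const * cis z * of_real (1 / sqrt z)" by (simp add: h_def)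
      moreover have "cnj h = cnj hankel_const * cis (- z) * of_real (1 / sqrt z)" by (simp add: h_def cis_cnj)
      ultimately have M: "M = of_real (1 / sqrt z) / 2 * (\<i> ^ p * hankel_const * cis z + (- \<i>) ^ p * cnj hankel_const * cis (- z))"
        unfolding M_def by (simp add: algebra_simps add_divide_distrib del: of_real_divide)
      show ?thesis
        unfolding cnj_lattice_term_eq[OF a b]
        unfolding lattice_term_eq[OF a b] sh z_def[symmetric] M sz
        by (simp add: algebra_simps add_divide_distrib)
    qed
    have "bessel_term x s w p L a b - osc (- s) 0 0 a * osc (- w) 0 0 b * M
       = osc (- s) 0 0 a * osc (- w) 0 0 b * ((leading_part p z - M) + L z)"
      unfolding bessel_term_def z_def[symmetric] by (simp add: algebra_simps)
    also have "norm \<dots> \<le> a powr (- Re s) * b powr (- Re w) * (C1 / (z * sqrt z) + C2 / (z * sqrt z))"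
      unfolding norm_mult using a b
      by (intro mult_mono norm_triangle_mono P Lb z) (auto simp: norm_osc)
    also have "\<dots> = C * a powr (- Re s - 3/4) * b powr (- Re w - 3/4)"
    proof -
      have "1 / (z * sqrt z) = (1 / sqrt z) ^ 3"
        using zp by (simp add: power3_eq_cube power_divide)
      also have "\<dots> = (1 / sqrt k) ^ 3 * (a powr (- 3/4) * b powr (- 3/4))"
      proof -
        have "(t powr (- 1/4)) ^ 3 = t powr (- 3/4)" if "t > 0" for t :: real
          using that by (simp add: powr_power)
        with a b show ?thesis unfolding sz power_mult_distrib by simp
      qed
      also have "(1 / sqrt k) ^ 3 = 1 / (k * sqrt k)"
        using k by (simp add: power3_eq_cube power_divide)
      finally have e: "1 / (z * sqrt z) = 1 / (k * sqrt k) * (a powr (- 3/4) * b powr (- 3/4))" .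
      have pa: "a powr (- Re s - 3/4) = a powr (- Re s) * a powr (- 3/4)"
        using powr_add[of a "- Re s" "- 3/4"] by simp
      have pb: "b powr (- Re w - 3/4) = b powr (- Re w) * b powr (- 3/4)"
        using powr_add[of b "- Re w" "- 3/4"] by simp
      have "C1 / (z * sqrt z) + C2 / (z * sqrt z) = (C1 + C2) * (1 / (z * sqrt z))" by (simp add: add_divide_distrib)
      then show ?thesis unfolding e pa pb C_def by (simp add: mult_ac)
    qed
    finally show "norm (bessel_term x s w p L a b
     - of_real (1 / (2 * sqrt (4 * pi * sqrt x))) *
        (\<i> ^ p * hankel_const * lattice_term x (- s - 1/4) (- w - 1/4) a b
         + (- \<i>) ^ p * cnj hankel_const * cnj (lattice_term x (cnj (- s - 1/4)) (cnj (- w - 1/4)) a b)))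
     \<le> C * a powr (- Re s - 3/4) * b powr (- Re w - 3/4)"
      unfolding main k_def .
  qed
qed

text \<open>
  For fixed \<open>m\<close> the frequency in \<open>n\<close> is at most \<open>\<pi>\<close> for all \<open>\<sigma> \<le> 1\<close> once \<open>n \<ge> 4 (m + 1) x\<close>, and the
  lower bound \<open>\<sigma> \<ge> d\<close> controls the remaining factors.
\<close>
lemma lattice_inner_uniform:
  assumes x: "x > 0" and w: "Re w < -1/2" and d: "d > 0"
  shows "series_uniform_on ({d..1} \<times> {d..1}) (\<lambda>n (\<sigma>, \<theta>). lattice_term x z w (real m + \<sigma>) (real n + \<theta>))"
proof -
  obtain C T where C: "C > 0" "T \<ge> 1" and bound:
    "\<And>c p N. c > 0 \<Longrightarrow> p \<ge> T \<Longrightarrow> c \<le> 3 * pi / 2 * sqrt p \<Longrightarrow>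
      norm (\<Sum>j<N. osc w c 0 (p + real j)) \<le> C * p powr (Re w + 1/2) / c"
    by (rule osc_sum_bound_sqrt[OF w]) blast
  define B where "B = (d powr Re z + (real m + 1) powr Re z) * (C / (2 * pi * sqrt (d * x)))"
  show ?thesis
  proof (rule series_uniform_tail_bound)
    show "(\<lambda>n. B * real n powr (Re w + 1/2)) \<longlonglongrightarrow> 0" using w by (intro powr_tendsto_zero) simp
    fix N1 N2 :: nat and p :: "real \<times> real"
    assume N1: "nat \<lceil>max T (4 * ((real m + 1) * x))\<rceil> \<le> N1" and p: "p \<in> {d..1} \<times> {d..1}"
    obtain \<sigma> \<theta> where p_eq: "p = (\<sigma>, \<theta>)" by (cases p)
    have st: "d \<le> \<sigma>" "\<sigma> \<le> 1" "d \<le> \<theta>" using p by (auto simp: p_eq)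
    have N1T: "real N1 \<ge> T" "real N1 \<ge> 4 * ((real m + 1) * x)"
      using N1 by (simp_all add: nat_le_iff ceiling_le_iff)
    define a where "a = real m + \<sigma>"
    have a: "a \<ge> d" "a \<le> real m + 1" "a > 0" using st d by (auto simp: a_def)
    define c where "c = 2 * pi * sqrt (a * x)"
    have c: "c \<ge> 2 * pi * sqrt (d * x)" "c > 0" using a x by (auto simp: c_def)
    have sum_eq: "(\<Sum>n\<in>{N1..<N2}. lattice_term x z w a (real n + \<theta>)) = of_real a powr z * (\<Sum>j<N2 - N1. osc w c 0 (real N1 + \<theta> + real j))"
    proof (cases "N1 \<le> N2")
      case True
      then show ?thesis
        by (subst sum.atLeastLessThan_shift_0)
           (simp add: lattice_term_def c_def atLeast0LessThan add_ac sum_distrib_left)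
    qed simp
    have apow: "a powr Re z \<le> d powr Re z + (real m + 1) powr Re z"
    proof (cases "Re z \<ge> 0")
      case True
      then have "a powr Re z \<le> (real m + 1) powr Re z" using a by (intro powr_mono2) auto
      then show ?thesis by (simp add: add_increasing)
    next
      case False
      then have "a powr Re z \<le> d powr Re z" using a d by (intro powr_mono2') auto
      then show ?thesis by (simp add: add_increasing2)
    qed
    have "norm (\<Sum>j<N2 - N1. osc w c 0 (real N1 + \<theta> + real j)) \<le> C * (real N1 + \<theta>) powr (Re w + 1/2) / c"
    proof (rule bound)
      have "4 * (a * x) \<le> 4 * ((real m + 1) * x)" using a x by simp
      also have "\<dots> \<le> real N1 + \<theta>" using N1T st d by simp
      finally have "sqrt (4 * (a * x)) \<le> sqrt (real N1 + \<theta>)" by simp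
      then have "2 * sqrt (a * x) \<le> sqrt (real N1 + \<theta>)" by (simp add: real_sqrt_mult)
      then have "pi * (2 * sqrt (a * x)) \<le> (3 * pi / 2) * sqrt (real N1 + \<theta>)"
        using a x by (intro mult_mono) auto
      then show "c \<le> 3 * pi / 2 * sqrt (real N1 + \<theta>)" by (simp add: c_def mult_ac)
    qed (use c N1T st d in auto)
    also have "\<dots> \<le> C * real N1 powr (Re w + 1/2) / (2 * pi * sqrt (d * x))"
      using C c N1T st d w x by (intro frac_le mult_left_mono powr_mono2') auto
    finally have "norm (\<Sum>n\<in>{N1..<N2}. lattice_term x z w a (real n + \<theta>))
       \<le> (d powr Re z + (real m + 1) powr Re z) * (C * real N1 powr (Re w + 1/2) / (2 * pi * sqrt (d * x)))"
      unfolding sum_eq norm_mult using apow a by (intro mult_mono) (auto simp: norm_powr_real_powr)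
    also have "\<dots> = B * real N1 powr (Re w + 1/2)" by (simp add: B_def)
    finally show "norm (\<Sum>n\<in>{N1..<N2}. case p of (\<sigma>, \<theta>) \<Rightarrow> lattice_term x z w (real m + \<sigma>) (real n + \<theta>)) \<le> B * real N1 powr (Re w + 1/2)"
      by (simp add: p_eq a_def)
  qed
qed

lemma lattice_sum_sums:
  assumes "x > 0" "Re w < -1/2" "\<sigma> > 0" "\<theta> > 0"
  shows "(\<lambda>n. lattice_term x z w (real m + \<sigma>) (real n + \<theta>)) sums lattice_sum x z w m \<sigma> \<theta>"
proof -
  have "summable (\<lambda>n. osc w (2 * pi * sqrt ((real m + \<sigma>) * x)) 0 (real n + \<theta>))"
    using osc_summable[of w "2 * pi * sqrt ((real m + \<sigma>) * x)" \<theta>] assms by (simp add: add.commute)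
  then show ?thesis unfolding lattice_term_def lattice_sum_def by (intro sums_mult summable_sums)
qed

lemma series_uniform_limit:
  assumes "series_uniform_on D g"
  shows "uniform_limit D (\<lambda>N p. \<Sum>n<N. g n p) (\<lambda>p. \<Sum>n. g n p) sequentially"
    and "p \<in> D \<Longrightarrow> summable (\<lambda>n. g n p)"
proof -
  from assms obtain l where l: "uniform_limit D (\<lambda>N p. \<Sum>n<N. g n p) l sequentially"
    by (auto simp: uniformly_convergent_on_def)
  have s: "(\<lambda>n. g n p) sums l p" if "p \<in> D" for p
    using tendsto_uniform_limitI[OF l that] by (simp add: sums_def)
  then have "uniform_limit D (\<lambda>N p. \<Sum>n<N. g n p) (\<lambda>p. \<Sum>n. g n p) sequentially
     \<longleftrightarrow> uniform_limit D (\<lambda>N p. \<Sum>n<N. g n p) l sequentially"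
    by (intro uniform_limit_cong') (auto simp: sums_iff)
  with l show "uniform_limit D (\<lambda>N p. \<Sum>n<N. g n p) (\<lambda>p. \<Sum>n. g n p) sequentially" by simp
  show "p \<in> D \<Longrightarrow> summable (\<lambda>n. g n p)" using s by (auto simp: sums_iff)
qed

lemma reflect_sum_sums:
  assumes "\<And>\<sigma> \<theta>. \<sigma> \<in> {d..1 - d} \<Longrightarrow> \<theta> \<in> {d..1 - d} \<Longrightarrow> (\<lambda>n. f n \<sigma> \<theta>) sums F \<sigma> \<theta>"
    and "\<sigma> \<in> {d..1 - d}" "\<theta> \<in> {d..1 - d}"
  shows "(\<lambda>n. reflect_sum \<alpha> \<beta> (f n) \<sigma> \<theta>) sums reflect_sum \<alpha> \<beta> F \<sigma> \<theta>"
  unfolding reflect_sum_def using assms(2,3)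
  by (intro sums_add sums_diff sums_mult assms(1)) auto

text \<open>
  Each term is a main term \<open>g\<close> built from \<open>lattice_term\<close> plus a remainder \<open>r\<close> that is dominated by
  the product of a convergent series in \<open>m\<close> and one in \<open>n\<close>. The inner sums of \<open>g\<close> are those of
  \<open>outer_series_uniform\<close>.
\<close>
lemma G_series_uniform:
  fixes x :: real and \<alpha> \<beta> :: nat and s w :: complex
  assumes x: "x > 0"
    and s: "4 * Re s + 2 * real \<alpha> - 2 * real \<beta> > 1"
    and w: "4 * Re w + 2 * real \<beta> - 2 * real \<alpha> > 1"
    and d: "d > 0"
  shows "iterated_series_uniform_on ({d..1 - d} \<times> {d..1 - d}) (\<lambda>m n (\<sigma>, \<theta>). G_term \<alpha> \<beta> x \<sigma> \<theta> s w m n)"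
proof -
  let ?D = "{d..1 - d} \<times> {d..1 - d}"
  define p where "p = \<alpha> + \<beta>"
  define S where "S = s + of_nat \<alpha> / 2 - of_nat \<beta> / 2"
  define W where "W = w + of_nat \<beta> / 2 - of_nat \<alpha> / 2"
  have S: "Re S > 1/4" and W: "Re W > 1/4" using s w by (simp_all add: S_def W_def)
  define z where "z = - S - 1/4"
  define v where "v = - W - 1/4"
  have z: "Re z < -1/2" and v: "Re v < -1/2" using S W by (simp_all add: z_def v_def)
  define k where "k = (of_real (2 * pi * sqrt x) :: complex) ^ p"
  obtain L where L: "lower_order L" and G: "\<And>m n \<sigma> \<theta>. \<sigma> \<in> {0<..<1} \<Longrightarrow> \<theta> \<in> {0<..<1} \<Longrightarrow>
     G_term \<alpha> \<beta> x \<sigma> \<theta> s w m n = k * reflect_sum \<alpha> \<beta> (\<lambda>\<sigma> \<theta>. bessel_term x S W p L (real m + \<sigma>) (real n + \<theta>)) \<sigma> \<theta>"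
    using G_term_eq[OF x, of \<alpha> \<beta> s w] unfolding S_def W_def p_def k_def by blast
  define c where "c = complex_of_real (1 / (2 * sqrt (4 * pi * sqrt x)))"
  define A where "A = \<i> ^ p * hankel_const"
  define B where "B = (- \<i>) ^ p * cnj hankel_const"
  define h where "h m n \<sigma> \<theta> = bessel_term x S W p L (real m + \<sigma>) (real n + \<theta>)" for m n :: nat and \<sigma> \<theta>
  define g where "g m n \<sigma> \<theta> = c * (A * lattice_term x z v (real m + \<sigma>) (real n + \<theta>)
     + B * cnj (lattice_term x (cnj z) (cnj v) (real m + \<sigma>) (real n + \<theta>)))" for m n :: nat and \<sigma> \<theta>
  define r where "r m n \<sigma> \<theta> = h m n \<sigma> \<theta> - g m n \<sigma> \<theta>" for m n \<sigma> \<theta>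
  obtain C where C: "C \<ge> 0" and r_le: "\<And>m n \<sigma> \<theta>. \<sigma> \<ge> d \<Longrightarrow> \<theta> \<ge> d \<Longrightarrow>
     norm (r m n \<sigma> \<theta>) \<le> C * (real m + \<sigma>) powr (- Re S - 3/4) * (real n + \<theta>) powr (- Re W - 3/4)"
  proof -
    obtain C where C: "C \<ge> 0" and le: "\<And>a b. a \<ge> d \<Longrightarrow> b \<ge> d \<Longrightarrow> norm (bessel_term x S W p L a b
     - c * (A * lattice_term x z v a b + B * cnj (lattice_term x (cnj z) (cnj v) a b)))
     \<le> C * a powr (- Re S - 3/4) * b powr (- Re W - 3/4)"
      using bessel_term_asymptotic[OF x L d, of S W p] unfolding c_def A_def B_def z_def v_def by blast
    show ?thesis
      by (rule that[OF C]) (unfold r_def h_def g_def, rule le, auto)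
  qed
  have eS: "- Re S - 3/4 < -1" and eW: "- Re W - 3/4 < -1" using S W by simp_all
  have DE: "q \<in> {d..1} \<times> {d..1}" if "q \<in> ?D" for q using that d by auto
  have g_inner: "series_uniform_on ?D (\<lambda>n q. g m n (fst q) (snd q))" for m
  proof -
    have "series_uniform_on ?D (\<lambda>n q. lattice_term x z v (real m + fst q) (real n + snd q))"
      if "Re v < -1/2" for z v
      using series_uniform_compose[where h = "\<lambda>q. q", OF lattice_inner_uniform[OF x that d] DE]
      by (simp add: case_prod_unfold)
    then show ?thesis
      unfolding g_def using v by (intro series_uniform_cmult series_uniform_add series_uniform_cnj) auto
  qed
  have r_inner: "series_uniform_on ?D (\<lambda>n q. r m n (fst q) (snd q))" for m
  proof (rule series_uniform_majorant[OF _ eW])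
    fix n :: nat and q assume n: "n \<ge> 1" and q: "q \<in> ?D"
    have q': "fst q \<ge> d" "snd q \<ge> d" using q by (auto simp: mem_Times_iff)
    have "norm (r m n (fst q) (snd q)) \<le> C * (real m + fst q) powr (- Re S - 3/4) * (real n + snd q) powr (- Re W - 3/4)"
      using q' by (rule r_le)
    also have "\<dots> \<le> C * d powr (- Re S - 3/4) * real n powr (- Re W - 3/4)"
      using q' d C n eS eW by (intro mult_mono powr_mono2' mult_left_mono) auto
    finally show "norm (r m n (fst q) (snd q)) \<le> (C * d powr (- Re S - 3/4)) * real n powr (- Re W - 3/4)" .
  qed
  have h_inner: "series_uniform_on ?D (\<lambda>n (\<sigma>, \<theta>). h m n \<sigma> \<theta>)" for m
    using series_uniform_add[OF g_inner[of m] r_inner[of m]] by (simp add: r_def case_prod_unfold)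
  have G': "(case q of (\<sigma>, \<theta>) \<Rightarrow> G_term \<alpha> \<beta> x \<sigma> \<theta> s w m n) = k * reflect_sum \<alpha> \<beta> (h m n) (fst q) (snd q)"
    if "q \<in> ?D" for q m n
    using that d G[of "fst q" "snd q" m n] by (auto simp: h_def[abs_def])
  have inner: "series_uniform_on ?D (\<lambda>n (\<sigma>, \<theta>). G_term \<alpha> \<beta> x \<sigma> \<theta> s w m n)" for m
  proof -
    have "series_uniform_on ?D (\<lambda>n q. k * reflect_sum \<alpha> \<beta> (h m n) (fst q) (snd q))"
      using series_uniform_reflect_sum[OF h_inner[of m], of \<alpha> \<beta>]
      by (intro series_uniform_cmult) (simp add: case_prod_unfold)
    then show ?thesis
      by (rule uniformly_convergent_cong[THEN iffD1, rotated -1]) (auto simp: G' intro!: sum.cong)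
  qed
  define R where "R m \<sigma> \<theta> = (\<Sum>n. r m n \<sigma> \<theta>)" for m \<sigma> \<theta>
  define T where "T m \<sigma> \<theta> = c * (A * lattice_sum x z v m \<sigma> \<theta> + B * cnj (lattice_sum x (cnj z) (cnj v) m \<sigma> \<theta>)) + R m \<sigma> \<theta>" for m \<sigma> \<theta>
  have r_sums: "(\<lambda>n. r m n \<sigma> \<theta>) sums R m \<sigma> \<theta>" if "\<sigma> \<in> {d..1 - d}" "\<theta> \<in> {d..1 - d}" for m \<sigma> \<theta>
    using series_uniform_limit(2)[OF r_inner[of m], of "(\<sigma>, \<theta>)"] that
    by (simp add: R_def summable_sums)
  have h_sums: "(\<lambda>n. h m n \<sigma> \<theta>) sums T m \<sigma> \<theta>" if st: "\<sigma> \<in> {d..1 - d}" "\<theta> \<in> {d..1 - d}" for m \<sigma> \<theta>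
  proof -
    have pos: "\<sigma> > 0" "\<theta> > 0" using st d by auto
    have "(\<lambda>n. cnj (lattice_term x (cnj z) (cnj v) (real m + \<sigma>) (real n + \<theta>))) sums cnj (lattice_sum x (cnj z) (cnj v) m \<sigma> \<theta>)"
      using v pos x by (subst sums_cnj) (auto intro: lattice_sum_sums)
    then have "(\<lambda>n. g m n \<sigma> \<theta>) sums (c * (A * lattice_sum x z v m \<sigma> \<theta> + B * cnj (lattice_sum x (cnj z) (cnj v) m \<sigma> \<theta>)))"
      unfolding g_def using v pos x by (intro sums_mult sums_add lattice_sum_sums)
    from sums_add[OF this r_sums[OF st, of m]] show ?thesis by (simp add: T_def r_def)
  qed
  have suminf_eq: "(\<Sum>n. case q of (\<sigma>, \<theta>) \<Rightarrow> G_term \<alpha> \<beta> x \<sigma> \<theta> s w m n) = k * reflect_sum \<alpha> \<beta> (T m) (fst q) (snd q)"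
    if q: "q \<in> ?D" for q m
  proof -
    have "(\<lambda>n. k * reflect_sum \<alpha> \<beta> (h m n) (fst q) (snd q)) sums (k * reflect_sum \<alpha> \<beta> (T m) (fst q) (snd q))"
      using q by (intro sums_mult reflect_sum_sums h_sums) auto
    then show ?thesis by (simp add: G'[OF q] sums_iff)
  qed
  obtain Q where Q: "Q \<ge> 0" "\<And>N \<theta>. \<theta> \<ge> d \<Longrightarrow> (\<Sum>n<N. (real n + \<theta>) powr (- Re W - 3/4)) \<le> Q"
    using shifted_powr_sum_bound[OF eW d] by blast
  have "series_uniform_on ?D (\<lambda>m q. R m (fst q) (snd q))"
  proof (rule series_uniform_majorant[OF _ eS])
    fix m :: nat and q assume m: "m \<ge> 1" and q: "q \<in> ?D"
    define \<sigma> where "\<sigma> = fst q"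
    define \<theta> where "\<theta> = snd q"
    have st: "\<sigma> \<in> {d..1 - d}" "\<theta> \<in> {d..1 - d}" using q by (auto simp: \<sigma>_def \<theta>_def)
    have lim: "(\<lambda>N. norm (\<Sum>n<N. r m n \<sigma> \<theta>)) \<longlonglongrightarrow> norm (R m \<sigma> \<theta>)"
      using r_sums[OF st, of m] by (intro tendsto_norm) (simp add: sums_def)
    have le: "norm (\<Sum>n<N. r m n \<sigma> \<theta>) \<le> C * Q * real m powr (- Re S - 3/4)" for N
    proof -
      have "norm (\<Sum>n<N. r m n \<sigma> \<theta>) \<le> (\<Sum>n<N. C * (real m + \<sigma>) powr (- Re S - 3/4) * (real n + \<theta>) powr (- Re W - 3/4))"
        using st by (intro sum_norm_le r_le) auto
      also have "\<dots> = C * (real m + \<sigma>) powr (- Re S - 3/4) * (\<Sum>n<N. (real n + \<theta>) powr (- Re W - 3/4))"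
        by (simp add: sum_distrib_left)
      also have "\<dots> \<le> C * real m powr (- Re S - 3/4) * Q"
        using C Q st d m eS by (intro mult_mono mult_left_mono powr_mono2' sum_nonneg) auto
      finally show ?thesis by (simp add: mult_ac)
    qed
    have "norm (R m \<sigma> \<theta>) \<le> C * Q * real m powr (- Re S - 3/4)"
      by (rule tendsto_upperbound[OF lim]) (auto intro: always_eventually le)
    then show "norm (R m (fst q) (snd q)) \<le> (C * Q) * real m powr (- Re S - 3/4)"
      by (simp add: \<sigma>_def \<theta>_def)
  qed
  then have R_outer: "series_uniform_on ?D (\<lambda>m (\<sigma>, \<theta>). reflect_sum \<alpha> \<beta> (R m) \<sigma> \<theta>)"
    by (intro series_uniform_reflect_sum) (simp add: case_prod_unfold)
  have main: "series_uniform_on ?D (\<lambda>m (\<sigma>, \<theta>). reflect_sum \<alpha> \<beta>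
    (\<lambda>\<sigma> \<theta>. A * lattice_sum x z v m \<sigma> \<theta> + B * cnj (lattice_sum x (cnj z) (cnj v) m \<sigma> \<theta>)) \<sigma> \<theta>)"
    unfolding A_def B_def p_def
    by (rule outer_series_uniform[OF x z v d hankel_const_times_fresnel])
  have "series_uniform_on ?D (\<lambda>m q. k * (c * reflect_sum \<alpha> \<beta>
    (\<lambda>\<sigma> \<theta>. A * lattice_sum x z v m \<sigma> \<theta> + B * cnj (lattice_sum x (cnj z) (cnj v) m \<sigma> \<theta>)) (fst q) (snd q)
     + reflect_sum \<alpha> \<beta> (R m) (fst q) (snd q)))"
    using main R_outer by (intro series_uniform_cmult series_uniform_add) (simp_all add: case_prod_unfold)
  then have outer: "series_uniform_on ?D (\<lambda>m q. k * reflect_sum \<alpha> \<beta> (T m) (fst q) (snd q))"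
    unfolding T_def[abs_def] reflect_sum_add reflect_sum_cmult .
  have "series_uniform_on ?D (\<lambda>m q. \<Sum>n. case q of (\<sigma>, \<theta>) \<Rightarrow> G_term \<alpha> \<beta> x \<sigma> \<theta> s w m n)"
    using outer by (rule uniformly_convergent_cong[THEN iffD1, rotated -1]) (auto simp: suminf_eq intro!: sum.cong)
  from series_uniform_limit(1)[OF this] series_uniform_limit(1)[OF inner]
  show ?thesis unfolding iterated_series_uniform_on_def by blast
qed

lemma compact_subset_open_unit_square:
  fixes K :: "(real \<times> real) set"
  assumes "compact K" "K \<subseteq> {0<..<1} \<times> {0<..<1}"
  obtains d where "d > 0" "K \<subseteq> {d..1 - d} \<times> {d..1 - d}"
proof (cases "K = {}")
  case True
  then show ?thesis using that[of 1] by simp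
next
  case False
  define f where "f q = min (min (fst q) (1 - fst q)) (min (snd q) (1 - snd q))" for q :: "real \<times> real"
  have "continuous_on K f" unfolding f_def by (intro continuous_intros)
  from continuous_attains_inf[OF assms(1) False this]
  obtain q where q: "q \<in> K" "\<And>y. y \<in> K \<Longrightarrow> f q \<le> f y" by blast
  have "f q > 0" using q(1) assms(2) by (auto simp: f_def)
  moreover have "K \<subseteq> {f q..1 - f q} \<times> {f q..1 - f q}"
    using q(2) by (fastforce simp: f_def mem_Times_iff)
  ultimately show ?thesis by (rule that)
qed

theorem theorem2p2:
  fixes x :: real and \<alpha> \<beta> :: nat and s w :: complex
  assumes "x > 0"
    and "4 * Re s + 2 * real \<alpha> - 2 * real \<beta> > 1"
    and "4 * Re w + 2 * real \<beta> - 2 * real \<alpha> > 1"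
    and "x \<in> \<int> \<Longrightarrow> Re s + Re w > 25 / 26"
    and "x \<notin> \<int> \<Longrightarrow> Re s + Re w > 5 / 6"
  shows "\<forall>K :: (real \<times> real) set. compact K \<and> K \<subseteq> {0<..<1} \<times> {0<..<1} \<longrightarrow>
    iterated_series_uniform_on K (\<lambda>m n (\<sigma>, \<theta>). G_term \<alpha> \<beta> x \<sigma> \<theta> s w m n)"
proof (intro allI impI)
  fix K :: "(real \<times> real) set"
  assume "compact K \<and> K \<subseteq> {0<..<1} \<times> {0<..<1}"
  then obtain d where d: "d > 0" "K \<subseteq> {d..1 - d} \<times> {d..1 - d}"
    using compact_subset_open_unit_square by blast
  from G_series_uniform[OF assms(1-3) d(1)]
  show "iterated_series_uniform_on K (\<lambda>m n (\<sigma>, \<theta>). G_term \<alpha> \<beta> x \<sigma> \<theta> s w m n)"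
    unfolding iterated_series_uniform_on_def using uniform_limit_on_subset[OF _ d(2)] by blast
qed

end
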